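(* Let $I$ be a nonzero radical Poisson ideal of $\mathrm{S}(W_+)$. (a) There exist a finitely generated reduced commutative $\Bbbk$-algebra $A$ and an injective algebra homomorphism $\mathrm{S}(W_+)/I\hookrightarrow A$. (b) If $I$ is prime, then there exist a finitely generated subalgebra $B$ of $\mathrm{S}(W_+)/I$ and $p\in B$ such that $\mathrm{S}(W_+)/I\subseteq B[p^{-1}]$ (inside the field of fractions of $\mathrm{S}(W_+)/I$). (c) The algebras $A$ in (a) and $B[p^{-1}]$ in (b) carry Poisson structures compatible with that of $\mathrm{S}(W_+)/I$: that is, $A$, $B$, $p$ may be chosen so that $A$ and $B[p^{-1}]$ are Poisson algebras and the embeddings $\mathrm{S}(W_+)/I\hookrightarrow A$ and $\mathrm{S}(W_+)/I\subseteq B[p^{-1}]$ are homomorphisms of Poisson algebras.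
   Context: $\Bbbk$ is a field of characteristic zero. The positive Witt algebra $W_+$ is the Lie algebra over $\Bbbk$ with basis $\{e_n : n\in\mathbb{Z}_{\geq 1}\}$ and bracket $[e_i,e_j]=(j-i)e_{i+j}$. Its symmetric algebra $\mathrm{S}(W_+)$ is the polynomial ring $\Bbbk[x_1,x_2,\dots]$ ($x_i$ being the image of $e_i$), with the Poisson bracket determined by $\{x_i,x_j\}=(j-i)x_{i+j}$ and the Leibniz rule. A Poisson ideal is an ideal $I$ with $\{f,g\}\in I$ for all $f\in I$, $g\in\mathrm{S}(W_+)$; the quotient $\mathrm{S}(W_+)/I$ is then a Poisson algebra. "Finitely generated" means finitely generated as a $\Bbbk$-algebra; "reduced" means having no nonzero nilpotents. *)

theory Defs
  imports
    "HOL-Library.Poly_Mapping"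
    "HOL-Algebra.QuotRing"
    "HOL-Algebra.Subrings"
    "HOL-Algebra.Algebraic_Closure_Type"
begin

section \<open>Algebras and Poisson algebras over a ring \<open>K\<close>\<close>

definition is_subalgebra ::
  "('k, 'c) ring_scheme \<Rightarrow> ('k, 'a, 'd) module_scheme \<Rightarrow> 'a set \<Rightarrow> bool" where
  "is_subalgebra K A B \<longleftrightarrow>
     subring B A \<and> (\<forall>c\<in>carrier K. \<forall>b\<in>B. c \<odot>\<^bsub>A\<^esub> b \<in> B)"

definition subalg_gen ::
  "('k, 'c) ring_scheme \<Rightarrow> ('k, 'a, 'd) module_scheme \<Rightarrow> 'a set \<Rightarrow> 'a set" where
  "subalg_gen K A G = \<Inter>{B. is_subalgebra K A B \<and> G \<subseteq> B}"

definition fg_subalgebra ::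
  "('k, 'c) ring_scheme \<Rightarrow> ('k, 'a, 'd) module_scheme \<Rightarrow> 'a set \<Rightarrow> bool" where
  "fg_subalgebra K A B \<longleftrightarrow>
     (\<exists>G. finite G \<and> G \<subseteq> carrier A \<and> B = subalg_gen K A G)"

definition fg_algebra ::
  "('k, 'c) ring_scheme \<Rightarrow> ('k, 'a, 'd) module_scheme \<Rightarrow> bool" where
  "fg_algebra K A \<longleftrightarrow> algebra K A \<and> fg_subalgebra K A (carrier A)"

definition reduced :: "('a, 'd) ring_scheme \<Rightarrow> bool" where
  "reduced A \<longleftrightarrow>
     (\<forall>x\<in>carrier A. \<forall>n::nat. x [^]\<^bsub>A\<^esub> n = \<zero>\<^bsub>A\<^esub> \<longrightarrow> x = \<zero>\<^bsub>A\<^esub>)"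

definition radical_ideal :: "'a set \<Rightarrow> ('a, 'd) ring_scheme \<Rightarrow> bool" where
  "radical_ideal I A \<longleftrightarrow>
     ideal I A \<and> (\<forall>x\<in>carrier A. \<forall>n::nat. x [^]\<^bsub>A\<^esub> n \<in> I \<longrightarrow> x \<in> I)"

definition alg_hom ::
  "('k, 'c) ring_scheme \<Rightarrow> ('k, 'a, 'd) module_scheme \<Rightarrow> ('k, 'b, 'e) module_scheme
     \<Rightarrow> ('a \<Rightarrow> 'b) set" where
  "alg_hom K A B =
     {h \<in> ring_hom A B. \<forall>c\<in>carrier K. \<forall>x\<in>carrier A. h (c \<odot>\<^bsub>A\<^esub> x) = c \<odot>\<^bsub>B\<^esub> h x}"

locale poisson_algebra = algebra K A
  for K :: "('k, 'c) ring_scheme" and A :: "('k, 'a, 'd) module_scheme" +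
  fixes br :: "'a \<Rightarrow> 'a \<Rightarrow> 'a"
  assumes br_closed:
      "\<lbrakk>x \<in> carrier A; y \<in> carrier A\<rbrakk> \<Longrightarrow> br x y \<in> carrier A"
    and br_add_left:
      "\<lbrakk>x \<in> carrier A; y \<in> carrier A; z \<in> carrier A\<rbrakk>
        \<Longrightarrow> br (x \<oplus>\<^bsub>A\<^esub> y) z = br x z \<oplus>\<^bsub>A\<^esub> br y z"
    and br_add_right:
      "\<lbrakk>x \<in> carrier A; y \<in> carrier A; z \<in> carrier A\<rbrakk>
        \<Longrightarrow> br x (y \<oplus>\<^bsub>A\<^esub> z) = br x y \<oplus>\<^bsub>A\<^esub> br x z"
    and br_smult_left:
      "\<lbrakk>c \<in> carrier K; x \<in> carrier A; y \<in> carrier A\<rbrakk>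
        \<Longrightarrow> br (c \<odot>\<^bsub>A\<^esub> x) y = c \<odot>\<^bsub>A\<^esub> br x y"
    and br_smult_right:
      "\<lbrakk>c \<in> carrier K; x \<in> carrier A; y \<in> carrier A\<rbrakk>
        \<Longrightarrow> br x (c \<odot>\<^bsub>A\<^esub> y) = c \<odot>\<^bsub>A\<^esub> br x y"
    and br_alternating:
      "x \<in> carrier A \<Longrightarrow> br x x = \<zero>\<^bsub>A\<^esub>"
    and br_jacobi:
      "\<lbrakk>x \<in> carrier A; y \<in> carrier A; z \<in> carrier A\<rbrakk>
        \<Longrightarrow> br x (br y z) \<oplus>\<^bsub>A\<^esub> br y (br z x) \<oplus>\<^bsub>A\<^esub> br z (br x y) = \<zero>\<^bsub>A\<^esub>"
    and br_leibniz:
      "\<lbrakk>x \<in> carrier A; y \<in> carrier A; z \<in> carrier A\<rbrakk>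
        \<Longrightarrow> br x (y \<otimes>\<^bsub>A\<^esub> z) = (br x y \<otimes>\<^bsub>A\<^esub> z) \<oplus>\<^bsub>A\<^esub> (y \<otimes>\<^bsub>A\<^esub> br x z)"

definition poisson_hom ::
  "('k, 'c) ring_scheme
     \<Rightarrow> ('k, 'a, 'd) module_scheme \<Rightarrow> ('a \<Rightarrow> 'a \<Rightarrow> 'a)
     \<Rightarrow> ('k, 'b, 'e) module_scheme \<Rightarrow> ('b \<Rightarrow> 'b \<Rightarrow> 'b) \<Rightarrow> ('a \<Rightarrow> 'b) set" where
  "poisson_hom K A brA B brB =
     {h \<in> alg_hom K A B. \<forall>x\<in>carrier A. \<forall>y\<in>carrier A. h (brA x y) = brB (h x) (h y)}"

definition poisson_ideal ::
  "'a set \<Rightarrow> ('a, 'd) ring_scheme \<Rightarrow> ('a \<Rightarrow> 'a \<Rightarrow> 'a) \<Rightarrow> bool" where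
  "poisson_ideal I A br \<longleftrightarrow> ideal I A \<and> (\<forall>f\<in>I. \<forall>g\<in>carrier A. br f g \<in> I)"


section \<open>Quotients\<close>

text \<open>The ring \<open>A Quot I\<close> with the induced scalar multiplication, and the induced
  bracket. As in the library's \<open>rcoset_mult\<close>, an operation on cosets is the union of the
  cosets of the results over all representatives; the lemmas below evaluate it.\<close>

definition quot_alg :: "('k, 'a, 'd) module_scheme \<Rightarrow> 'a set \<Rightarrow> ('k, 'a set) module" where
  "quot_alg A I =
     \<lparr>carrier = carrier (A Quot I), monoid.mult = monoid.mult (A Quot I),
      one = one (A Quot I), zero = zero (A Quot I), add = add (A Quot I),
      module.smult = (\<lambda>c U. \<Union>x\<in>U. I +>\<^bsub>A\<^esub> (c \<odot>\<^bsub>A\<^esub> x))\<rparr>"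

definition quot_bracket ::
  "('a, 'd) ring_scheme \<Rightarrow> ('a \<Rightarrow> 'a \<Rightarrow> 'a) \<Rightarrow> 'a set \<Rightarrow> 'a set \<Rightarrow> 'a set \<Rightarrow> 'a set" where
  "quot_bracket A br I U V = (\<Union>x\<in>U. \<Union>y\<in>V. I +>\<^bsub>A\<^esub> br x y)"

lemma quot_alg_smult_coset:
  assumes "algebra K A" "ideal I A" "c \<in> carrier K" "x \<in> carrier A"
  shows "c \<odot>\<^bsub>quot_alg A I\<^esub> (I +>\<^bsub>A\<^esub> x) = I +>\<^bsub>A\<^esub> (c \<odot>\<^bsub>A\<^esub> x)"
proof -
  interpret algebra K A by fact
  interpret I: ideal I A by fact
  have "I +>\<^bsub>A\<^esub> (c \<odot>\<^bsub>A\<^esub> y) = I +>\<^bsub>A\<^esub> (c \<odot>\<^bsub>A\<^esub> x)" if y: "y \<in> I +>\<^bsub>A\<^esub> x" for y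
  proof -
    obtain i where i: "i \<in> I" "y = i \<oplus>\<^bsub>A\<^esub> x"
      using y by (auto simp: a_r_coset_def')
    have iA: "i \<in> carrier A" using i(1) I.Icarr by auto
    have "c \<odot>\<^bsub>A\<^esub> i = (c \<odot>\<^bsub>A\<^esub> \<one>\<^bsub>A\<^esub>) \<otimes>\<^bsub>A\<^esub> i"
      using smult_assoc2[OF assms(3) one_closed iA] iA by simp
    then have "c \<odot>\<^bsub>A\<^esub> i \<in> I"
      using I.I_l_closed i(1) assms(3) by simp
    then have "c \<odot>\<^bsub>A\<^esub> y \<in> I +>\<^bsub>A\<^esub> (c \<odot>\<^bsub>A\<^esub> x)"
      using i iA assms(3,4) by (auto simp: a_r_coset_def' smult_r_distr)
    then show ?thesis
      using I.a_repr_independence' assms(3,4) by (metis smult_closed)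
  qed
  then have "(\<Union>y\<in>I +>\<^bsub>A\<^esub> x. I +>\<^bsub>A\<^esub> (c \<odot>\<^bsub>A\<^esub> y)) = (\<Union>y\<in>I +>\<^bsub>A\<^esub> x. I +>\<^bsub>A\<^esub> (c \<odot>\<^bsub>A\<^esub> x))"
    by (intro SUP_cong refl)
  moreover have "I +>\<^bsub>A\<^esub> x \<noteq> {}"
    using assms(4) I.a_rcos_self by blast
  ultimately show ?thesis
    by (simp add: quot_alg_def)
qed

lemma quot_bracket_coset:
  assumes "poisson_algebra K A br" "poisson_ideal I A br"
    and x: "x \<in> carrier A" and y: "y \<in> carrier A"
  shows "quot_bracket A br I (I +>\<^bsub>A\<^esub> x) (I +>\<^bsub>A\<^esub> y) = I +>\<^bsub>A\<^esub> br x y"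
proof -
  interpret poisson_algebra K A br by fact
  interpret I: ideal I A using assms(2) by (simp add: poisson_ideal_def)
  have brI: "br i z \<in> I" if "i \<in> I" "z \<in> carrier A" for i z
    using assms(2) that by (auto simp: poisson_ideal_def)
  have anti: "br z i = \<ominus>\<^bsub>A\<^esub> br i z" if "i \<in> carrier A" "z \<in> carrier A" for i z
  proof -
    have "br (i \<oplus>\<^bsub>A\<^esub> z) (i \<oplus>\<^bsub>A\<^esub> z) = br i z \<oplus>\<^bsub>A\<^esub> br z i"
      using that by (simp add: br_add_left br_add_right br_alternating[of i] br_alternating[of z] br_closed
          M.a_comm[of "br z i" "br i z"])
    then have "br z i \<oplus>\<^bsub>A\<^esub> br i z = \<zero>\<^bsub>A\<^esub>"
      using that br_alternating[of "i \<oplus>\<^bsub>A\<^esub> z"] by (simp add: br_closed M.a_comm)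
    then show ?thesis using that by (simp add: M.minus_equality br_closed)
  qed
  have brI': "br z i \<in> I" if "i \<in> I" "z \<in> carrier A" for i z
    using anti[of i z] brI[OF that] that I.Icarr by (simp add: I.a_inv_closed)
  have "I +>\<^bsub>A\<^esub> br u v = I +>\<^bsub>A\<^esub> br x y" if u: "u \<in> I +>\<^bsub>A\<^esub> x" and v: "v \<in> I +>\<^bsub>A\<^esub> y" for u v
  proof -
    obtain i where i: "i \<in> I" "u = i \<oplus>\<^bsub>A\<^esub> x" using u by (auto simp: a_r_coset_def')
    obtain j where j: "j \<in> I" "v = j \<oplus>\<^bsub>A\<^esub> y" using v by (auto simp: a_r_coset_def')
    have ij: "i \<in> carrier A" "j \<in> carrier A" using i(1) j(1) I.Icarr by auto
    have vA: "v \<in> carrier A" using j ij y by simp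
    have "br u v = br i v \<oplus>\<^bsub>A\<^esub> (br x j \<oplus>\<^bsub>A\<^esub> br x y)"
      using br_add_left[OF ij(1) x vA] br_add_right[OF x ij(2) y] i(2) j(2) by simp
    also have "\<dots> = (br i v \<oplus>\<^bsub>A\<^esub> br x j) \<oplus>\<^bsub>A\<^esub> br x y"
      using ij x y vA by (simp add: br_closed M.a_assoc)
    finally have "br u v = (br i v \<oplus>\<^bsub>A\<^esub> br x j) \<oplus>\<^bsub>A\<^esub> br x y" .
    moreover have "br i v \<oplus>\<^bsub>A\<^esub> br x j \<in> I"
      using brI[OF i(1) vA] brI'[OF j(1) x] by simp
    ultimately have "br u v \<in> I +>\<^bsub>A\<^esub> br x y" by (auto simp: a_r_coset_def')
    then show ?thesis
      using I.a_repr_independence' br_closed x y by metis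
  qed
  then have "quot_bracket A br I (I +>\<^bsub>A\<^esub> x) (I +>\<^bsub>A\<^esub> y) =
      (\<Union>u\<in>I +>\<^bsub>A\<^esub> x. \<Union>v\<in>I +>\<^bsub>A\<^esub> y. I +>\<^bsub>A\<^esub> br x y)"
    unfolding quot_bracket_def by (intro SUP_cong refl)
  moreover have "I +>\<^bsub>A\<^esub> x \<noteq> {}" "I +>\<^bsub>A\<^esub> y \<noteq> {}"
    using x y I.a_rcos_self by blast+
  ultimately show ?thesis
    by simp
qed


section \<open>The field of fractions and localisation\<close>

text \<open>\<open>fraction R a b\<close> is the fraction \<open>a/b\<close>: the class of \<open>(a, b)\<close> under
  \<open>(a, b) \<sim> (c, d) \<longleftrightarrow> a d = c b\<close>.\<close>

definition fraction :: "('a, 'd) ring_scheme \<Rightarrow> 'a \<Rightarrow> 'a \<Rightarrow> ('a \<times> 'a) set" where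
  "fraction R a b =
     {(c, d). c \<in> carrier R \<and> d \<in> carrier R - {\<zero>\<^bsub>R\<^esub>} \<and> a \<otimes>\<^bsub>R\<^esub> d = c \<otimes>\<^bsub>R\<^esub> b}"

definition frac_alg :: "('k, 'a, 'd) module_scheme \<Rightarrow> ('k, ('a \<times> 'a) set) module" where
  "frac_alg R =
     \<lparr>carrier = {fraction R a b | a b. a \<in> carrier R \<and> b \<in> carrier R - {\<zero>\<^bsub>R\<^esub>}},
      monoid.mult = (\<lambda>U V. \<Union>(a, b)\<in>U. \<Union>(c, d)\<in>V. fraction R (a \<otimes>\<^bsub>R\<^esub> c) (b \<otimes>\<^bsub>R\<^esub> d)),
      one = fraction R \<one>\<^bsub>R\<^esub> \<one>\<^bsub>R\<^esub>,
      zero = fraction R \<zero>\<^bsub>R\<^esub> \<one>\<^bsub>R\<^esub>,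
      add = (\<lambda>U V. \<Union>(a, b)\<in>U. \<Union>(c, d)\<in>V.
               fraction R ((a \<otimes>\<^bsub>R\<^esub> d) \<oplus>\<^bsub>R\<^esub> (c \<otimes>\<^bsub>R\<^esub> b)) (b \<otimes>\<^bsub>R\<^esub> d)),
      module.smult = (\<lambda>c U. \<Union>(a, b)\<in>U. fraction R (c \<odot>\<^bsub>R\<^esub> a) b)\<rparr>"

definition frac_emb :: "('a, 'd) ring_scheme \<Rightarrow> 'a \<Rightarrow> ('a \<times> 'a) set" where
  "frac_emb R a = fraction R a \<one>\<^bsub>R\<^esub>"

text \<open>\<open>frac_alg R\<close> is a field in which \<open>fraction R a b\<close> is the quotient of the images of
  \<open>a\<close> and \<open>b\<close>.\<close>

context domain
begin

lemma fraction_eq_iff: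
  assumes "a \<in> carrier R" "b \<in> carrier R - {\<zero>}" "c \<in> carrier R" "d \<in> carrier R - {\<zero>}"
  shows "fraction R a b = fraction R c d \<longleftrightarrow> a \<otimes> d = c \<otimes> b"
proof
  assume "fraction R a b = fraction R c d"
  moreover have "(a, b) \<in> fraction R a b" using assms by (auto simp: fraction_def)
  ultimately show "a \<otimes> d = c \<otimes> b" by (auto simp: fraction_def)
next
  have sub: "fraction R a b \<subseteq> fraction R c d"
    if "a \<otimes> d = c \<otimes> b" "a \<in> carrier R" "b \<in> carrier R - {\<zero>}"
      "c \<in> carrier R" "d \<in> carrier R - {\<zero>}" for a b c d
  proof (clarsimp simp: fraction_def)
    fix u v assume uv: "u \<in> carrier R" "v \<in> carrier R" "a \<otimes> v = u \<otimes> b"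
    have "b \<otimes> (c \<otimes> v) = (c \<otimes> b) \<otimes> v" using that(2-) uv(1,2) by (simp add: m_ac)
    also have "\<dots> = (a \<otimes> d) \<otimes> v" by (simp only: that(1))
    also have "\<dots> = (a \<otimes> v) \<otimes> d" using that(2-) uv(1,2) by (simp add: m_ac)
    also have "\<dots> = (u \<otimes> b) \<otimes> d" by (simp only: uv(3))
    also have "\<dots> = b \<otimes> (u \<otimes> d)" using that(2-) uv(1,2) by (simp add: m_ac)
    finally show "c \<otimes> v = u \<otimes> d" using that(2-) uv(1,2) m_lcancel[of b] by auto
  qed
  assume "a \<otimes> d = c \<otimes> b"
  then show "fraction R a b = fraction R c d"
    using sub[of a d c b] sub[of c b a d] assms by auto
qed

lemma fraction_UN:
  assumes "a \<in> carrier R" "b \<in> carrier R - {\<zero>}"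
    and "\<And>u v. (u, v) \<in> fraction R a b \<Longrightarrow> F u v = F a b"
  shows "(\<Union>(u, v)\<in>fraction R a b. F u v) = F a b"
proof -
  have "(a, b) \<in> fraction R a b" using assms by (auto simp: fraction_def)
  then show ?thesis using assms(3) by blast
qed

lemma fraction_UN2:
  assumes "a \<in> carrier R" "b \<in> carrier R - {\<zero>}" "c \<in> carrier R" "d \<in> carrier R - {\<zero>}"
    and eq: "\<And>u v s t. (u, v) \<in> fraction R a b \<Longrightarrow> (s, t) \<in> fraction R c d \<Longrightarrow>
      F u v s t = C"
  shows "(\<Union>(u, v)\<in>fraction R a b. \<Union>(s, t)\<in>fraction R c d. F u v s t) = C"
proof -
  have "(a, b) \<in> fraction R a b" "(c, d) \<in> fraction R c d"
    using assms(1-4) by (auto simp: fraction_def)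
  then have ne: "fraction R a b \<noteq> {}" "fraction R c d \<noteq> {}" by auto
  show ?thesis
    by (rule SUP_eq_const[OF ne(1)], clarify, rule SUP_eq_const[OF ne(2)], clarify, rule eq)
qed

end

locale domain_algebra = algebra K R + domain R
  for K :: "('k, 'c) ring_scheme" and R :: "('k, 'a, 'd) module_scheme"
begin

abbreviation "nz \<equiv> carrier R - {\<zero>\<^bsub>R\<^esub>}"

lemma nz_mult: "b \<in> nz \<Longrightarrow> d \<in> nz \<Longrightarrow> b \<otimes>\<^bsub>R\<^esub> d \<in> nz"
  using integral_iff by auto

lemma frac_mult:
  assumes "a \<in> carrier R" "b \<in> nz" "c \<in> carrier R" "d \<in> nz"
  shows "fraction R a b \<otimes>\<^bsub>frac_alg R\<^esub> fraction R c d
    = fraction R (a \<otimes>\<^bsub>R\<^esub> c) (b \<otimes>\<^bsub>R\<^esub> d)"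
proof -
  have 1: "fraction R (u \<otimes>\<^bsub>R\<^esub> s) (v \<otimes>\<^bsub>R\<^esub> t) = fraction R (a \<otimes>\<^bsub>R\<^esub> c) (b \<otimes>\<^bsub>R\<^esub> d)"
    if uv: "(u, v) \<in> fraction R a b" and st: "(s, t) \<in> fraction R c d" for u v s t
  proof -
    have c: "u \<in> carrier R" "v \<in> nz" "a \<otimes>\<^bsub>R\<^esub> v = u \<otimes>\<^bsub>R\<^esub> b"
      "s \<in> carrier R" "t \<in> nz" "c \<otimes>\<^bsub>R\<^esub> t = s \<otimes>\<^bsub>R\<^esub> d"
      using uv st by (auto simp: fraction_def)
    have "(u \<otimes>\<^bsub>R\<^esub> s) \<otimes>\<^bsub>R\<^esub> (b \<otimes>\<^bsub>R\<^esub> d) = (u \<otimes>\<^bsub>R\<^esub> b) \<otimes>\<^bsub>R\<^esub> (s \<otimes>\<^bsub>R\<^esub> d)"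
      using c(1,2,4,5) assms by (simp add: m_ac)
    also have "\<dots> = (a \<otimes>\<^bsub>R\<^esub> v) \<otimes>\<^bsub>R\<^esub> (c \<otimes>\<^bsub>R\<^esub> t)" by (simp add: c(3,6))
    also have "\<dots> = (a \<otimes>\<^bsub>R\<^esub> c) \<otimes>\<^bsub>R\<^esub> (v \<otimes>\<^bsub>R\<^esub> t)"
      using c(1,2,4,5) assms by (simp add: m_ac)
    finally show ?thesis
      using c(1,2,4,5) assms nz_mult by (subst fraction_eq_iff) auto
  qed
  show ?thesis
    unfolding frac_alg_def monoid.simps by (rule fraction_UN2[OF assms], rule 1)
qed

lemma frac_add:
  assumes "a \<in> carrier R" "b \<in> nz" "c \<in> carrier R" "d \<in> nz"
  shows "fraction R a b \<oplus>\<^bsub>frac_alg R\<^esub> fraction R c d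
    = fraction R ((a \<otimes>\<^bsub>R\<^esub> d) \<oplus>\<^bsub>R\<^esub> (c \<otimes>\<^bsub>R\<^esub> b)) (b \<otimes>\<^bsub>R\<^esub> d)"
proof -
  have 1: "fraction R ((u \<otimes>\<^bsub>R\<^esub> t) \<oplus>\<^bsub>R\<^esub> (s \<otimes>\<^bsub>R\<^esub> v)) (v \<otimes>\<^bsub>R\<^esub> t)
      = fraction R ((a \<otimes>\<^bsub>R\<^esub> d) \<oplus>\<^bsub>R\<^esub> (c \<otimes>\<^bsub>R\<^esub> b)) (b \<otimes>\<^bsub>R\<^esub> d)"
    if uv: "(u, v) \<in> fraction R a b" and st: "(s, t) \<in> fraction R c d" for u v s t
  proof -
    have c: "u \<in> carrier R" "v \<in> nz" "a \<otimes>\<^bsub>R\<^esub> v = u \<otimes>\<^bsub>R\<^esub> b"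
      "s \<in> carrier R" "t \<in> nz" "c \<otimes>\<^bsub>R\<^esub> t = s \<otimes>\<^bsub>R\<^esub> d"
      using uv st by (auto simp: fraction_def)
    have "((u \<otimes>\<^bsub>R\<^esub> t) \<oplus>\<^bsub>R\<^esub> (s \<otimes>\<^bsub>R\<^esub> v)) \<otimes>\<^bsub>R\<^esub> (b \<otimes>\<^bsub>R\<^esub> d)
        = (u \<otimes>\<^bsub>R\<^esub> b) \<otimes>\<^bsub>R\<^esub> (t \<otimes>\<^bsub>R\<^esub> d) \<oplus>\<^bsub>R\<^esub> (s \<otimes>\<^bsub>R\<^esub> d) \<otimes>\<^bsub>R\<^esub> (v \<otimes>\<^bsub>R\<^esub> b)"
      using c(1,2,4,5) assms by (simp add: l_distr r_distr m_ac)
    also have "\<dots> = (a \<otimes>\<^bsub>R\<^esub> v) \<otimes>\<^bsub>R\<^esub> (t \<otimes>\<^bsub>R\<^esub> d) \<oplus>\<^bsub>R\<^esub> (c \<otimes>\<^bsub>R\<^esub> t) \<otimes>\<^bsub>R\<^esub> (v \<otimes>\<^bsub>R\<^esub> b)"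
      by (simp add: c(3,6))
    also have "\<dots> = ((a \<otimes>\<^bsub>R\<^esub> d) \<oplus>\<^bsub>R\<^esub> (c \<otimes>\<^bsub>R\<^esub> b)) \<otimes>\<^bsub>R\<^esub> (v \<otimes>\<^bsub>R\<^esub> t)"
      using c(1,2,4,5) assms by (simp add: l_distr r_distr m_ac)
    finally show ?thesis
      using c(1,2,4,5) assms nz_mult by (subst fraction_eq_iff) auto
  qed
  show ?thesis
    unfolding frac_alg_def ring.simps by (rule fraction_UN2[OF assms], rule 1)
qed

lemma frac_smult:
  assumes "k \<in> carrier K" "a \<in> carrier R" "b \<in> nz"
  shows "k \<odot>\<^bsub>frac_alg R\<^esub> fraction R a b = fraction R (k \<odot>\<^bsub>R\<^esub> a) b"
proof -
  have "fraction R (k \<odot>\<^bsub>R\<^esub> u) v = fraction R (k \<odot>\<^bsub>R\<^esub> a) b" if "(u, v) \<in> fraction R a b" for u v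
  proof -
    have c: "u \<in> carrier R" "v \<in> nz" "a \<otimes>\<^bsub>R\<^esub> v = u \<otimes>\<^bsub>R\<^esub> b"
      using that by (auto simp: fraction_def)
    then have "(k \<odot>\<^bsub>R\<^esub> u) \<otimes>\<^bsub>R\<^esub> b = (k \<odot>\<^bsub>R\<^esub> a) \<otimes>\<^bsub>R\<^esub> v"
      using assms by (simp add: smult_assoc2)
    then show ?thesis using c assms by (subst fraction_eq_iff) auto
  qed
  then show ?thesis
    unfolding frac_alg_def module.simps using assms by (subst fraction_UN) auto
qed

lemma frac_cases:
  assumes "z \<in> carrier (frac_alg R)"
  obtains a b where "a \<in> carrier R" "b \<in> nz" "z = fraction R a b"
  using assms by (auto simp: frac_alg_def)

lemma frac_closed: "a \<in> carrier R \<Longrightarrow> b \<in> nz \<Longrightarrow> fraction R a b \<in> carrier (frac_alg R)"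
  by (auto simp: frac_alg_def)

lemma frac_zero: "\<zero>\<^bsub>frac_alg R\<^esub> = fraction R \<zero>\<^bsub>R\<^esub> \<one>\<^bsub>R\<^esub>"
  and frac_one: "\<one>\<^bsub>frac_alg R\<^esub> = fraction R \<one>\<^bsub>R\<^esub> \<one>\<^bsub>R\<^esub>"
  by (simp_all add: frac_alg_def)

lemma one_nz: "\<one>\<^bsub>R\<^esub> \<in> nz"
  by auto

lemmas frac_ops = frac_mult frac_add frac_smult frac_zero frac_one

lemma frac_cring: "cring (frac_alg R)"
proof (intro cringI abelian_groupI comm_monoidI)
  fix x y z
  assume "x \<in> carrier (frac_alg R)" "y \<in> carrier (frac_alg R)" "z \<in> carrier (frac_alg R)"
  then obtain a b c d e f where r:
    "a \<in> carrier R" "b \<in> nz" "x = fraction R a b" "c \<in> carrier R" "d \<in> nz" "y = fraction R c d"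
    "e \<in> carrier R" "f \<in> nz" "z = fraction R e f"
    by (metis frac_cases)
  note n = nz_mult[OF r(2) r(5)] nz_mult[OF r(5) r(8)] nz_mult[OF r(2) r(8)]
  show "x \<oplus>\<^bsub>frac_alg R\<^esub> y \<oplus>\<^bsub>frac_alg R\<^esub> z = x \<oplus>\<^bsub>frac_alg R\<^esub> (y \<oplus>\<^bsub>frac_alg R\<^esub> z)"
    using r n by (simp add: frac_add l_distr r_distr m_ac M.a_ac)
  show "x \<otimes>\<^bsub>frac_alg R\<^esub> y \<otimes>\<^bsub>frac_alg R\<^esub> z = x \<otimes>\<^bsub>frac_alg R\<^esub> (y \<otimes>\<^bsub>frac_alg R\<^esub> z)"
    using r n by (simp add: frac_mult m_ac)
  have n': "(b \<otimes>\<^bsub>R\<^esub> d) \<otimes>\<^bsub>R\<^esub> f \<in> nz" "(b \<otimes>\<^bsub>R\<^esub> f) \<otimes>\<^bsub>R\<^esub> (d \<otimes>\<^bsub>R\<^esub> f) \<in> nz"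
    using n r(8) nz_mult by blast+
  show "(x \<oplus>\<^bsub>frac_alg R\<^esub> y) \<otimes>\<^bsub>frac_alg R\<^esub> z = x \<otimes>\<^bsub>frac_alg R\<^esub> z \<oplus>\<^bsub>frac_alg R\<^esub> y \<otimes>\<^bsub>frac_alg R\<^esub> z"
    using r n n' by (simp add: frac_mult frac_add, subst fraction_eq_iff)
      (auto simp: l_distr r_distr m_ac)
next
  fix x y
  assume "x \<in> carrier (frac_alg R)" "y \<in> carrier (frac_alg R)"
  then obtain a b c d where r:
    "a \<in> carrier R" "b \<in> nz" "x = fraction R a b" "c \<in> carrier R" "d \<in> nz" "y = fraction R c d"
    by (metis frac_cases)
  show "x \<oplus>\<^bsub>frac_alg R\<^esub> y \<in> carrier (frac_alg R)"
    using r nz_mult[OF r(2) r(5)] by (simp add: frac_add frac_closed)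
  show "x \<otimes>\<^bsub>frac_alg R\<^esub> y \<in> carrier (frac_alg R)"
    using r nz_mult[OF r(2) r(5)] by (simp add: frac_mult frac_closed)
  show "x \<oplus>\<^bsub>frac_alg R\<^esub> y = y \<oplus>\<^bsub>frac_alg R\<^esub> x"
    using r by (simp add: frac_add m_ac M.a_ac)
  show "x \<otimes>\<^bsub>frac_alg R\<^esub> y = y \<otimes>\<^bsub>frac_alg R\<^esub> x"
    using r by (simp add: frac_mult m_ac)
next
  fix x assume "x \<in> carrier (frac_alg R)"
  then obtain a b where r: "a \<in> carrier R" "b \<in> nz" "x = fraction R a b"
    by (metis frac_cases)
  show "\<zero>\<^bsub>frac_alg R\<^esub> \<oplus>\<^bsub>frac_alg R\<^esub> x = x" "\<one>\<^bsub>frac_alg R\<^esub> \<otimes>\<^bsub>frac_alg R\<^esub> x = x"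
    using r one_nz by (simp_all add: frac_ops)
  have "fraction R (\<ominus>\<^bsub>R\<^esub> a) b \<oplus>\<^bsub>frac_alg R\<^esub> x = \<zero>\<^bsub>frac_alg R\<^esub>"
    using r one_nz nz_mult[OF r(2) r(2)]
    by (simp add: frac_add frac_zero, subst fraction_eq_iff) (auto simp: l_minus M.l_neg)
  then show "\<exists>y\<in>carrier (frac_alg R). y \<oplus>\<^bsub>frac_alg R\<^esub> x = \<zero>\<^bsub>frac_alg R\<^esub>"
    using frac_closed[of "\<ominus>\<^bsub>R\<^esub> a" b] r by (intro bexI) auto
qed (use one_nz in \<open>auto simp: frac_zero frac_one intro!: frac_closed\<close>)

theorem frac_alg_algebra: "algebra K (frac_alg R)"
proof (rule algebraI[OF R_cring frac_cring])
  fix k x y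
  assume k: "k \<in> carrier K" and "x \<in> carrier (frac_alg R)" "y \<in> carrier (frac_alg R)"
  then obtain a b c d where r:
    "a \<in> carrier R" "b \<in> nz" "x = fraction R a b" "c \<in> carrier R" "d \<in> nz" "y = fraction R c d"
    by (metis frac_cases)
  note n = nz_mult[OF r(2) r(5)]
  show "k \<odot>\<^bsub>frac_alg R\<^esub> (x \<oplus>\<^bsub>frac_alg R\<^esub> y)
      = k \<odot>\<^bsub>frac_alg R\<^esub> x \<oplus>\<^bsub>frac_alg R\<^esub> k \<odot>\<^bsub>frac_alg R\<^esub> y"
    using r k n by (simp add: frac_ops smult_r_distr smult_assoc2)
  show "(k \<odot>\<^bsub>frac_alg R\<^esub> x) \<otimes>\<^bsub>frac_alg R\<^esub> y = k \<odot>\<^bsub>frac_alg R\<^esub> (x \<otimes>\<^bsub>frac_alg R\<^esub> y)"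
    using r k n by (simp add: frac_ops smult_assoc2)
next
  fix k l x
  assume k: "k \<in> carrier K" "l \<in> carrier K" and "x \<in> carrier (frac_alg R)"
  then obtain a b where r: "a \<in> carrier R" "b \<in> nz" "x = fraction R a b"
    by (metis frac_cases)
  note n = nz_mult[OF r(2) r(2)]
  show "(k \<oplus>\<^bsub>K\<^esub> l) \<odot>\<^bsub>frac_alg R\<^esub> x
      = k \<odot>\<^bsub>frac_alg R\<^esub> x \<oplus>\<^bsub>frac_alg R\<^esub> l \<odot>\<^bsub>frac_alg R\<^esub> x"
    using r k n by (simp add: frac_ops, subst fraction_eq_iff)
      (auto simp: smult_l_distr l_distr m_assoc)
  show "(k \<otimes>\<^bsub>K\<^esub> l) \<odot>\<^bsub>frac_alg R\<^esub> x = k \<odot>\<^bsub>frac_alg R\<^esub> (l \<odot>\<^bsub>frac_alg R\<^esub> x)"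
    using r k by (simp add: frac_ops smult_assoc1)
next
  fix k x
  assume k: "k \<in> carrier K" and "x \<in> carrier (frac_alg R)"
  then obtain a b where r: "a \<in> carrier R" "b \<in> nz" "x = fraction R a b"
    by (metis frac_cases)
  show "k \<odot>\<^bsub>frac_alg R\<^esub> x \<in> carrier (frac_alg R)"
    using r k by (simp add: frac_ops frac_closed)
next
  fix x
  assume "x \<in> carrier (frac_alg R)"
  then obtain a b where r: "a \<in> carrier R" "b \<in> nz" "x = fraction R a b"
    by (metis frac_cases)
  show "\<one>\<^bsub>K\<^esub> \<odot>\<^bsub>frac_alg R\<^esub> x = x"
    using r by (simp add: frac_ops)
qed

theorem frac_alg_field: "field (frac_alg R)"
proof (rule cring.cring_fieldI2[OF frac_cring])
  show "\<zero>\<^bsub>frac_alg R\<^esub> \<noteq> \<one>\<^bsub>frac_alg R\<^esub>"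
    using one_nz by (auto simp: frac_ops fraction_eq_iff)
  fix x assume "x \<in> carrier (frac_alg R)" "x \<noteq> \<zero>\<^bsub>frac_alg R\<^esub>"
  then obtain a b where r: "a \<in> carrier R" "b \<in> nz" "x = fraction R a b"
    "fraction R a b \<noteq> fraction R \<zero>\<^bsub>R\<^esub> \<one>\<^bsub>R\<^esub>"
    by (metis frac_cases frac_zero)
  then have a: "a \<in> nz" using one_nz by (auto simp: fraction_eq_iff)
  have "x \<otimes>\<^bsub>frac_alg R\<^esub> fraction R b a = \<one>\<^bsub>frac_alg R\<^esub>"
    using r a one_nz nz_mult[OF r(2) a]
    by (simp add: frac_ops, subst fraction_eq_iff) (auto simp: m_ac)
  then show "\<exists>y\<in>carrier (frac_alg R). x \<otimes>\<^bsub>frac_alg R\<^esub> y = \<one>\<^bsub>frac_alg R\<^esub>"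
    using frac_closed[of b a] r a by blast
qed

theorem frac_emb_hom: "frac_emb R \<in> alg_hom K R (frac_alg R)"
  and frac_emb_inj: "inj_on (frac_emb R) (carrier R)"
  and frac_emb_quotients:
    "a \<in> carrier R \<Longrightarrow> b \<in> nz \<Longrightarrow>
       fraction R a b = frac_emb R a \<otimes>\<^bsub>frac_alg R\<^esub> inv\<^bsub>frac_alg R\<^esub> (frac_emb R b)"
proof -
  show "frac_emb R \<in> alg_hom K R (frac_alg R)"
    using one_nz
    by (auto simp: alg_hom_def frac_emb_def frac_ops frac_closed intro!: ring_hom_memI)
  show "inj_on (frac_emb R) (carrier R)"
    using one_nz by (intro inj_onI) (simp add: frac_emb_def fraction_eq_iff)
  assume ab: "a \<in> carrier R" "b \<in> nz"
  interpret F: field "frac_alg R" by (rule frac_alg_field)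
  have "frac_emb R b \<otimes>\<^bsub>frac_alg R\<^esub> fraction R \<one>\<^bsub>R\<^esub> b = \<one>\<^bsub>frac_alg R\<^esub>"
    using ab one_nz by (simp add: frac_emb_def frac_ops, subst fraction_eq_iff) auto
  then have "inv\<^bsub>frac_alg R\<^esub> (frac_emb R b) = fraction R \<one>\<^bsub>R\<^esub> b"
    using ab one_nz F.comm_inv_char[of "frac_emb R b" "fraction R \<one>\<^bsub>R\<^esub> b"]
    by (simp add: frac_emb_def frac_closed)
  then show "fraction R a b = frac_emb R a \<otimes>\<^bsub>frac_alg R\<^esub> inv\<^bsub>frac_alg R\<^esub> (frac_emb R b)"
    using ab one_nz by (simp add: frac_emb_def frac_ops)
qed

end

text \<open>\<open>B[p\<^sup>-\<^sup>1]\<close> as a subalgebra of the field of fractions of \<open>R\<close>, for \<open>p \<noteq> 0\<close>.\<close>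

definition adjoin_inverse ::
  "('k, 'c) ring_scheme \<Rightarrow> ('k, 'a, 'd) module_scheme \<Rightarrow> 'a set \<Rightarrow> 'a
     \<Rightarrow> ('k, ('a \<times> 'a) set) module" where
  "adjoin_inverse K R B p =
     (frac_alg R)\<lparr>carrier :=
        subalg_gen K (frac_alg R)
          (frac_emb R ` B \<union> {inv\<^bsub>frac_alg R\<^esub> (frac_emb R p)})\<rparr>"


section \<open>The symmetric algebra of the positive Witt algebra\<close>

text \<open>The polynomial ring over \<open>'k\<close> in variables \<open>x\<^sub>1, x\<^sub>2, \<dots>\<close>. Monomials are exponent
  functions on \<^typ>\<open>nat\<close>, and the exponent of \<open>x\<^sub>n\<close> is stored at index \<open>n - 1\<close>.\<close>

type_synonym 'k spoly = "(nat \<Rightarrow>\<^sub>0 nat) \<Rightarrow>\<^sub>0 'k"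

definition xgen :: "nat \<Rightarrow> 'k::zero_neq_one spoly" where
  "xgen n = Poly_Mapping.single (Poly_Mapping.single (n - 1) 1) 1"

definition const :: "'k::zero \<Rightarrow> 'k spoly" where
  "const c = Poly_Mapping.single 0 c"

definition witt_sym :: "('k::comm_ring_1, 'k spoly) module" where
  "witt_sym = \<lparr>carrier = UNIV, monoid.mult = (*), one = 1, zero = 0, add = (+),
               module.smult = (\<lambda>c f. const c * f)\<rparr>"

text \<open>Indices of the variables that occur, and partial derivatives with respect to
  \<open>x\<^bsub>i+1\<^esub>\<close>.\<close>

definition vars :: "'k::zero spoly \<Rightarrow> nat set" where
  "vars f = (\<Union>m\<in>Poly_Mapping.keys f. Poly_Mapping.keys m)"

definition pd :: "nat \<Rightarrow> 'k::comm_ring_1 spoly \<Rightarrow> 'k spoly" where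
  "pd i f = (\<Sum>m\<in>Poly_Mapping.keys f.
     Poly_Mapping.single (m - Poly_Mapping.single i 1)
       (of_nat (Poly_Mapping.lookup m i) * Poly_Mapping.lookup f m))"

text \<open>The bracket is given by
  \<open>{f, g} = (\<Sum>a b. {x\<^sub>a, x\<^sub>b} \<partial>f/\<partial>x\<^sub>a \<partial>g/\<partial>x\<^sub>b)\<close> with \<open>a = i + 1\<close>, \<open>b = j + 1\<close>. Below it is
  shown to be the unique Poisson bracket with the prescribed values on the generators.\<close>

definition witt_bracket :: "'k::comm_ring_1 spoly \<Rightarrow> 'k spoly \<Rightarrow> 'k spoly" where
  "witt_bracket f g = (\<Sum>i\<in>vars f. \<Sum>j\<in>vars g.
     of_int (int j - int i) * xgen (i + j + 2) * pd i f * pd j g)"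

lemma finite_vars [simp]: "finite (vars f)"
  by (simp add: vars_def)

lemma spoly_sum_monomials:
  "f = (\<Sum>m\<in>Poly_Mapping.keys f. Poly_Mapping.single m (Poly_Mapping.lookup f m))"
  by (rule poly_mapping_eqI)
    (auto simp: lookup_sum lookup_single when_def sum.delta in_keys_iff)

lemma spoly_add_induct:
  fixes f :: "'k::comm_ring_1 spoly"
  assumes "P 0" "\<And>f g. P f \<Longrightarrow> P g \<Longrightarrow> P (f + g)" "\<And>m c. P (Poly_Mapping.single m c)"
  shows "P f"
proof -
  have "P (\<Sum>m\<in>M. Poly_Mapping.single m (Poly_Mapping.lookup f m))" if "finite M" for M
    using that by induction (auto intro: assms)
  then show ?thesis using spoly_sum_monomials[of f] finite_keys by metis
qed

lemma const_0 [simp]: "const 0 = 0"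
  and const_1 [simp]: "const 1 = 1"
  and const_add: "const (c + d) = const c + const d"
  and const_mult: "const (c * d) = const c * const d"
  by (simp_all add: const_def single_add mult_single)

lemma spoly_induct [case_names const gen add mult]:
  fixes f :: "'k::comm_ring_1 spoly"
  assumes c: "\<And>c. P (const c)" and x: "\<And>n. n \<ge> 1 \<Longrightarrow> P (xgen n)"
    and a: "\<And>f g. P f \<Longrightarrow> P g \<Longrightarrow> P (f + g)" and m: "\<And>f g. P f \<Longrightarrow> P g \<Longrightarrow> P (f * g)"
  shows "P f"
proof (rule spoly_add_induct)
  show "P 0" using c[of 0] by simp
  show "P (f + g)" if "P f" "P g" for f g using a that .
next
  fix m :: "nat \<Rightarrow>\<^sub>0 nat" and c' :: 'k
  have pw: "P (Poly_Mapping.single (Poly_Mapping.single i k) 1)" for i k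
  proof (induction k)
    case 0
    then show ?case using c[of 1] by (simp add: const_def)
  next
    case (Suc k)
    have "Poly_Mapping.single (Poly_Mapping.single i (Suc k)) (1::'k)
        = xgen (Suc i) * Poly_Mapping.single (Poly_Mapping.single i k) 1"
      by (simp add: xgen_def mult_single flip: single_add)
    then show ?case using m x Suc by simp
  qed
  have m_eq: "m = (\<Sum>i\<in>Poly_Mapping.keys m. Poly_Mapping.single i (Poly_Mapping.lookup m i))"
    by (rule poly_mapping_eqI)
      (auto simp: lookup_sum lookup_single when_def sum.delta in_keys_iff)
  have "P (Poly_Mapping.single (\<Sum>i\<in>A. Poly_Mapping.single i (Poly_Mapping.lookup m i)) 1)"
    if "finite A" for A
    using that
  proof induction
    case empty
    then show ?case using c[of 1] by (simp add: const_def)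
  next
    case (insert i A)
    then show ?case using m[OF pw[of i "Poly_Mapping.lookup m i"] insert.IH]
      by (simp add: mult_single)
  qed
  then have "P (Poly_Mapping.single m 1)" using m_eq finite_keys by metis
  then have "P (const c' * Poly_Mapping.single m 1)" using m c by blast
  then show "P (Poly_Mapping.single m c')" by (simp add: const_def mult_single)
qed

lemma pd_superset:
  assumes "finite M" "Poly_Mapping.keys f \<subseteq> M"
  shows "pd i f = (\<Sum>m\<in>M. Poly_Mapping.single (m - Poly_Mapping.single i 1)
       (of_nat (Poly_Mapping.lookup m i) * Poly_Mapping.lookup f m))"
  unfolding pd_def using assms
  by (intro sum.mono_neutral_left) (auto simp: in_keys_iff)

lemma pd_add: "pd i (f + g) = pd i f + pd i g"
proof -
  let ?M = "Poly_Mapping.keys f \<union> Poly_Mapping.keys g"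
  have "Poly_Mapping.keys (f + g) \<subseteq> ?M" by (rule keys_add)
  then show ?thesis
    by (simp add: pd_superset[of ?M] lookup_add ring_distribs single_add sum.distrib)
qed

lemma pd_single: "pd i (Poly_Mapping.single m c) =
    Poly_Mapping.single (m - Poly_Mapping.single i 1) (of_nat (Poly_Mapping.lookup m i) * c)"
  by (simp add: pd_superset[of "{m}"])

lemma pd_zero [simp]: "pd i 0 = 0"
  by (simp add: pd_def)

lemma pd_const [simp]: "pd i (const c) = 0"
  by (simp add: const_def pd_single)

lemma pd_xgen: "n \<ge> 1 \<Longrightarrow> pd i (xgen n) = (if n = i + 1 then 1 else 0)"
  by (auto simp: xgen_def pd_single lookup_single when_def)

lemma pd_mult:
  fixes f g :: "'k::comm_ring_1 spoly"
  shows "pd i (f * g) = pd i f * g + f * pd i g"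
proof -
  have shift: "Poly_Mapping.single (m - Poly_Mapping.single i 1 + n) (of_nat (Poly_Mapping.lookup m i) * c)
     = Poly_Mapping.single (m + n - Poly_Mapping.single i 1) (of_nat (Poly_Mapping.lookup m i) * c)"
    for m n :: "nat \<Rightarrow>\<^sub>0 nat" and c :: 'k
  proof (cases "Poly_Mapping.lookup m i = 0")
    case False
    then have "m - Poly_Mapping.single i 1 + n = m + n - Poly_Mapping.single i 1"
      by (intro poly_mapping_eqI) (auto simp: lookup_add lookup_minus lookup_single when_def)
    then show ?thesis by simp
  qed simp
  have mono: "pd i (Poly_Mapping.single m c * Poly_Mapping.single n d) =
     pd i (Poly_Mapping.single m c) * Poly_Mapping.single n d +
     Poly_Mapping.single m c * pd i (Poly_Mapping.single n d)" for m n and c d :: 'k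
    using shift[of m n "c * d"] shift[of n m "c * d"]
    by (simp add: pd_single mult_single lookup_add ring_distribs single_add ac_simps)
  have "pd i (Poly_Mapping.single m c * g) =
     pd i (Poly_Mapping.single m c) * g + Poly_Mapping.single m c * pd i g" for m c
    by (induction g rule: spoly_add_induct) (simp_all add: mono pd_add ring_distribs)
  then show ?thesis
    by (induction f rule: spoly_add_induct) (simp_all add: pd_add ring_distribs)
qed

lemma pd_outside: "i \<notin> vars f \<Longrightarrow> pd i f = 0"
  by (auto simp: pd_def vars_def in_keys_iff intro!: sum.neutral)

lemma witt_bracket_superset:
  assumes "finite V" "vars f \<subseteq> V" "finite W" "vars g \<subseteq> W"
  shows "witt_bracket f g = (\<Sum>i\<in>V. \<Sum>j\<in>W.
     of_int (int j - int i) * xgen (i + j + 2) * pd i f * pd j g)"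
proof -
  have "witt_bracket f g = (\<Sum>i\<in>vars f. \<Sum>j\<in>W.
     of_int (int j - int i) * xgen (i + j + 2) * pd i f * pd j g)"
    unfolding witt_bracket_def
    by (intro sum.cong refl sum.mono_neutral_left) (use assms in \<open>auto simp: pd_outside\<close>)
  also have "\<dots> = (\<Sum>i\<in>V. \<Sum>j\<in>W.
     of_int (int j - int i) * xgen (i + j + 2) * pd i f * pd j g)"
    by (intro sum.mono_neutral_left) (use assms in \<open>auto simp: pd_outside\<close>)
  finally show ?thesis .
qed

lemma witt_bracket_anti: "witt_bracket f g = - witt_bracket g f"
proof -
  have "witt_bracket f g = (\<Sum>j\<in>vars g. \<Sum>i\<in>vars f.
     of_int (int j - int i) * xgen (i + j + 2) * pd i f * pd j g)"
    unfolding witt_bracket_def by (rule sum.swap)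
  also have "\<dots> = (\<Sum>j\<in>vars g. \<Sum>i\<in>vars f.
     - (of_int (int i - int j) * xgen (j + i + 2) * pd j g * pd i f))"
    by (intro sum.cong refl) (simp add: algebra_simps)
  finally show ?thesis by (simp add: witt_bracket_def sum_negf)
qed

lemma witt_bracket_add_right:
  "witt_bracket f (g + h) = witt_bracket f g + witt_bracket f h"
proof -
  let ?W = "vars g \<union> vars h \<union> vars (g + h)"
  have "witt_bracket f k = (\<Sum>i\<in>vars f. \<Sum>j\<in>?W.
     of_int (int j - int i) * xgen (i + j + 2) * pd i f * pd j k)" if "vars k \<subseteq> ?W" for k
    using that by (intro witt_bracket_superset) auto
  from this[of "g + h", OF Un_upper2] this[of g, OF le_supI1[OF Un_upper1]]
    this[of h, OF le_supI1[OF Un_upper2]]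
  show ?thesis
    by (simp only: pd_add distrib_left sum.distrib)
qed

lemma witt_bracket_add_left:
  "witt_bracket (f + g) h = witt_bracket f h + witt_bracket g h"
  by (simp add: witt_bracket_anti[of _ h] witt_bracket_add_right)

lemma witt_bracket_leibniz:
  "witt_bracket f (g * h) = witt_bracket f g * h + g * witt_bracket f h"
proof -
  let ?W = "vars g \<union> vars h \<union> vars (g * h)"
  have "witt_bracket f k = (\<Sum>i\<in>vars f. \<Sum>j\<in>?W.
     of_int (int j - int i) * xgen (i + j + 2) * pd i f * pd j k)" if "vars k \<subseteq> ?W" for k
    using that by (intro witt_bracket_superset) auto
  from this[of "g * h", OF Un_upper2] this[of g, OF le_supI1[OF Un_upper1]]
    this[of h, OF le_supI1[OF Un_upper2]]
  show ?thesis
    by (simp add: pd_mult sum_distrib_left sum_distrib_right distrib_left sum.distrib mult_ac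
        del: of_int_diff of_int_of_nat_eq)
qed

lemma witt_bracket_leibniz_left:
  "witt_bracket (f * g) h = witt_bracket f h * g + f * witt_bracket g h"
  by (simp add: witt_bracket_anti[of _ h] witt_bracket_leibniz)

lemma witt_bracket_const [simp]:
  "witt_bracket (const c) f = 0" "witt_bracket f (const c) = 0"
  by (simp_all add: witt_bracket_def)

lemma witt_bracket_gen:
  assumes "i \<ge> 1" "j \<ge> 1"
  shows "witt_bracket (xgen i) (xgen j) = of_int (int j - int i) * xgen (i + j)"
proof -
  have v: "vars (xgen n :: 'a spoly) \<subseteq> {n - 1}" for n
    by (auto simp: vars_def xgen_def split: if_splits)
  show ?thesis
    using assms by (simp add: witt_bracket_superset[OF _ v _ v] pd_xgen of_nat_diff eval_nat_numeral
        Suc_diff_Suc)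
qed

lemma witt_bracket_alternating:
  fixes f :: "'k::comm_ring_1 spoly"
  shows "witt_bracket f f = 0"
proof (induction f rule: spoly_induct)
  case (add f g)
  then show ?case
    using witt_bracket_anti[of g f] by (simp add: witt_bracket_add_left witt_bracket_add_right)
next
  case (mult f g)
  then show ?case
    using witt_bracket_anti[of g f]
    by (simp add: witt_bracket_leibniz witt_bracket_leibniz_left algebra_simps)
qed (simp_all add: witt_bracket_gen)

lemma witt_bracket_jacobi:
  fixes f g h :: "'k::comm_ring_1 spoly"
  shows "witt_bracket f (witt_bracket g h) + witt_bracket g (witt_bracket h f)
       + witt_bracket h (witt_bracket f g) = 0"
proof -
  define J where "J f g h = witt_bracket f (witt_bracket g h) + witt_bracket g (witt_bracket h f)
       + witt_bracket h (witt_bracket f g)" for f g h :: "'k spoly"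
  have rot: "J f g h = J g h f" for f g h
    by (simp add: J_def add_ac)
  have z: "witt_bracket x 0 = 0" for x :: "'k spoly"
    using witt_bracket_const(2)[of x 0] by simp
  have minus: "witt_bracket x (- y) = - witt_bracket x y" for x y :: "'k spoly"
    using witt_bracket_add_right[of x y "- y"] by (simp add: z eq_neg_iff_add_eq_0 add.commute)
  have diff: "witt_bracket x (y - w) = witt_bracket x y - witt_bracket x w" for x y w :: "'k spoly"
    using witt_bracket_add_right[of x y "- w"] by (simp add: minus)
  have c: "J (const a) g h = 0" for a g h
    by (simp add: J_def z)
  have a: "J (f + f') g h = J f g h + J f' g h" for f f' g h
    by (simp add: J_def witt_bracket_add_left witt_bracket_add_right add_ac)
  have m: "J (f * f') g h = J f g h * f' + f * J f' g h" for f f' g h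
    by (simp add: J_def witt_bracket_leibniz witt_bracket_leibniz_left
        witt_bracket_add_left witt_bracket_add_right minus diff
        witt_bracket_anti[of f g] witt_bracket_anti[of f' g] algebra_simps)
  have ind: "J f g h = 0" if "\<And>n. n \<ge> 1 \<Longrightarrow> J (xgen n) g h = 0" for f g h
  proof (induction f rule: spoly_induct)
    case (gen n)
    then show ?case by (rule that)
  qed (simp_all add: c a m)
  have ofint: "witt_bracket f (of_int k * g) = of_int k * witt_bracket f g"
    for f g :: "'k spoly" and k
  proof -
    have "(of_int k :: 'k spoly) = const (of_int k)" by (simp add: const_def)
    then show ?thesis by (simp add: witt_bracket_leibniz)
  qed
  have gen2: "witt_bracket (xgen n) (witt_bracket (xgen m) (xgen l) :: 'k spoly)
      = of_int ((int l - int m) * (int m + int l - int n)) * xgen (n + m + l)"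
    if "n \<ge> 1" "m \<ge> 1" "l \<ge> 1" for n m l
  proof -
    have "witt_bracket (xgen n) (witt_bracket (xgen m) (xgen l) :: 'k spoly)
        = of_int (int l - int m) * (of_int (int (m + l) - int n) * xgen (n + (m + l)))"
      using that by (subst witt_bracket_gen, simp, simp, subst ofint, subst witt_bracket_gen) auto
    then show ?thesis
      by (simp only: of_int_mult mult.assoc add.assoc of_nat_add)
  qed
  have gen: "J (xgen n) (xgen m) (xgen l) = 0" if "n \<ge> 1" "m \<ge> 1" "l \<ge> 1" for n m l
  proof -
    have "J (xgen n) (xgen m) (xgen l) = of_int
        ((int l - int m) * (int m + int l - int n) + (int n - int l) * (int l + int n - int m)
          + (int m - int n) * (int n + int m - int l)) * xgen (n + m + l)"
      using that by (simp only: J_def gen2 of_int_add distrib_right add_ac)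
    also have "(int l - int m) * (int m + int l - int n) + (int n - int l) * (int l + int n - int m)
          + (int m - int n) * (int n + int m - int l) = 0"
      by (simp add: algebra_simps)
    finally show ?thesis by simp
  qed
  have 1: "J (xgen n) (xgen m) h = 0" if "n \<ge> 1" "m \<ge> 1" for n m h
  proof -
    have "J h (xgen n) (xgen m) = 0" by (rule ind) (use gen that in blast)
    then show ?thesis using rot[of h "xgen n" "xgen m"] by (simp only:)
  qed
  have 2: "J (xgen n) g h = 0" if "n \<ge> 1" for n g h
  proof -
    have "J (xgen k) h (xgen n) = 0" if "k \<ge> 1" for k
      using 1[OF \<open>n \<ge> 1\<close> that, of h] rot[of "xgen n" "xgen k" h] by (simp only:)
    then have "J g h (xgen n) = 0" by (rule ind)
    then show ?thesis using rot[of "xgen n" g h] by (simp only:)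
  qed
  have "J f g h = 0" by (rule ind) (rule 2)
  then show ?thesis by (simp add: J_def)
qed

theorem witt_poisson_algebra:
  "poisson_algebra ring_of_type_algebra (witt_sym :: ('k::field_char_0, 'k spoly) module) witt_bracket"
proof -
  have K: "cring (ring_of_type_algebra :: 'k ring)" by (rule cring_from_type_algebra)
  have S: "cring (witt_sym :: ('k, 'k spoly) module)"
  proof (intro cringI abelian_groupI comm_monoidI)
    fix x :: "'k spoly"
    show "\<exists>y\<in>carrier witt_sym. y \<oplus>\<^bsub>witt_sym\<^esub> x = \<zero>\<^bsub>(witt_sym :: ('k, 'k spoly) module)\<^esub>"
      by (auto simp: witt_sym_def intro: exI[of _ "- x"])
  qed (auto simp: witt_sym_def algebra_simps)
  have "algebra ring_of_type_algebra (witt_sym :: ('k, 'k spoly) module)"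
    by (rule algebraI[OF K S])
      (auto simp: witt_sym_def ring_of_type_algebra_def const_add const_mult algebra_simps)
  then show ?thesis
    by (rule poisson_algebra.intro) (unfold_locales;
      simp add: witt_sym_def witt_bracket_add_left witt_bracket_add_right witt_bracket_leibniz
        witt_bracket_leibniz_left witt_bracket_alternating witt_bracket_jacobi)
qed

theorem witt_bracket_unique:
  fixes br :: "'k::field_char_0 spoly \<Rightarrow> 'k spoly \<Rightarrow> 'k spoly"
  assumes "poisson_algebra ring_of_type_algebra witt_sym br"
    and gen: "\<And>i j. i \<ge> 1 \<Longrightarrow> j \<ge> 1 \<Longrightarrow>
      br (xgen i) (xgen j) = of_int (int j - int i) * xgen (i + j)"
  shows "br = witt_bracket"
proof -
  interpret poisson_algebra ring_of_type_algebra witt_sym br by fact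
  have al: "br (x + y) z = br x z + br y z" and ar: "br x (y + z) = br x y + br x z"
    and sl: "br (const c * x) y = const c * br x y"
    and sr: "br x (const c * y) = const c * br x y"
    and alt: "br x x = 0" and lb: "br x (y * z) = br x y * z + y * br x z" for x y z c
    using br_add_left[of x y z] br_add_right[of x y z] br_smult_left[of c x y]
      br_smult_right[of c x y] br_alternating[of x] br_leibniz[of x y z]
    by (simp_all add: witt_sym_def ring_of_type_algebra_def)
  have anti: "br x y = - br y x" for x y
  proof -
    have "br x y + br y x = 0" using alt[of "x + y"] unfolding al ar by (simp add: alt add.commute)
    then show ?thesis by (simp add: add_eq_0_iff2)
  qed
  have ll: "br (x * y) z = br x z * y + x * br y z" for x y z
    by (simp add: anti[of _ z] lb)
  have one: "br x 1 = 0" for x using lb[of x 1 1] by simp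
  have cr: "br x (const c) = 0" for x c using sr[of x c 1] by (simp add: one)
  have cl: "br (const c) x = 0" for x c using anti[of "const c" x] by (simp add: cr)
  have "br (xgen n) g = witt_bracket (xgen n) g" if "n \<ge> 1" for n g
    by (induction g rule: spoly_induct)
      (simp_all only: cr ar lb gen that witt_bracket_const witt_bracket_gen witt_bracket_add_right
        witt_bracket_leibniz)
  then have "br f g = witt_bracket f g" for f g
    by (induction f rule: spoly_induct)
      (simp_all add: cl al ll witt_bracket_add_left witt_bracket_leibniz_left)
  then show ?thesis by blast
qed

end

theory Submission
  imports Defs
begin

text \<open>Let \<open>0 \<noteq> f \<in> I\<close> and let \<open>N\<close> be the index of its top variable. Bracketing \<open>f\<close> with
  \<open>x\<^sub>i\<close> for large \<open>i\<close> gives an element of \<open>I\<close> in which the top variable occurs only in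
  \<open>(N - i) x\<^bsub>N+i\<^esub> \<partial>f/\<partial>x\<^sub>N\<close>, so modulo \<open>I\<close> and after inverting \<open>\<partial>f/\<partial>x\<^sub>N\<close> all variables are
  generated by finitely many. Taking successive top derivatives of \<open>f\<close> one ends at a nonzero
  constant, so every proper ideal above \<open>I\<close> contains one of these derivatives but not the
  next. Thus for a Poisson prime one derivative is inverted. In general \<open>I\<close> is the
  intersection of the Poisson primes above it, and these fall into finitely many strata on
  each of which a fixed derivative is inverted.\<close>

section \<open>Ideals of the symmetric algebra\<close>

text \<open>The Poisson primes above \<open>I\<close> can form an infinite family, so one
  localisation per prime does not add up to a finitely generated algebra. The derivative chain of a
  single \<open>f\<close> in \<open>I\<close> repairs this: its length depends on \<open>f\<close>
  alone, and the place where it leaves a prime sorts all primes, however many, into finitely many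
  strata. Characteristic zero enters twice: the derivative by a variable that occurs does not
  vanish, and the coefficient of the top term is invertible. The bound \<open>2 * N + 2\<close>
  below is written with the stored index \<open>N\<close> of the top variable, one less than in the
  overview: the relations used with \<open>i > N\<close> reach exactly the variables numbered
  \<open>i + N + 2\<close>, so from \<open>2 * N + 3\<close> on. Brackets of the finitely many
  generators leave the list of generators. Closure under the bracket is therefore checked on a
  redundant generating set of the same algebra, all polynomials together with the inverses, where
  the quotient rule gives it.\<close>

lemma witt_sym_simps [simp]:
  "carrier witt_sym = UNIV" "x \<otimes>\<^bsub>witt_sym\<^esub> y = x * y" "x \<oplus>\<^bsub>witt_sym\<^esub> y = x + y"
  "\<one>\<^bsub>witt_sym\<^esub> = 1" "\<zero>\<^bsub>witt_sym\<^esub> = 0" "c \<odot>\<^bsub>witt_sym\<^esub> x = const c * x"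
  by (simp_all add: witt_sym_def)

lemma ring_of_type_algebra_simps [simp]:
  "carrier ring_of_type_algebra = UNIV" "x \<otimes>\<^bsub>ring_of_type_algebra\<^esub> y = x * y"
  "x \<oplus>\<^bsub>ring_of_type_algebra\<^esub> y = x + y"
  "\<one>\<^bsub>ring_of_type_algebra\<^esub> = 1" "\<zero>\<^bsub>ring_of_type_algebra\<^esub> = 0"
  by (simp_all add: ring_of_type_algebra_def)

lemma witt_algebra: "algebra ring_of_type_algebra (witt_sym :: ('k::field_char_0, 'k spoly) module)"
  using witt_poisson_algebra by (rule poisson_algebra.axioms(1))

lemma witt_cring: "cring (witt_sym :: ('k::field_char_0, 'k spoly) module)"
  using witt_algebra by (rule algebra.axioms(2))

lemma ideal_witt_sym_iff:
  fixes I :: "'k::field_char_0 spoly set"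
  shows "ideal I witt_sym \<longleftrightarrow> 0 \<in> I \<and> (\<forall>x\<in>I. \<forall>y\<in>I. x + y \<in> I) \<and> (\<forall>x\<in>I. \<forall>y. y * x \<in> I)"
proof
  assume "ideal I (witt_sym :: ('k, 'k spoly) module)"
  then interpret ideal I "witt_sym :: ('k, 'k spoly) module" .
  show "0 \<in> I \<and> (\<forall>x\<in>I. \<forall>y\<in>I. x + y \<in> I) \<and> (\<forall>x\<in>I. \<forall>y. y * x \<in> I)"
    using additive_subgroup.zero_closed[OF is_additive_subgroup]
      additive_subgroup.a_closed[OF is_additive_subgroup] I_l_closed by auto
next
  assume a: "0 \<in> I \<and> (\<forall>x\<in>I. \<forall>y\<in>I. x + y \<in> I) \<and> (\<forall>x\<in>I. \<forall>y. y * x \<in> I)"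
  interpret S: cring "witt_sym :: ('k, 'k spoly) module" by (rule witt_cring)
  have neg: "\<ominus>\<^bsub>witt_sym\<^esub> x = - x" for x :: "'k spoly"
    using S.minus_equality[of "- x" x] by simp
  have z: "0 \<in> I" and d: "\<And>x y. x \<in> I \<Longrightarrow> y \<in> I \<Longrightarrow> x + y \<in> I"
    and l: "\<And>x y. x \<in> I \<Longrightarrow> y * x \<in> I" using a by blast+
  have n: "-x \<in> I" if "x \<in> I" for x using l[OF that, of "-1"] by simp
  have inv: "inv\<^bsub>add_monoid witt_sym\<^esub> x \<in> I" if "x \<in> I" for x
    using n[OF that] neg[of x] by (simp only: a_inv_def)
  have r: "x * y \<in> I" if "x \<in> I" for x y using l[OF that, of y] by (simp add: mult.commute)
  show "ideal I (witt_sym :: ('k, 'k spoly) module)"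
  proof (rule idealI[OF S.ring_axioms])
    show "subgroup I (add_monoid (witt_sym :: ('k, 'k spoly) module))"
      by (rule subgroup.intro) (use inv z d in auto)
  qed (use l r in auto)
qed

lemma witt_pow: "x [^]\<^bsub>witt_sym\<^esub> (n::nat) = x ^ n" for x :: "'k::field_char_0 spoly"
  by (induction n) (simp_all add: mult.commute)

text \<open>Testing squares suffices: for \<open>n \<ge> 1\<close> the square of
  \<open>x ^ n\<close> is a multiple of \<open>x ^ Suc n\<close>, so the exponent can be lowered one
  at a time.\<close>

lemma radical_witt_sym_iff:
  fixes I :: "'k::field_char_0 spoly set"
  shows "radical_ideal I witt_sym \<longleftrightarrow> ideal I witt_sym \<and> (\<forall>x. x * x \<in> I \<longrightarrow> x \<in> I)"
proof
  assume "radical_ideal I witt_sym"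
  then show "ideal I witt_sym \<and> (\<forall>x. x * x \<in> I \<longrightarrow> x \<in> I)"
    unfolding radical_ideal_def by (metis UNIV_I power2_eq_square witt_pow witt_sym_simps(1))
next
  assume a: "ideal I witt_sym \<and> (\<forall>x. x * x \<in> I \<longrightarrow> x \<in> I)"
  then have c: "\<forall>x\<in>I. \<forall>y. y * x \<in> I" unfolding ideal_witt_sym_iff by blast
  have "x \<in> I" if "x ^ n \<in> I" for x n
    using that
  proof (induction n)
    case 0
    then show ?case using c[rule_format, of 1 x] by simp
  next
    case (Suc n)
    show ?case
    proof (cases n)
      case (Suc m)
      have "x ^ n * x ^ n = x ^ m * x ^ Suc n" by (simp add: Suc mult_ac)
      then have "x ^ n * x ^ n \<in> I" using c Suc.prems by metis
      then show ?thesis using a Suc.IH by blast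
    qed (use Suc.prems in simp)
  qed
  then show "radical_ideal I witt_sym" using a unfolding radical_ideal_def witt_pow by blast
qed

lemma primeideal_witt_sym_iff:
  fixes P :: "'k::field_char_0 spoly set"
  shows "primeideal P witt_sym \<longleftrightarrow>
    ideal P witt_sym \<and> P \<noteq> UNIV \<and> (\<forall>a b. a * b \<in> P \<longrightarrow> a \<in> P \<or> b \<in> P)"
  using witt_cring[where 'k = 'k]
  by (auto simp: primeideal_def primeideal_axioms_def)

lemma ideal_colon:
  fixes I :: "'k::field_char_0 spoly set"
  assumes "ideal I witt_sym"
  shows "ideal {x. a * x \<in> I} witt_sym"
proof -
  have "a * (y * x) \<in> I" if "a * x \<in> I" for x y
    using assms that unfolding ideal_witt_sym_iff by (metis mult.left_commute)
  then show ?thesis using assms by (auto simp: ideal_witt_sym_iff distrib_left)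
qed

text \<open>Multiplying \<open>a * (x * x)\<close> by \<open>a\<close> gives the square of
  \<open>a * x\<close>.\<close>

lemma radical_colon:
  fixes I :: "'k::field_char_0 spoly set"
  assumes "radical_ideal I witt_sym"
  shows "radical_ideal {x. a * x \<in> I} witt_sym"
proof -
  have r: "x * x \<in> I \<Longrightarrow> x \<in> I" and c: "x \<in> I \<Longrightarrow> y * x \<in> I" for x y
    using assms unfolding radical_witt_sym_iff ideal_witt_sym_iff by blast+
  have "a * x \<in> I" if "a * (x * x) \<in> I" for x
  proof (rule r)
    show "a * x * (a * x) \<in> I" using c[OF that, of a] by (simp only: mult_ac)
  qed
  then show ?thesis using assms ideal_colon[of I a] unfolding radical_witt_sym_iff by blast
qed

text \<open>By Leibniz, \<open>a * {x, g} = {a * x, g} - x * {a, g}\<close>, and the last term need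
  not lie in \<open>I\<close>. Multiplying once more by \<open>a * {x, g}\<close> supplies the
  missing factor \<open>a\<close>, and radicality removes the resulting square.\<close>

lemma poisson_radical_colon:
  fixes I :: "'k::field_char_0 spoly set"
  assumes "radical_ideal I witt_sym" "poisson_ideal I witt_sym witt_bracket"
  shows "poisson_ideal {x. a * x \<in> I} witt_sym witt_bracket"
proof -
  have id: "ideal I witt_sym" and r: "x * x \<in> I \<Longrightarrow> x \<in> I"
    and br: "x \<in> I \<Longrightarrow> witt_bracket x g \<in> I" for x g
    using assms unfolding radical_witt_sym_iff poisson_ideal_def witt_sym_simps by blast+
  have c: "x \<in> I \<Longrightarrow> y * x \<in> I" and d: "x \<in> I \<Longrightarrow> y \<in> I \<Longrightarrow> x + y \<in> I" for x y
    using id by (auto simp: ideal_witt_sym_iff)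
  have "a * witt_bracket x g \<in> I" if x: "a * x \<in> I" for x g
  proof (rule r)
    let ?b = "witt_bracket x g"
    have "(a * ?b) * (a * ?b) = (?b * a) * witt_bracket (a * x) g + - (?b * witt_bracket a g) * (a * x)"
      by (simp add: witt_bracket_leibniz_left algebra_simps)
    also have "\<dots> \<in> I" by (rule d[OF c[OF br[OF x]] c[OF x]])
    finally show "(a * ?b) * (a * ?b) \<in> I" .
  qed
  then show ?thesis using ideal_colon[OF id] by (simp add: poisson_ideal_def)
qed

text \<open>An ideal maximal among the radical Poisson ideals avoiding \<open>s\<close> is prime, since
  colon ideals of radical Poisson ideals are again radical and Poisson.\<close>

theorem radical_poisson_separation:
  fixes I :: "'k::field_char_0 spoly set"
  assumes "radical_ideal I witt_sym" "poisson_ideal I witt_sym witt_bracket" "s \<notin> I"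
  obtains P where "primeideal P witt_sym" "poisson_ideal P witt_sym witt_bracket" "I \<subseteq> P" "s \<notin> P"
proof -
  define F where "F = {Q. radical_ideal Q witt_sym \<and> poisson_ideal Q witt_sym witt_bracket
    \<and> I \<subseteq> Q \<and> s \<notin> Q}"
  have "I \<in> F" using assms by (simp add: F_def)
  have "\<exists>M\<in>F. \<forall>Q\<in>F. M \<subseteq> Q \<longrightarrow> Q = M"
  proof (rule subset_Zorn_nonempty)
    show "F \<noteq> {}" using \<open>I \<in> F\<close> by blast
    fix C assume C: "C \<noteq> {}" "subset.chain F C"
    then have CA: "Q \<in> F" if "Q \<in> C" for Q using that by (auto simp: subset_chain_def)
    have pair: "\<exists>Q\<in>C. x \<in> Q \<and> y \<in> Q" if "x \<in> \<Union>C" "y \<in> \<Union>C" for x y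
      using that C(2) unfolding subset_chain_def by blast
    have rad: "radical_ideal Q witt_sym" and po: "poisson_ideal Q witt_sym witt_bracket"
      and Q: "I \<subseteq> Q" "s \<notin> Q" if "Q \<in> C" for Q
      using CA[OF that] by (auto simp: F_def)
    have id: "ideal Q witt_sym" if "Q \<in> C" for Q
      using rad[OF that] by (simp add: radical_ideal_def)
    have ideal: "ideal (\<Union>C) witt_sym"
      unfolding ideal_witt_sym_iff
    proof (intro conjI ballI allI)
      show "0 \<in> \<Union>C" using C(1) id by (auto simp: ideal_witt_sym_iff)
      show "x + y \<in> \<Union>C" if "x \<in> \<Union>C" "y \<in> \<Union>C" for x y
        using pair[OF that] id by (auto simp: ideal_witt_sym_iff)
      show "y * x \<in> \<Union>C" if "x \<in> \<Union>C" for x y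
        using that id unfolding ideal_witt_sym_iff by blast
    qed
    have "x \<in> \<Union>C" if "x * x \<in> \<Union>C" for x
      using that rad unfolding radical_witt_sym_iff by blast
    then have "radical_ideal (\<Union>C) witt_sym" using ideal unfolding radical_witt_sym_iff by blast
    moreover have "poisson_ideal (\<Union>C) witt_sym witt_bracket"
      using ideal po unfolding poisson_ideal_def by blast
    ultimately show "\<Union>C \<in> F" using C(1) Q by (auto simp: F_def)
  qed
  then obtain M where M: "M \<in> F" and max: "\<And>Q. Q \<in> F \<Longrightarrow> M \<subseteq> Q \<Longrightarrow> Q = M" by blast
  have rad: "radical_ideal M witt_sym" and po: "poisson_ideal M witt_sym witt_bracket"
    and IM: "I \<subseteq> M" and s: "s \<notin> M" using M by (auto simp: F_def)
  have c: "x \<in> M \<Longrightarrow> y * x \<in> M" for x y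
    using rad unfolding radical_witt_sym_iff ideal_witt_sym_iff by blast
  \<comment> \<open>Otherwise the colon ideal of \<open>a\<close> would be a member of
    \<open>F\<close> strictly above \<open>M\<close>: it contains \<open>b\<close> but not
    \<open>s\<close>.\<close>
  have colon: "a * s \<in> M" if "a * b \<in> M" "b \<notin> M" for a b
  proof (rule ccontr)
    assume "a * s \<notin> M"
    then have "{x. a * x \<in> M} \<in> F"
      using radical_colon[OF rad] poisson_radical_colon[OF rad po] IM c by (auto simp: F_def)
    then show False using max[of "{x. a * x \<in> M}"] c that by auto
  qed
  have "a \<in> M \<or> b \<in> M" if "a * b \<in> M" for a b
  proof (rule ccontr)
    assume n: "\<not> (a \<in> M \<or> b \<in> M)"
    \<comment> \<open>Replacing \<open>b\<close> by \<open>s\<close>, and then \<open>a\<close> by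
      \<open>s\<close>, turns \<open>a * b\<close> into \<open>s * s\<close>, which radicality
      excludes.\<close>
    then have "s * a \<in> M" using colon[OF that] by (simp add: mult.commute)
    then have "s * s \<in> M" using colon n by blast
    then show False using s rad unfolding radical_witt_sym_iff by blast
  qed
  then have "primeideal M witt_sym"
    using rad s by (auto simp: primeideal_witt_sym_iff radical_ideal_def)
  then show ?thesis using that po IM s by blast
qed


section \<open>Successive top partial derivatives\<close>

lemma keys_pdE:
  assumes "m \<in> Poly_Mapping.keys (pd i f)"
  obtains n where "n \<in> Poly_Mapping.keys f" "Poly_Mapping.lookup n i \<noteq> 0"
    "m = n - Poly_Mapping.single i 1"
proof -
  have "m \<in> (\<Union>n\<in>Poly_Mapping.keys f. Poly_Mapping.keys (Poly_Mapping.single (n - Poly_Mapping.single i 1)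
       (of_nat (Poly_Mapping.lookup n i) * Poly_Mapping.lookup f n)))"
    using assms Poly_Mapping.keys_sum unfolding pd_def by fast
  then obtain n where "n \<in> Poly_Mapping.keys f" "of_nat (Poly_Mapping.lookup n i) * Poly_Mapping.lookup f n \<noteq> 0"
    "m = n - Poly_Mapping.single i 1"
    by (auto split: if_splits)
  then show ?thesis using that[of n] by (metis mult_zero_left of_nat_0)
qed

lemma vars_pd: "vars (pd i f) \<subseteq> vars f"
proof
  fix j assume "j \<in> vars (pd i f)"
  then obtain m where m: "m \<in> Poly_Mapping.keys (pd i f)" "j \<in> Poly_Mapping.keys m"
    by (auto simp: vars_def)
  from m(1) obtain n where "n \<in> Poly_Mapping.keys f" "m = n - Poly_Mapping.single i 1"
    by (rule keys_pdE)
  with m(2) show "j \<in> vars f" by (force simp: vars_def in_keys_iff lookup_minus)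
qed

text \<open>Lowering the exponent of a variable is injective on the monomials that contain it, so
  nothing cancels; in characteristic zero the exponent in front stays nonzero.\<close>

lemma pd_neq_0:
  fixes f :: "'k::field_char_0 spoly"
  assumes "i \<in> vars f"
  shows "pd i f \<noteq> 0"
proof -
  obtain m where m: "m \<in> Poly_Mapping.keys f" "Poly_Mapping.lookup m i \<noteq> 0"
    using assms by (auto simp: vars_def in_keys_iff)
  have inj: "n = m" if "n - Poly_Mapping.single i 1 = m - Poly_Mapping.single i 1"
      "Poly_Mapping.lookup n i \<noteq> 0" for n
  proof (rule poly_mapping_eqI)
    fix j
    have "Poly_Mapping.lookup (n - Poly_Mapping.single i 1) j
      = Poly_Mapping.lookup (m - Poly_Mapping.single i 1) j" using that(1) by simp
    then show "Poly_Mapping.lookup n j = Poly_Mapping.lookup m j"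
      using m(2) that(2) by (auto simp: lookup_minus lookup_single when_def split: if_splits)
  qed
  have "Poly_Mapping.lookup (pd i f) (m - Poly_Mapping.single i 1) =
     (\<Sum>n\<in>Poly_Mapping.keys f. if n = m then of_nat (Poly_Mapping.lookup m i) * Poly_Mapping.lookup f m else 0)"
    unfolding pd_def lookup_sum
  proof (rule sum.cong)
    fix n assume "n \<in> Poly_Mapping.keys f"
    then show "Poly_Mapping.lookup (Poly_Mapping.single (n - Poly_Mapping.single i 1)
       (of_nat (Poly_Mapping.lookup n i) * Poly_Mapping.lookup f n)) (m - Poly_Mapping.single i 1)
      = (if n = m then of_nat (Poly_Mapping.lookup m i) * Poly_Mapping.lookup f m else 0)"
      using inj[of n] by (cases "Poly_Mapping.lookup n i = 0") (auto simp: lookup_single when_def)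
  qed simp
  also have "\<dots> \<noteq> 0" using m by (simp add: in_keys_iff)
  finally show ?thesis by auto
qed

lemma vars_empty_const:
  assumes "vars f = {}"
  shows "f = const (Poly_Mapping.lookup f 0)"
proof (rule poly_mapping_eqI)
  fix m
  have "m = 0" if "m \<in> Poly_Mapping.keys f" using assms that by (auto simp: vars_def)
  then show "Poly_Mapping.lookup f m = Poly_Mapping.lookup (const (Poly_Mapping.lookup f 0)) m"
    by (auto simp: const_def lookup_single when_def in_keys_iff)
qed

text \<open>For constant \<open>f\<close> the index \<open>Max {}\<close> is unspecified, but the
  derivative is zero whatever it is.\<close>

definition top_pd :: "'k::comm_ring_1 spoly \<Rightarrow> 'k spoly" where
  "top_pd f = pd (Max (vars f)) f"

lemma top_pd_eq_0D:
  fixes f :: "'k::field_char_0 spoly"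
  assumes "top_pd f = 0"
  shows "vars f = {}"
  using assms pd_neq_0 Max_in[OF finite_vars] unfolding top_pd_def by blast

lemma vars_top_pd_pow: "vars ((top_pd ^^ n) f) \<subseteq> vars f"
proof (induction n)
  case (Suc n)
  then show ?case using vars_pd unfolding top_pd_def funpow.simps comp_def by blast
qed simp

text \<open>Each derivative lowers the total degree of every surviving monomial by one;
  \<open>d\<close> bounds this degree.\<close>

lemma top_pd_nilpotent: "\<exists>n. (top_pd ^^ n) f = 0"
proof -
  have "(top_pd ^^ Suc d) f = 0"
    if "\<And>m. m \<in> Poly_Mapping.keys f \<Longrightarrow> sum (Poly_Mapping.lookup m) (vars f) \<le> d" for f :: "'a spoly" and d
    using that
  proof (induction d arbitrary: f)
    case 0
    have "Poly_Mapping.lookup m i = 0" if "m \<in> Poly_Mapping.keys f" for m i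
      using 0[OF that] that by (cases "i \<in> vars f") (auto simp: vars_def in_keys_iff)
    then show ?case by (simp add: top_pd_def pd_def)
  next
    case (Suc d)
    let ?i = "Max (vars f)"
    have "(top_pd ^^ Suc d) (top_pd f) = 0"
    proof (rule Suc.IH)
      fix m assume "m \<in> Poly_Mapping.keys (top_pd f)"
      then obtain n where n: "n \<in> Poly_Mapping.keys f" "Poly_Mapping.lookup n ?i \<noteq> 0"
        "m = n - Poly_Mapping.single ?i 1"
        unfolding top_pd_def by (rule keys_pdE)
      have i: "?i \<in> vars f" using n by (auto simp: vars_def in_keys_iff)
      have "sum (Poly_Mapping.lookup m) (vars (top_pd f)) \<le> sum (Poly_Mapping.lookup m) (vars f)"
        using vars_pd by (intro sum_mono2) (auto simp: top_pd_def)
      also have "\<dots> < sum (Poly_Mapping.lookup n) (vars f)"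
        using i n(2) by (intro sum_strict_mono_ex1 ballI bexI[of _ ?i])
          (auto simp: n(3) lookup_minus lookup_single when_def)
      also have "\<dots> \<le> Suc d" using Suc.prems n(1) by blast
      finally show "sum (Poly_Mapping.lookup m) (vars (top_pd f)) \<le> d" by simp
    qed
    then show ?case by (simp only: funpow_Suc_right comp_def)
  qed
  from this[of f "Max ((\<lambda>m. sum (Poly_Mapping.lookup m) (vars f)) ` Poly_Mapping.keys f)"]
  show ?thesis by (metis Max_ge finite_imageI finite_keys imageI)
qed

text \<open>Unlike \<open>spoly_induct\<close>, this asks only for the variables that occur in
  \<open>f\<close>, so it applies while \<open>T\<close> is known to contain an initial segment of
  the variables only.\<close>

lemma subring_contains_poly:
  fixes f :: "'k::comm_ring_1 spoly"
  assumes c: "\<And>c. const c \<in> T" and a: "\<And>f g. f \<in> T \<Longrightarrow> g \<in> T \<Longrightarrow> f + g \<in> T"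
    and m: "\<And>f g. f \<in> T \<Longrightarrow> g \<in> T \<Longrightarrow> f * g \<in> T"
    and x: "\<And>i. i \<in> vars f \<Longrightarrow> xgen (Suc i) \<in> T"
  shows "f \<in> T"
proof -
  have pw: "Poly_Mapping.single (Poly_Mapping.single i k) 1 \<in> T" if "i \<in> vars f" for i k
  proof (induction k)
    case 0
    then show ?case using c[of 1] by (simp add: const_def)
  next
    case (Suc k)
    have "Poly_Mapping.single (Poly_Mapping.single i (Suc k)) (1::'k)
        = xgen (Suc i) * Poly_Mapping.single (Poly_Mapping.single i k) 1"
      by (simp add: xgen_def mult_single flip: single_add)
    then show ?case using m x[OF that] Suc by simp
  qed
  have mono: "Poly_Mapping.single n b \<in> T" if "n \<in> Poly_Mapping.keys f" for n b
  proof -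
    have n_eq: "n = (\<Sum>i\<in>Poly_Mapping.keys n. Poly_Mapping.single i (Poly_Mapping.lookup n i))"
      by (rule poly_mapping_eqI)
        (auto simp: lookup_sum lookup_single when_def sum.delta in_keys_iff)
    have "Poly_Mapping.single (\<Sum>i\<in>A. Poly_Mapping.single i (Poly_Mapping.lookup n i)) 1 \<in> T"
      if "finite A" "A \<subseteq> vars f" for A
      using that
    proof induction
      case empty
      then show ?case using c[of 1] by (simp add: const_def)
    next
      case (insert i A)
      then show ?case using m[OF pw[of i "Poly_Mapping.lookup n i"] insert.IH]
        by (simp add: mult_single)
    qed
    moreover have "Poly_Mapping.keys n \<subseteq> vars f" using that by (auto simp: vars_def)
    ultimately have "Poly_Mapping.single n 1 \<in> T" using n_eq finite_keys by metis
    then have "const b * Poly_Mapping.single n 1 \<in> T" using m c by blast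
    then show ?thesis by (simp add: const_def mult_single)
  qed
  have "(\<Sum>m\<in>M. Poly_Mapping.single m (Poly_Mapping.lookup f m)) \<in> T"
    if "finite M" "M \<subseteq> Poly_Mapping.keys f" for M
    using that
  proof induction
    case empty
    then show ?case using c[of 0] by simp
  qed (simp add: a mono)
  then show ?thesis using spoly_sum_monomials[of f] finite_keys by (metis subset_refl)
qed

text \<open>Stored indices are one less than the variable numbers, so \<open>i + j + 2\<close> is
  the number \<open>(i + 1) + (j + 1)\<close>.\<close>

lemma witt_bracket_xgen_left:
  "witt_bracket (xgen (Suc i)) f =
     (\<Sum>j\<in>vars f. of_int (int j - int i) * xgen (i + j + 2) * pd j f)"
proof -
  have "vars (xgen (Suc i) :: 'a spoly) \<subseteq> {i}"
    by (auto simp: vars_def xgen_def split: if_splits)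
  from witt_bracket_superset[OF _ this finite_vars subset_refl, of f]
  show ?thesis by (simp add: pd_xgen)
qed


section \<open>Algebras and Poisson algebras\<close>

context algebra
begin

lemma is_subalgebraI:
  assumes "B \<subseteq> carrier M" "\<one>\<^bsub>M\<^esub> \<in> B"
    and "\<And>x y. x \<in> B \<Longrightarrow> y \<in> B \<Longrightarrow> x \<oplus>\<^bsub>M\<^esub> y \<in> B"
    and "\<And>x y. x \<in> B \<Longrightarrow> y \<in> B \<Longrightarrow> x \<otimes>\<^bsub>M\<^esub> y \<in> B"
    and smult: "\<And>c x. c \<in> carrier R \<Longrightarrow> x \<in> B \<Longrightarrow> c \<odot>\<^bsub>M\<^esub> x \<in> B"
  shows "is_subalgebra R M B"
proof -
  have "\<ominus>\<^bsub>M\<^esub> x \<in> B" if "x \<in> B" for x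
  proof -
    have "\<ominus>\<^bsub>M\<^esub> x = (\<ominus>\<^bsub>R\<^esub> \<one>\<^bsub>R\<^esub>) \<odot>\<^bsub>M\<^esub> x"
      using that assms(1) by (subst smult_l_minus) auto
    then show ?thesis using smult that by simp
  qed
  then have "subring B M"
    using assms by (intro subringI) auto
  then show ?thesis using smult by (simp add: is_subalgebra_def)
qed

lemma is_subalgebraD:
  assumes "is_subalgebra R M B"
  shows "B \<subseteq> carrier M" "\<one>\<^bsub>M\<^esub> \<in> B" "\<zero>\<^bsub>M\<^esub> \<in> B"
    and "x \<in> B \<Longrightarrow> y \<in> B \<Longrightarrow> x \<oplus>\<^bsub>M\<^esub> y \<in> B" "x \<in> B \<Longrightarrow> y \<in> B \<Longrightarrow> x \<otimes>\<^bsub>M\<^esub> y \<in> B"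
    and "x \<in> B \<Longrightarrow> \<ominus>\<^bsub>M\<^esub> x \<in> B" "c \<in> carrier R \<Longrightarrow> x \<in> B \<Longrightarrow> c \<odot>\<^bsub>M\<^esub> x \<in> B"
  using assms subringE[of B M] by (auto simp: is_subalgebra_def)

lemma subalgebra_carrier: "is_subalgebra R M (carrier M)"
  by (rule is_subalgebraI) auto

lemma subalg_gen_incl: "G \<subseteq> subalg_gen R M G"
  by (auto simp: subalg_gen_def)

lemma subalg_gen_min: "is_subalgebra R M B \<Longrightarrow> G \<subseteq> B \<Longrightarrow> subalg_gen R M G \<subseteq> B"
  by (auto simp: subalg_gen_def)

lemma subalg_gen_subalgebra:
  assumes "G \<subseteq> carrier M"
  shows "is_subalgebra R M (subalg_gen R M G)"
proof (rule is_subalgebraI)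
  show "subalg_gen R M G \<subseteq> carrier M"
    using assms subalg_gen_min subalgebra_carrier by blast
qed (auto simp: subalg_gen_def dest: is_subalgebraD)

lemma subalg_gen_eqI:
  assumes "G \<subseteq> H" "H \<subseteq> subalg_gen R M G" "H \<subseteq> carrier M"
  shows "subalg_gen R M G = subalg_gen R M H"
proof
  show "subalg_gen R M H \<subseteq> subalg_gen R M G"
    using assms by (intro subalg_gen_min subalg_gen_subalgebra) auto
  show "subalg_gen R M G \<subseteq> subalg_gen R M H"
    using assms(1) by (auto simp: subalg_gen_def)
qed

lemma algebra_restrict:
  assumes "is_subalgebra R M B"
  shows "algebra R (M\<lparr>carrier := B\<rparr>)"
proof -
  note B = is_subalgebraD[OF assms]
  have c: "x \<in> carrier M" if "x \<in> B" for x using B(1) that by blast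
  have "cring (M\<lparr>carrier := B\<rparr>)"
  proof (intro cringI abelian_groupI comm_monoidI)
    fix x assume "x \<in> carrier (M\<lparr>carrier := B\<rparr>)"
    then show "\<exists>y\<in>carrier (M\<lparr>carrier := B\<rparr>). y \<oplus>\<^bsub>M\<lparr>carrier := B\<rparr>\<^esub> x = \<zero>\<^bsub>M\<lparr>carrier := B\<rparr>\<^esub>"
      using B c[of x] by (intro bexI[of _ "\<ominus>\<^bsub>M\<^esub> x"]) (auto simp: M.l_neg)
  qed (auto simp: B c M.a_assoc m_assoc l_distr intro: M.a_comm m_comm)
  then show ?thesis
    by (rule algebraI[OF R_cring]) (auto simp: B c smult_l_distr smult_r_distr smult_assoc1 smult_assoc2)
qed

text \<open>Finite generation refers to subalgebras of the restricted algebra. Each of them is also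
  a subalgebra of \<open>M\<close>, so generating inside the restriction gives nothing
  smaller.\<close>

lemma fg_algebra_subalg_gen:
  assumes "finite G" "G \<subseteq> carrier M"
  shows "fg_algebra R (M\<lparr>carrier := subalg_gen R M G\<rparr>)"
proof -
  let ?C = "subalg_gen R M G"
  let ?N = "M\<lparr>carrier := ?C\<rparr>"
  have C: "is_subalgebra R M ?C" by (rule subalg_gen_subalgebra[OF assms(2)])
  interpret N: algebra R ?N by (rule algebra_restrict[OF C])
  have "?C \<subseteq> B" if B: "is_subalgebra R ?N B" "G \<subseteq> B" for B
  proof (rule subalg_gen_min[OF _ B(2)])
    show "is_subalgebra R M B"
      using N.is_subalgebraD[OF B(1)] is_subalgebraD(1)[OF C]
      by (intro is_subalgebraI) auto
  qed
  then have "?C = subalg_gen R ?N G"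
    using N.subalg_gen_min[OF N.subalgebra_carrier, of G] subalg_gen_incl[of G]
    unfolding subalg_gen_def[of R ?N] by auto
  then show ?thesis
    using assms(1) subalg_gen_incl[of G] N.algebra_axioms
    by (auto simp: fg_algebra_def fg_subalgebra_def)
qed

end

lemma alg_homD:
  assumes "h \<in> alg_hom K A B"
  shows "x \<in> carrier A \<Longrightarrow> h x \<in> carrier B"
    and "x \<in> carrier A \<Longrightarrow> y \<in> carrier A \<Longrightarrow> h (x \<oplus>\<^bsub>A\<^esub> y) = h x \<oplus>\<^bsub>B\<^esub> h y"
    and "x \<in> carrier A \<Longrightarrow> y \<in> carrier A \<Longrightarrow> h (x \<otimes>\<^bsub>A\<^esub> y) = h x \<otimes>\<^bsub>B\<^esub> h y"
    and "h \<one>\<^bsub>A\<^esub> = \<one>\<^bsub>B\<^esub>"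
    and "c \<in> carrier K \<Longrightarrow> x \<in> carrier A \<Longrightarrow> h (c \<odot>\<^bsub>A\<^esub> x) = c \<odot>\<^bsub>B\<^esub> h x"
  using assms by (auto simp: alg_hom_def ring_hom_def)

lemma alg_hom_zero:
  assumes "h \<in> alg_hom K A B" "algebra K A" "algebra K B"
  shows "h \<zero>\<^bsub>A\<^esub> = \<zero>\<^bsub>B\<^esub>"
proof -
  interpret A: algebra K A by fact
  interpret B: algebra K B by fact
  show ?thesis
    using assms(1) ring_hom_zero[OF _ A.ring_axioms B.ring_axioms] by (simp add: alg_hom_def)
qed

lemma subalgebra_vimage:
  assumes "h \<in> alg_hom K A B" "algebra K A" "algebra K B" "is_subalgebra K B C"
  shows "is_subalgebra K A {x \<in> carrier A. h x \<in> C}"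
proof -
  interpret A: algebra K A by fact
  interpret B: algebra K B by fact
  show ?thesis
    using B.is_subalgebraD[OF assms(4)] by (intro A.is_subalgebraI) (auto simp: alg_homD[OF assms(1)])
qed

lemma fg_algebra_image:
  assumes h: "h \<in> alg_hom K A B" "h ` carrier A = carrier B" and A: "fg_algebra K A" and B: "algebra K B"
  shows "fg_algebra K B"
proof -
  interpret A: algebra K A using A by (simp add: fg_algebra_def)
  interpret B: algebra K B by fact
  obtain G where G: "finite G" "G \<subseteq> carrier A" "carrier A = subalg_gen K A G"
    using A by (auto simp: fg_algebra_def fg_subalgebra_def)
  have hG: "h ` G \<subseteq> carrier B" using G(2) h(2) by blast
  let ?C = "subalg_gen K B (h ` G)"
  have C: "is_subalgebra K B ?C" by (rule B.subalg_gen_subalgebra[OF hG])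
  have "carrier A \<subseteq> {x \<in> carrier A. h x \<in> ?C}"
    using A.subalg_gen_min[OF subalgebra_vimage[OF h(1) A.algebra_axioms B C], of G] G
      B.subalg_gen_incl[of "h ` G"] by blast
  then have "carrier B = ?C"
    using h(2)[symmetric] B.is_subalgebraD(1)[OF C] by auto
  then show ?thesis
    using G(1) hG B by (auto simp: fg_algebra_def fg_subalgebra_def)
qed

lemma reduced_alg_hom:
  assumes h: "h \<in> alg_hom K A B" "inj_on h (carrier A)" and A: "algebra K A" and B: "algebra K B"
    and "reduced B"
  shows "reduced A"
  unfolding reduced_def
proof (intro ballI allI impI)
  fix x and n :: nat
  interpret A: algebra K A by fact
  assume x: "x \<in> carrier A" "x [^]\<^bsub>A\<^esub> n = \<zero>\<^bsub>A\<^esub>"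
  have "h (x [^]\<^bsub>A\<^esub> n) = h x [^]\<^bsub>B\<^esub> n"
    by (induction n) (simp_all add: alg_homD[OF h(1)] x(1))
  then have "h x = \<zero>\<^bsub>B\<^esub>"
    using \<open>reduced B\<close> x alg_homD(1)[OF h(1)] alg_hom_zero[OF h(1) A B]
    unfolding reduced_def by metis
  then show "x = \<zero>\<^bsub>A\<^esub>"
    using inj_onD[OF h(2), of x "\<zero>\<^bsub>A\<^esub>"] x(1) alg_hom_zero[OF h(1) A B] by simp
qed

lemma poisson_homI:
  assumes "h \<in> alg_hom K A B"
    and "\<And>x y. x \<in> carrier A \<Longrightarrow> y \<in> carrier A \<Longrightarrow> h (brA x y) = brB (h x) (h y)"
  shows "h \<in> poisson_hom K A brA B brB"
  using assms by (simp add: poisson_hom_def)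

lemma poisson_homD:
  assumes "h \<in> poisson_hom K A brA B brB"
  shows "h \<in> alg_hom K A B"
    and "x \<in> carrier A \<Longrightarrow> y \<in> carrier A \<Longrightarrow> h (brA x y) = brB (h x) (h y)"
  using assms by (auto simp: poisson_hom_def)

lemma alg_hom_compose:
  assumes "h \<in> alg_hom K A B" "h' \<in> alg_hom K B C"
  shows "(\<lambda>x. h' (h x)) \<in> alg_hom K A C"
  using assms by (auto simp: alg_hom_def ring_hom_def Pi_iff)

lemma poisson_hom_compose:
  assumes "h \<in> poisson_hom K A brA B brB" "h' \<in> poisson_hom K B brB C brC"
  shows "(\<lambda>x. h' (h x)) \<in> poisson_hom K A brA C brC"
proof (rule poisson_homI)
  note h = poisson_homD[OF assms(1)] and h' = poisson_homD[OF assms(2)]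
  show "(\<lambda>x. h' (h x)) \<in> alg_hom K A C" by (rule alg_hom_compose[OF h(1) h'(1)])
  show "h' (h (brA x y)) = brC (h' (h x)) (h' (h y))" if "x \<in> carrier A" "y \<in> carrier A" for x y
    using that by (simp add: h(2) h'(2) alg_homD(1)[OF h(1)])
qed

section \<open>Brackets on generated subalgebras\<close>

context poisson_algebra
begin

lemma br_anti:
  assumes "x \<in> carrier A" "y \<in> carrier A"
  shows "br x y = \<ominus>\<^bsub>A\<^esub> br y x"
proof -
  have "br (y \<oplus>\<^bsub>A\<^esub> x) (y \<oplus>\<^bsub>A\<^esub> x) = br x y \<oplus>\<^bsub>A\<^esub> br y x"
    using assms by (simp add: br_add_left br_add_right br_alternating[of x] br_alternating[of y] br_closed
        M.a_comm[of "br x y" "br y x"])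
  then have "br x y \<oplus>\<^bsub>A\<^esub> br y x = \<zero>\<^bsub>A\<^esub>"
    using assms br_alternating[of "y \<oplus>\<^bsub>A\<^esub> x"] by simp
  then show ?thesis using assms by (simp add: M.minus_equality br_closed)
qed

lemma br_one:
  assumes "x \<in> carrier A"
  shows "br x \<one>\<^bsub>A\<^esub> = \<zero>\<^bsub>A\<^esub>"
  using br_leibniz[of x "\<one>\<^bsub>A\<^esub>" "\<one>\<^bsub>A\<^esub>"] assms br_closed[of x "\<one>\<^bsub>A\<^esub>"]
  by (simp add: M.add.l_cancel_one)

lemma br_zero:
  assumes "x \<in> carrier A"
  shows "br x \<zero>\<^bsub>A\<^esub> = \<zero>\<^bsub>A\<^esub>"
  using br_add_right[of x "\<zero>\<^bsub>A\<^esub>" "\<zero>\<^bsub>A\<^esub>"] assms br_closed[of x "\<zero>\<^bsub>A\<^esub>"]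
  by (simp add: M.add.l_cancel_one)

text \<open>For fixed \<open>z\<close>, the \<open>y\<close> in the generated subalgebra
  \<open>?C\<close> whose bracket with \<open>z\<close> stays in \<open>?C\<close> form a
  subalgebra. This is applied with \<open>z\<close> a generator and then, after antisymmetry, with
  \<open>z\<close> an arbitrary element.\<close>

lemma subalg_gen_br_closed:
  assumes G: "G \<subseteq> carrier A" and br: "\<And>g h. g \<in> G \<Longrightarrow> h \<in> G \<Longrightarrow> br g h \<in> subalg_gen K A G"
    and xy: "x \<in> subalg_gen K A G" "y \<in> subalg_gen K A G"
  shows "br x y \<in> subalg_gen K A G"
proof -
  let ?C = "subalg_gen K A G"
  note C = is_subalgebraD[OF subalg_gen_subalgebra[OF G]]
  have ext: "br z y \<in> ?C" if z: "z \<in> carrier A" and g: "\<And>g. g \<in> G \<Longrightarrow> br z g \<in> ?C"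
    and y: "y \<in> ?C" for z y
  proof -
    have "is_subalgebra K A {y \<in> ?C. br z y \<in> ?C}"
      using C z
      by (intro is_subalgebraI)
        (auto simp: br_one br_add_right br_leibniz br_smult_right subset_iff)
    then have "?C \<subseteq> {y \<in> ?C. br z y \<in> ?C}"
      using g subalg_gen_incl[of G] by (intro subalg_gen_min) auto
    then show ?thesis using y by blast
  qed
  have "br g x \<in> ?C" if "g \<in> G" for g
    using ext[of g x] that G br xy(1) by blast
  then have "br x g \<in> ?C" if "g \<in> G" for g
    using br_anti[of x g] that G C(1,6) xy(1) by (metis subsetD)
  then show ?thesis using ext[of x y] C(1) xy by blast
qed

lemma poisson_restrict:
  assumes B: "is_subalgebra K A B" and br: "\<And>x y. x \<in> B \<Longrightarrow> y \<in> B \<Longrightarrow> br x y \<in> B"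
  shows "poisson_algebra K (A\<lparr>carrier := B\<rparr>) br"
proof -
  have c: "x \<in> carrier A" if "x \<in> B" for x using is_subalgebraD(1)[OF B] that by blast
  show ?thesis
    by (rule poisson_algebra.intro[OF algebra_restrict[OF B]])
      (unfold_locales; simp add: c br br_add_left br_add_right br_smult_left br_smult_right
        br_alternating br_jacobi br_leibniz)
qed

end

subsection \<open>Products\<close>

text \<open>Elements are extensional functions, so that they are determined by their values on
  \<open>J\<close>. The set \<open>J\<close> may be infinite, and for empty \<open>J\<close> this is
  the zero algebra.\<close>

definition prod_alg :: "'i set \<Rightarrow> ('i \<Rightarrow> ('k, 'a, 'd) module_scheme) \<Rightarrow> ('k, 'i \<Rightarrow> 'a) module" where
  "prod_alg J A = \<lparr>carrier = Pi\<^sub>E J (\<lambda>i. carrier (A i)),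
     monoid.mult = (\<lambda>f g. \<lambda>i\<in>J. f i \<otimes>\<^bsub>A i\<^esub> g i), one = (\<lambda>i\<in>J. \<one>\<^bsub>A i\<^esub>),
     zero = (\<lambda>i\<in>J. \<zero>\<^bsub>A i\<^esub>), add = (\<lambda>f g. \<lambda>i\<in>J. f i \<oplus>\<^bsub>A i\<^esub> g i),
     module.smult = (\<lambda>c f. \<lambda>i\<in>J. c \<odot>\<^bsub>A i\<^esub> f i)\<rparr>"

lemma prod_alg_simps:
  "carrier (prod_alg J A) = Pi\<^sub>E J (\<lambda>i. carrier (A i))"
  "f \<otimes>\<^bsub>prod_alg J A\<^esub> g = (\<lambda>i\<in>J. f i \<otimes>\<^bsub>A i\<^esub> g i)"
  "f \<oplus>\<^bsub>prod_alg J A\<^esub> g = (\<lambda>i\<in>J. f i \<oplus>\<^bsub>A i\<^esub> g i)"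
  "\<one>\<^bsub>prod_alg J A\<^esub> = (\<lambda>i\<in>J. \<one>\<^bsub>A i\<^esub>)" "\<zero>\<^bsub>prod_alg J A\<^esub> = (\<lambda>i\<in>J. \<zero>\<^bsub>A i\<^esub>)"
  "c \<odot>\<^bsub>prod_alg J A\<^esub> f = (\<lambda>i\<in>J. c \<odot>\<^bsub>A i\<^esub> f i)"
  by (simp_all add: prod_alg_def)

lemma prod_alg_algebra:
  assumes "cring K" and A: "\<And>i. i \<in> J \<Longrightarrow> algebra K (A i)"
  shows "algebra K (prod_alg J A)"
proof -
  have ring: "cring (A i)" if "i \<in> J" for i using A[OF that] by (rule algebra.axioms(2))
  have mod: "module K (A i)" if "i \<in> J" for i using A[OF that] by (rule algebra.axioms(1))
  note ab = ring[THEN cring.axioms(1), THEN ring.is_abelian_group]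
  have "cring (prod_alg J A)"
  proof (intro cringI abelian_groupI comm_monoidI)
    fix f assume f: "f \<in> carrier (prod_alg J A)"
    then show "\<exists>g\<in>carrier (prod_alg J A). g \<oplus>\<^bsub>prod_alg J A\<^esub> f = \<zero>\<^bsub>prod_alg J A\<^esub>"
      by (intro bexI[of _ "\<lambda>i\<in>J. \<ominus>\<^bsub>A i\<^esub> f i"])
        (auto simp: prod_alg_simps restrict_def fun_eq_iff abelian_group.l_neg[OF ab]
          abelian_group.a_inv_closed[OF ab] PiE_iff extensional_def)
  qed (auto simp: prod_alg_simps restrict_def fun_eq_iff PiE_iff extensional_def
      cring.cring_simprules[OF ring] monoid.r_one[OF ring[THEN cring.axioms(1), THEN ring.is_monoid]])
  then show ?thesis
    by (rule algebraI[OF assms(1)])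
      (auto simp: prod_alg_simps restrict_def fun_eq_iff PiE_iff extensional_def
        module.smult_closed[OF mod] module.smult_l_distr[OF mod] module.smult_r_distr[OF mod]
        module.smult_assoc1[OF mod] module.smult_one[OF mod] algebra.smult_assoc2[OF A])
qed

lemma prod_alg_poisson:
  assumes "cring K" and A: "\<And>i. i \<in> J \<Longrightarrow> poisson_algebra K (A i) (br i)"
  shows "poisson_algebra K (prod_alg J A) (\<lambda>f g. \<lambda>i\<in>J. br i (f i) (g i))"
proof (rule poisson_algebra.intro)
  show "algebra K (prod_alg J A)"
    using assms by (intro prod_alg_algebra) (auto dest: poisson_algebra.axioms(1))
  show "poisson_algebra_axioms K (prod_alg J A) (\<lambda>f g. \<lambda>i\<in>J. br i (f i) (g i))"
    by unfold_locales
      (auto simp: prod_alg_simps restrict_def fun_eq_iff PiE_iff extensional_def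
        poisson_algebra.br_closed[OF A] poisson_algebra.br_add_left[OF A]
        poisson_algebra.br_add_right[OF A] poisson_algebra.br_smult_left[OF A]
        poisson_algebra.br_smult_right[OF A] poisson_algebra.br_alternating[OF A]
        poisson_algebra.br_jacobi[OF A] poisson_algebra.br_leibniz[OF A])
qed

lemma prod_alg_reduced:
  assumes "\<And>i. i \<in> J \<Longrightarrow> reduced (A i)"
  shows "reduced (prod_alg J A)"
  unfolding reduced_def
proof (intro ballI allI impI)
  fix f and n :: nat
  assume f: "f \<in> carrier (prod_alg J A)" "f [^]\<^bsub>prod_alg J A\<^esub> n = \<zero>\<^bsub>prod_alg J A\<^esub>"
  have pw: "(f [^]\<^bsub>prod_alg J A\<^esub> n) i = f i [^]\<^bsub>A i\<^esub> n" if "i \<in> J" for i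
    by (induction n) (simp_all add: prod_alg_simps that)
  have "f i = \<zero>\<^bsub>A i\<^esub>" if i: "i \<in> J" for i
    using pw[OF i] f assms[OF i] i unfolding reduced_def by (auto simp: prod_alg_simps PiE_iff)
  then show "f = \<zero>\<^bsub>prod_alg J A\<^esub>"
    using f(1) by (auto simp: prod_alg_simps PiE_iff extensional_def fun_eq_iff)
qed

lemma prod_alg_hom:
  assumes "\<And>i. i \<in> J \<Longrightarrow> h i \<in> poisson_hom K B brB (A i) (br i)"
  shows "(\<lambda>x. \<lambda>i\<in>J. h i x) \<in> poisson_hom K B brB (prod_alg J A) (\<lambda>f g. \<lambda>i\<in>J. br i (f i) (g i))"
proof (rule poisson_homI)
  note h = alg_homD[OF poisson_homD(1)[OF assms]] and br = poisson_homD(2)[OF assms]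
  show "(\<lambda>x. \<lambda>i\<in>J. h i x) \<in> alg_hom K B (prod_alg J A)"
    by (auto simp: alg_hom_def ring_hom_def prod_alg_simps restrict_def fun_eq_iff h)
  show "(\<lambda>i\<in>J. h i (brB x y)) = (\<lambda>i\<in>J. br i ((\<lambda>i\<in>J. h i x) i) ((\<lambda>i\<in>J. h i y) i))"
    if "x \<in> carrier B" "y \<in> carrier B" for x y
    using that by (auto simp: br)
qed

subsection \<open>Transport of structure\<close>

text \<open>Meant for injective \<open>h\<close>: it carries an algebra over to another element
  type, since the type of the algebra to be found is prescribed.\<close>

definition transport_alg :: "('a \<Rightarrow> 'b) \<Rightarrow> ('k, 'a, 'd) module_scheme \<Rightarrow> ('k, 'b) module" where
  "transport_alg h A = (let r = inv_into (carrier A) h in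
     \<lparr>carrier = h ` carrier A, monoid.mult = (\<lambda>x y. h (r x \<otimes>\<^bsub>A\<^esub> r y)), one = h \<one>\<^bsub>A\<^esub>,
      zero = h \<zero>\<^bsub>A\<^esub>, add = (\<lambda>x y. h (r x \<oplus>\<^bsub>A\<^esub> r y)), module.smult = (\<lambda>c x. h (c \<odot>\<^bsub>A\<^esub> r x))\<rparr>)"

lemma transport_poisson:
  assumes A: "poisson_algebra K A br" and h: "inj_on h (carrier A)"
  defines "br' \<equiv> \<lambda>x y. h (br (inv_into (carrier A) h x) (inv_into (carrier A) h y))"
  shows "poisson_algebra K (transport_alg h A) br'"
    and "h \<in> poisson_hom K A br (transport_alg h A) br'"
    and "h ` carrier A = carrier (transport_alg h A)"
proof -
  interpret poisson_algebra K A br by fact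
  note s = transport_alg_def Let_def inv_into_f_f[OF h]
  have "cring (transport_alg h A)"
  proof (intro cringI abelian_groupI comm_monoidI)
    fix x assume x: "x \<in> carrier (transport_alg h A)"
    then obtain a where "a \<in> carrier A" "x = h a" by (auto simp: s)
    then show "\<exists>y\<in>carrier (transport_alg h A). y \<oplus>\<^bsub>transport_alg h A\<^esub> x = \<zero>\<^bsub>transport_alg h A\<^esub>"
      by (intro bexI[of _ "h (\<ominus>\<^bsub>A\<^esub> a)"]) (auto simp: s M.l_neg)
  qed (auto simp: s M.a_ac m_ac r_distr)
  then have "algebra K (transport_alg h A)"
    by (rule algebraI[OF R_cring]) (auto simp: s smult_l_distr smult_r_distr smult_assoc1 smult_assoc2)
  then show "poisson_algebra K (transport_alg h A) br'"
    by (rule poisson_algebra.intro)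
      (unfold_locales; auto simp: s br'_def br_closed br_add_left br_add_right br_smult_left br_smult_right
        br_alternating br_jacobi br_leibniz)
  show "h \<in> poisson_hom K A br (transport_alg h A) br'"
    by (auto simp: poisson_hom_def alg_hom_def s br'_def intro!: ring_hom_memI)
  show "h ` carrier A = carrier (transport_alg h A)" by (simp add: s)
qed

lemma transport_reduced:
  assumes A: "poisson_algebra K A br" and h: "inj_on h (carrier A)" and "reduced A"
  shows "reduced (transport_alg h A)"
proof -
  interpret poisson_algebra K A br by fact
  interpret T: poisson_algebra K "transport_alg h A"
      "\<lambda>x y. h (br (inv_into (carrier A) h x) (inv_into (carrier A) h y))"
    by (rule transport_poisson(1)[OF A h])
  have "inv_into (carrier A) h \<in> alg_hom K (transport_alg h A) A"
    by (auto simp: alg_hom_def ring_hom_def transport_alg_def Let_def inv_into_f_f[OF h])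
  moreover have "inj_on (inv_into (carrier A) h) (carrier (transport_alg h A))"
    by (auto simp: transport_alg_def Let_def inj_on_def inv_into_f_f[OF h])
  ultimately show ?thesis
    using reduced_alg_hom[OF _ _ T.algebra_axioms algebra_axioms \<open>reduced A\<close>] by blast
qed

subsection \<open>Quotients\<close>

lemma (in ideal) coset_eq_iff:
  assumes "x \<in> carrier R" "y \<in> carrier R"
  shows "I +> x = I +> y \<longleftrightarrow> x \<ominus> y \<in> I"
  using assms quotient_eq_iff_same_a_r_cos[OF ideal_axioms assms] by blast

lemma quot_alg_simps:
  assumes "algebra K A" "ideal I A"
  shows "carrier (quot_alg A I) = (\<lambda>x. I +>\<^bsub>A\<^esub> x) ` carrier A"
    and "\<one>\<^bsub>quot_alg A I\<^esub> = I +>\<^bsub>A\<^esub> \<one>\<^bsub>A\<^esub>" "\<zero>\<^bsub>quot_alg A I\<^esub> = I +>\<^bsub>A\<^esub> \<zero>\<^bsub>A\<^esub>"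
    and "x \<in> carrier A \<Longrightarrow> y \<in> carrier A \<Longrightarrow>
      (I +>\<^bsub>A\<^esub> x) \<otimes>\<^bsub>quot_alg A I\<^esub> (I +>\<^bsub>A\<^esub> y) = I +>\<^bsub>A\<^esub> (x \<otimes>\<^bsub>A\<^esub> y)"
    and "x \<in> carrier A \<Longrightarrow> y \<in> carrier A \<Longrightarrow>
      (I +>\<^bsub>A\<^esub> x) \<oplus>\<^bsub>quot_alg A I\<^esub> (I +>\<^bsub>A\<^esub> y) = I +>\<^bsub>A\<^esub> (x \<oplus>\<^bsub>A\<^esub> y)"
    and "c \<in> carrier K \<Longrightarrow> x \<in> carrier A \<Longrightarrow>
      c \<odot>\<^bsub>quot_alg A I\<^esub> (I +>\<^bsub>A\<^esub> x) = I +>\<^bsub>A\<^esub> (c \<odot>\<^bsub>A\<^esub> x)"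
proof -
  interpret algebra K A by fact
  interpret I: ideal I A by fact
  show "carrier (quot_alg A I) = (\<lambda>x. I +>\<^bsub>A\<^esub> x) ` carrier A"
    by (auto simp: quot_alg_def FactRing_simps)
  show "\<one>\<^bsub>quot_alg A I\<^esub> = I +>\<^bsub>A\<^esub> \<one>\<^bsub>A\<^esub>" by (simp add: quot_alg_def FactRing_simps)
  show "\<zero>\<^bsub>quot_alg A I\<^esub> = I +>\<^bsub>A\<^esub> \<zero>\<^bsub>A\<^esub>"
    by (simp add: a_rcos_zero[OF assms(2)] additive_subgroup.zero_closed[OF I.is_additive_subgroup] quot_alg_def FactRing_simps)
  show "(I +>\<^bsub>A\<^esub> x) \<otimes>\<^bsub>quot_alg A I\<^esub> (I +>\<^bsub>A\<^esub> y) = I +>\<^bsub>A\<^esub> (x \<otimes>\<^bsub>A\<^esub> y)"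
    if "x \<in> carrier A" "y \<in> carrier A"
    using that by (simp add: quot_alg_def FactRing_simps I.rcoset_mult_add)
  show "(I +>\<^bsub>A\<^esub> x) \<oplus>\<^bsub>quot_alg A I\<^esub> (I +>\<^bsub>A\<^esub> y) = I +>\<^bsub>A\<^esub> (x \<oplus>\<^bsub>A\<^esub> y)"
    if "x \<in> carrier A" "y \<in> carrier A"
    using that by (simp add: quot_alg_def FactRing_simps I.a_rcos_sum)
  show "c \<odot>\<^bsub>quot_alg A I\<^esub> (I +>\<^bsub>A\<^esub> x) = I +>\<^bsub>A\<^esub> (c \<odot>\<^bsub>A\<^esub> x)"
    if "c \<in> carrier K" "x \<in> carrier A"
    using quot_alg_smult_coset[OF assms that] .
qed

lemma quot_alg_algebra:
  assumes "algebra K A" "ideal I A"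
  shows "algebra K (quot_alg A I)"
proof -
  interpret algebra K A by fact
  note s = quot_alg_simps[OF assms]
  have "cring (quot_alg A I)"
  proof (intro cringI abelian_groupI comm_monoidI)
    fix x assume "x \<in> carrier (quot_alg A I)"
    then obtain a where "a \<in> carrier A" "x = I +>\<^bsub>A\<^esub> a" by (auto simp: s)
    then show "\<exists>y\<in>carrier (quot_alg A I). y \<oplus>\<^bsub>quot_alg A I\<^esub> x = \<zero>\<^bsub>quot_alg A I\<^esub>"
      by (intro bexI[of _ "I +>\<^bsub>A\<^esub> (\<ominus>\<^bsub>A\<^esub> a)"]) (auto simp: s M.l_neg)
  qed (auto simp: s M.a_ac m_ac r_distr)
  then show ?thesis
    by (rule algebraI[OF R_cring]) (auto simp: s smult_l_distr smult_r_distr smult_assoc1 smult_assoc2)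
qed

lemma quot_alg_domain:
  assumes "algebra K A" "primeideal I A"
  shows "domain_algebra K (quot_alg A I)"
proof -
  interpret I: primeideal I A by fact
  interpret Q: algebra K "quot_alg A I" by (rule quot_alg_algebra[OF assms(1) I.is_ideal])
  interpret D: domain "A Quot I" by (rule I.quotient_is_domain)
  have "domain (quot_alg A I)"
    using D.one_not_zero D.integral
    by (intro domain.intro Q.cring_axioms domain_axioms.intro) (auto simp: quot_alg_def)
  then show ?thesis by (intro domain_algebra.intro Q.algebra_axioms)
qed

text \<open>The homomorphism theorem for Poisson algebras. The two directions of \<open>ker\<close>
  give well-definedness and injectivity of the map read off from a chosen representative.\<close>

lemma quot_alg_embed:
  assumes A: "poisson_algebra K A br" and I: "poisson_ideal I A br" and B: "algebra K B"
    and h: "h \<in> poisson_hom K A br B br'"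
    and ker: "\<And>x. x \<in> carrier A \<Longrightarrow> h x = \<zero>\<^bsub>B\<^esub> \<longleftrightarrow> x \<in> I"
  obtains g where "g \<in> poisson_hom K (quot_alg A I) (quot_bracket A br I) B br'"
    "inj_on g (carrier (quot_alg A I))"
proof -
  interpret poisson_algebra K A br by fact
  interpret I: ideal I A using I by (simp add: poisson_ideal_def)
  interpret B: algebra K B by fact
  note hom = poisson_homD[OF h] and alg = alg_homD[OF poisson_homD(1)[OF h]]
  note s = quot_alg_simps[OF algebra_axioms I.is_ideal]
  have minus: "h (\<ominus>\<^bsub>A\<^esub> x) = \<ominus>\<^bsub>B\<^esub> h x" if "x \<in> carrier A" for x
  proof -
    have "h (\<ominus>\<^bsub>A\<^esub> x) \<oplus>\<^bsub>B\<^esub> h x = h (\<ominus>\<^bsub>A\<^esub> x \<oplus>\<^bsub>A\<^esub> x)" using that by (simp only: alg M.a_inv_closed)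
    also have "\<dots> = \<zero>\<^bsub>B\<^esub>" using that alg_hom_zero[OF hom(1) algebra_axioms B] by (simp add: M.l_neg)
    finally show ?thesis using that alg(1) by (simp add: B.M.minus_equality)
  qed
  have eq: "h x = h y \<longleftrightarrow> I +>\<^bsub>A\<^esub> x = I +>\<^bsub>A\<^esub> y" if "x \<in> carrier A" "y \<in> carrier A" for x y
  proof -
    have "h x = h y \<longleftrightarrow> h x \<ominus>\<^bsub>B\<^esub> h y = \<zero>\<^bsub>B\<^esub>"
      using that alg(1) by simp
    also have "\<dots> \<longleftrightarrow> h (x \<ominus>\<^bsub>A\<^esub> y) = \<zero>\<^bsub>B\<^esub>"
      using that by (simp add: a_minus_def alg minus)
    finally show ?thesis using that by (simp add: ker I.coset_eq_iff)
  qed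
  define g where "g U = h (SOME x. x \<in> U)" for U
  have g: "g (I +>\<^bsub>A\<^esub> x) = h x" if x: "x \<in> carrier A" for x
  proof -
    have "(SOME y. y \<in> I +>\<^bsub>A\<^esub> x) \<in> I +>\<^bsub>A\<^esub> x"
      using I.a_rcos_self[OF x] by (rule someI)
    then show ?thesis
      unfolding g_def using x eq I.a_repr_independence' I.a_elemrcos_carrier by metis
  qed
  have "g \<in> poisson_hom K (quot_alg A I) (quot_bracket A br I) B br'"
    by (intro poisson_homI)
      (auto simp: alg_hom_def ring_hom_def s g alg quot_bracket_coset[OF A I] br_closed hom(2))
  moreover have "inj_on g (carrier (quot_alg A I))"
    by (auto simp: inj_on_def s g eq)
  ultimately show ?thesis by (rule that)
qed


section \<open>The field of fractions modulo a Poisson prime\<close>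

text \<open>Fractions of cosets are written with polynomial representatives, so that computations
  take place in the polynomial ring and \<open>b \<notin> P\<close> replaces nonvanishing of the
  denominator.\<close>

definition qfrac :: "'k::field_char_0 spoly set \<Rightarrow> 'k spoly \<Rightarrow> 'k spoly \<Rightarrow>
    ('k spoly set \<times> 'k spoly set) set" where
  "qfrac P a b = fraction (quot_alg witt_sym P) (P +>\<^bsub>witt_sym\<^esub> a) (P +>\<^bsub>witt_sym\<^esub> b)"

text \<open>The numerator in the quotient rule \<open>{a/b, c/d} = bracket_num a b c d / (b\<^sup>2 d\<^sup>2)\<close>.\<close>

definition bracket_num :: "'k::comm_ring_1 spoly \<Rightarrow> 'k spoly \<Rightarrow> 'k spoly \<Rightarrow> 'k spoly \<Rightarrow> 'k spoly" where
  "bracket_num a b c d = b * d * witt_bracket a c - b * c * witt_bracket a d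
     - a * d * witt_bracket b c + a * c * witt_bracket b d"

text \<open>The description ranges over all representations at once; that they give one value is the
  content of \<open>br_q\<close>.\<close>

definition frac_bracket :: "'k::field_char_0 spoly set \<Rightarrow> ('k spoly set \<times> 'k spoly set) set \<Rightarrow>
    ('k spoly set \<times> 'k spoly set) set \<Rightarrow> ('k spoly set \<times> 'k spoly set) set" where
  "frac_bracket P u v = (THE w. \<exists>a b c d. b \<notin> P \<and> d \<notin> P \<and> u = qfrac P a b \<and> v = qfrac P c d \<and>
     w = qfrac P (bracket_num a b c d) (b * b * (d * d)))"

lemma witt_bracket_minus:
  "witt_bracket (- f) g = - witt_bracket f g" "witt_bracket f (- g) = - witt_bracket f g"
proof -
  have z: "witt_bracket f 0 = 0" for f :: "'a spoly" using witt_bracket_const(2)[of f 0] by simp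
  show 2: "witt_bracket f (- g) = - witt_bracket f g" for f g :: "'a spoly"
    using witt_bracket_add_right[of f g "- g"] by (simp add: z eq_neg_iff_add_eq_0 add.commute)
  show "witt_bracket (- f) g = - witt_bracket f g"
    by (simp add: witt_bracket_anti[of _ g] 2)
qed

lemma witt_bracket_diff_left: "witt_bracket (f - f') g = witt_bracket f g - witt_bracket f' g"
  using witt_bracket_add_left[of f "- f'" g] by (simp add: witt_bracket_minus)

lemma bracket_num_anti: "bracket_num c d a b = - bracket_num a b c d"
  by (simp add: bracket_num_def witt_bracket_anti[of a] witt_bracket_anti[of b] algebra_simps)

lemma bracket_num_self: "bracket_num a b a (b :: 'k::comm_ring_1 spoly) = 0"
  by (simp add: bracket_num_def witt_bracket_alternating witt_bracket_anti[of b a] algebra_simps)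

lemma witt_bracket_one [simp]: "witt_bracket 1 f = 0" "witt_bracket f 1 = 0"
  using witt_bracket_const(1)[of 1 f] witt_bracket_const(2)[of f 1] by simp_all

lemma bracket_num_one: "bracket_num a 1 c 1 = witt_bracket a c"
  by (simp add: bracket_num_def)

lemma bracket_num_add:
  "bracket_num a b (c * f + e * d) (d * f) = bracket_num a b c d * (f * f) + bracket_num a b e f * (d * d)"
  by (simp add: bracket_num_def witt_bracket_add_right witt_bracket_leibniz algebra_simps)

lemma bracket_num_mult:
  "bracket_num a b (c * e) (d * f) = bracket_num a b c d * (e * f) + bracket_num a b e f * (c * d)"
  by (simp add: bracket_num_def witt_bracket_leibniz algebra_simps)

lemma bracket_num_const: "bracket_num a b (const k * c) d = const k * bracket_num a b c d"
  by (simp add: bracket_num_def witt_bracket_leibniz algebra_simps)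

text \<open>The left-hand side measures how far the quotient rule depends on the representative
  \<open>c/d = c'/d'\<close>; on the right, \<open>i = c d' - c' d\<close> lies in the ideal.\<close>

lemma bracket_num_change:
  assumes i: "i = c * d' - c' * d"
  shows "bracket_num c d a b * (d' * d') - bracket_num c' d' a b * (d * d) =
    b * (d * d' * witt_bracket i a - i * (d * witt_bracket d' a + d' * witt_bracket d a))
    - a * (d * d' * witt_bracket i b - i * (d * witt_bracket d' b + d' * witt_bracket d b))"
  by (simp add: bracket_num_def i witt_bracket_diff_left witt_bracket_leibniz_left algebra_simps)

section \<open>Poisson structure on the field of fractions modulo a Poisson prime\<close>

locale poisson_prime =
  fixes P :: "'k::field_char_0 spoly set"
  assumes prime: "primeideal P witt_sym" and poisson: "poisson_ideal P witt_sym witt_bracket"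
begin

abbreviation "R \<equiv> quot_alg witt_sym P"
abbreviation "F \<equiv> frac_alg R"
abbreviation "coset a \<equiv> P +>\<^bsub>witt_sym\<^esub> a"
abbreviation "q \<equiv> qfrac P"
abbreviation "br \<equiv> frac_bracket P"

lemma P_ideal: "ideal P witt_sym"
  using poisson by (simp add: poisson_ideal_def)

lemma P_zero: "0 \<in> P"
  and P_add: "x \<in> P \<Longrightarrow> y \<in> P \<Longrightarrow> x + y \<in> P"
  and P_mult: "x \<in> P \<Longrightarrow> y * x \<in> P"
  and P_bracket: "x \<in> P \<Longrightarrow> witt_bracket x y \<in> P"
  using P_ideal poisson by (auto simp: ideal_witt_sym_iff poisson_ideal_def)

lemma P_mult': "x \<in> P \<Longrightarrow> x * y \<in> P"
  using P_mult[of x y] by (simp add: mult.commute)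

lemma P_minus: "x \<in> P \<Longrightarrow> - x \<in> P"
  using P_mult[of x "-1"] by simp

lemma P_diff: "x \<in> P \<Longrightarrow> y \<in> P \<Longrightarrow> x - y \<in> P"
  using P_add[OF _ P_minus, of x y] by simp

lemma P_bracket': "x \<in> P \<Longrightarrow> witt_bracket y x \<in> P"
  using P_minus[OF P_bracket, of x y] by (simp add: witt_bracket_anti[of y])

lemma P_prime: "a * b \<notin> P" if "a \<notin> P" "b \<notin> P"
  using prime that unfolding primeideal_witt_sym_iff by blast

lemma one_notin: "1 \<notin> P"
proof
  assume "1 \<in> P"
  then have "P = UNIV" using P_mult[of 1] by auto
  then show False using prime unfolding primeideal_witt_sym_iff by blast
qed

lemma const_notin: "c \<noteq> 0 \<Longrightarrow> const c \<notin> P"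
  using one_notin P_mult[of "const c" "const (inverse c)"] by (auto simp flip: const_mult)

sublocale D: domain_algebra ring_of_type_algebra R
  by (rule quot_alg_domain[OF witt_algebra prime])

sublocale F: field F
  by (rule D.frac_alg_field)

sublocale FA: algebra ring_of_type_algebra F
  by (rule D.frac_alg_algebra)

lemmas R_simps = quot_alg_simps[OF witt_algebra P_ideal, unfolded witt_sym_simps]

lemma coset_eq_iff: "coset a = coset b \<longleftrightarrow> a - b \<in> P"
proof -
  interpret S: cring "witt_sym :: ('k, 'k spoly) module" by (rule witt_cring)
  have "a \<ominus>\<^bsub>witt_sym\<^esub> b = a - b"
    using S.minus_equality[of "- b" b] by (simp add: S.minus_eq)
  then show ?thesis using ideal.coset_eq_iff[OF P_ideal, of a b] by simp
qed

lemma coset_closed: "coset a \<in> carrier R" by (simp add: R_simps)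

lemma coset_nz: "b \<notin> P \<Longrightarrow> coset b \<in> D.nz"
  using coset_closed[of b] by (simp add: R_simps(3) coset_eq_iff)

lemma q_closed: "b \<notin> P \<Longrightarrow> q a b \<in> carrier F"
  unfolding qfrac_def by (intro D.frac_closed coset_closed coset_nz)

lemma q_cases:
  assumes "x \<in> carrier F"
  obtains a b where "b \<notin> P" "x = q a b"
proof -
  obtain u v where "u \<in> carrier R" "v \<in> D.nz" "x = fraction R u v"
    using D.frac_cases[OF assms] .
  moreover from this obtain a b where "u = coset a" "v = coset b" by (auto simp: R_simps(1))
  ultimately show ?thesis
    using that[of b a] by (auto simp: qfrac_def R_simps(3) coset_eq_iff)
qed

lemma q_eq_iff: "b \<notin> P \<Longrightarrow> d \<notin> P \<Longrightarrow> q a b = q c d \<longleftrightarrow> a * d - c * b \<in> P"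
  unfolding qfrac_def
  by (subst D.fraction_eq_iff[OF coset_closed coset_nz coset_closed coset_nz])
    (auto simp: R_simps coset_eq_iff)

lemma q_eqI: "b \<notin> P \<Longrightarrow> d \<notin> P \<Longrightarrow> a * d = c * b \<Longrightarrow> q a b = q c d"
  by (simp add: q_eq_iff P_zero)

lemma q_mult: "b \<notin> P \<Longrightarrow> d \<notin> P \<Longrightarrow> q a b \<otimes>\<^bsub>F\<^esub> q c d = q (a * c) (b * d)"
  unfolding qfrac_def
  by (subst D.frac_mult[OF coset_closed coset_nz coset_closed coset_nz]) (auto simp: R_simps)

lemma q_add: "b \<notin> P \<Longrightarrow> d \<notin> P \<Longrightarrow> q a b \<oplus>\<^bsub>F\<^esub> q c d = q (a * d + c * b) (b * d)"
  unfolding qfrac_def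
  by (subst D.frac_add[OF coset_closed coset_nz coset_closed coset_nz]) (auto simp: R_simps)

lemma q_smult: "b \<notin> P \<Longrightarrow> k \<odot>\<^bsub>F\<^esub> q a b = q (const k * a) b"
  unfolding qfrac_def
  by (subst D.frac_smult[OF _ coset_closed coset_nz]) (auto simp: R_simps)

lemma q_zero: "\<zero>\<^bsub>F\<^esub> = q 0 1" and q_one: "\<one>\<^bsub>F\<^esub> = q 1 1"
  by (simp_all add: qfrac_def D.frac_zero D.frac_one R_simps)

lemma q_eq_zero_iff: "b \<notin> P \<Longrightarrow> q a b = \<zero>\<^bsub>F\<^esub> \<longleftrightarrow> a \<in> P"
  by (simp add: q_zero q_eq_iff one_notin)

lemma q_minus:
  assumes "b \<notin> P"
  shows "\<ominus>\<^bsub>F\<^esub> q a b = q (- a) b"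
  using assms by (intro F.minus_equality) (simp_all add: q_closed q_add q_eq_zero_iff P_prime P_zero)

lemma frac_emb_coset: "frac_emb R (coset a) = q a 1"
  by (simp add: qfrac_def frac_emb_def R_simps)

lemma q_inv:
  assumes "g \<notin> P"
  shows "inv\<^bsub>F\<^esub> (q g 1) = q 1 g"
proof -
  have "q g 1 \<otimes>\<^bsub>F\<^esub> q 1 g = \<one>\<^bsub>F\<^esub>"
    unfolding q_one using assms by (simp add: q_mult one_notin q_eq_iff P_zero)
  then show ?thesis
    using assms F.comm_inv_char[of "q g 1" "q 1 g"] by (simp add: q_closed one_notin)
qed

text \<open>The cross difference \<open>i\<close> lies in \<open>P\<close>, and so do its brackets
  because \<open>P\<close> is Poisson; every term of \<open>bracket_num_change\<close> contains one
  of these.\<close>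

lemma bracket_num_cong:
  assumes "d \<notin> P" "d' \<notin> P" "b \<notin> P" "q c d = q c' d'"
  shows "q (bracket_num c d a b) (d * d * (b * b)) = q (bracket_num c' d' a b) (d' * d' * (b * b))"
proof -
  let ?i = "c * d' - c' * d"
  have i: "?i \<in> P" using assms by (simp add: q_eq_iff)
  have "bracket_num c d a b * (d' * d') - bracket_num c' d' a b * (d * d) \<in> P"
    unfolding bracket_num_change[OF refl] by (intro P_diff P_mult P_bracket P_mult' i)
  from P_mult[OF this, of "b * b"] show ?thesis
    using assms by (subst q_eq_iff) (auto simp: P_prime algebra_simps)
qed

text \<open>One argument is changed at a time. The second is brought to the first place by
  antisymmetry, where \<open>bracket_num_cong\<close> applies.\<close>

lemma br_q:
  assumes "b \<notin> P" "d \<notin> P"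
  shows "br (q a b) (q c d) = q (bracket_num a b c d) (b * b * (d * d))"
  unfolding frac_bracket_def
proof (rule the_equality)
  show "\<exists>a' b' c' d'. b' \<notin> P \<and> d' \<notin> P \<and> q a b = q a' b' \<and> q c d = q c' d' \<and>
     q (bracket_num a b c d) (b * b * (d * d)) = q (bracket_num a' b' c' d') (b' * b' * (d' * d'))"
    using assms by blast
  fix w assume "\<exists>a' b' c' d'. b' \<notin> P \<and> d' \<notin> P \<and> q a b = q a' b' \<and> q c d = q c' d' \<and>
     w = q (bracket_num a' b' c' d') (b' * b' * (d' * d'))"
  then obtain a' b' c' d' where r: "b' \<notin> P" "d' \<notin> P" "q a b = q a' b'" "q c d = q c' d'"
    "w = q (bracket_num a' b' c' d') (b' * b' * (d' * d'))" by blast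
  have "q (bracket_num c d a' b') (d * d * (b' * b')) = q (bracket_num c' d' a' b') (d' * d' * (b' * b'))"
    using r assms by (intro bracket_num_cong)
  from arg_cong[OF this, of "\<lambda>x. \<ominus>\<^bsub>F\<^esub> x"]
  have "q (bracket_num a' b' c d) (b' * b' * (d * d)) = w"
    using r assms by (simp add: q_minus P_prime bracket_num_anti[of _ _ a'] mult.commute[of "b' * b'"])
  moreover have "q (bracket_num a b c d) (b * b * (d * d)) = q (bracket_num a' b' c d) (b' * b' * (d * d))"
    using r assms by (intro bracket_num_cong)
  ultimately show "w = q (bracket_num a b c d) (b * b * (d * d))" by simp
qed

lemma br_q_one: "br (q a 1) (q c 1) = q (witt_bracket a c) 1"
  by (simp add: br_q one_notin bracket_num_one)

text \<open>Brackets with inverses need no new denominators: they are polynomials in the inverses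
  with polynomial coefficients. This makes the localised algebras closed under the bracket.\<close>

lemma br_q_inverse:
  assumes "g \<notin> P"
  shows "br (q a 1) (q 1 g) = q (witt_bracket g a) 1 \<otimes>\<^bsub>F\<^esub> (q 1 g \<otimes>\<^bsub>F\<^esub> q 1 g)"
    and "h \<notin> P \<Longrightarrow> br (q 1 g) (q 1 h) =
      q (witt_bracket g h) 1 \<otimes>\<^bsub>F\<^esub> (q 1 g \<otimes>\<^bsub>F\<^esub> q 1 g) \<otimes>\<^bsub>F\<^esub> (q 1 h \<otimes>\<^bsub>F\<^esub> q 1 h)"
  using assms
  by (simp_all add: br_q one_notin q_mult P_prime bracket_num_def witt_bracket_anti[of a g])

lemma br_closed: "x \<in> carrier F \<Longrightarrow> y \<in> carrier F \<Longrightarrow> br x y \<in> carrier F"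
  by (elim q_cases) (simp add: br_q q_closed P_prime)

lemma br_anti:
  assumes "x \<in> carrier F" "y \<in> carrier F"
  shows "br x y = \<ominus>\<^bsub>F\<^esub> br y x"
proof -
  obtain a b c d where r: "b \<notin> P" "x = q a b" "d \<notin> P" "y = q c d"
    using assms by (metis q_cases)
  then show ?thesis
    by (simp add: br_q q_minus P_prime bracket_num_anti[of c d] mult.commute[of "d * d"])
qed

lemma br_alternating: "x \<in> carrier F \<Longrightarrow> br x x = \<zero>\<^bsub>F\<^esub>"
  by (elim q_cases) (simp add: br_q bracket_num_self q_eq_zero_iff P_prime P_zero)

lemma br_add_right:
  assumes "x \<in> carrier F" "y \<in> carrier F" "z \<in> carrier F"
  shows "br x (y \<oplus>\<^bsub>F\<^esub> z) = br x y \<oplus>\<^bsub>F\<^esub> br x z"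
proof -
  obtain a b c d e f where r: "b \<notin> P" "x = q a b" "d \<notin> P" "y = q c d" "f \<notin> P" "z = q e f"
    using assms by (metis q_cases)
  then show ?thesis
    by (simp add: br_q q_add P_prime bracket_num_add, intro q_eqI) (simp_all add: P_prime algebra_simps)
qed

lemma br_leibniz:
  assumes "x \<in> carrier F" "y \<in> carrier F" "z \<in> carrier F"
  shows "br x (y \<otimes>\<^bsub>F\<^esub> z) = (br x y \<otimes>\<^bsub>F\<^esub> z) \<oplus>\<^bsub>F\<^esub> (y \<otimes>\<^bsub>F\<^esub> br x z)"
proof -
  obtain a b c d e f where r: "b \<notin> P" "x = q a b" "d \<notin> P" "y = q c d" "f \<notin> P" "z = q e f"
    using assms by (metis q_cases)
  then show ?thesis
    by (simp add: br_q q_add q_mult P_prime bracket_num_mult, intro q_eqI)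
      (simp_all add: P_prime algebra_simps)
qed

lemma br_smult_right:
  assumes "x \<in> carrier F" "y \<in> carrier F"
  shows "br x (k \<odot>\<^bsub>F\<^esub> y) = k \<odot>\<^bsub>F\<^esub> br x y"
proof -
  obtain a b c d where r: "b \<notin> P" "x = q a b" "d \<notin> P" "y = q c d"
    using assms by (metis q_cases)
  then show ?thesis by (simp add: br_q q_smult P_prime bracket_num_const)
qed

lemma br_add_left:
  assumes "x \<in> carrier F" "y \<in> carrier F" "z \<in> carrier F"
  shows "br (x \<oplus>\<^bsub>F\<^esub> y) z = br x z \<oplus>\<^bsub>F\<^esub> br y z"
  using assms by (simp add: br_anti[of _ z] br_add_right br_closed F.minus_add)

lemma br_smult_left:
  assumes "x \<in> carrier F" "y \<in> carrier F"
  shows "br (k \<odot>\<^bsub>F\<^esub> x) y = k \<odot>\<^bsub>F\<^esub> br x y"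
  using assms by (simp add: br_anti[of _ y] br_smult_right br_closed FA.smult_r_minus)

lemma br_leibniz_left:
  assumes "x \<in> carrier F" "y \<in> carrier F" "z \<in> carrier F"
  shows "br (x \<otimes>\<^bsub>F\<^esub> y) z = (br x z \<otimes>\<^bsub>F\<^esub> y) \<oplus>\<^bsub>F\<^esub> (x \<otimes>\<^bsub>F\<^esub> br y z)"
  using assms by (simp add: br_anti[of _ z] br_leibniz br_closed F.minus_add F.l_minus F.r_minus)

text \<open>The Jacobiator is a derivation in each argument and vanishes on polynomials, hence
  also on their quotients.\<close>

lemma br_jacobi:
  assumes "x \<in> carrier F" "y \<in> carrier F" "z \<in> carrier F"
  shows "br x (br y z) \<oplus>\<^bsub>F\<^esub> br y (br z x) \<oplus>\<^bsub>F\<^esub> br z (br x y) = \<zero>\<^bsub>F\<^esub>"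
proof -
  define J where "J x y z = br x (br y z) \<oplus>\<^bsub>F\<^esub> br y (br z x) \<oplus>\<^bsub>F\<^esub> br z (br x y)" for x y z
  have cl: "J x y z \<in> carrier F" if "x \<in> carrier F" "y \<in> carrier F" "z \<in> carrier F" for x y z
    using that by (simp add: J_def br_closed)
  have rot: "J x y z = J y z x" if "x \<in> carrier F" "y \<in> carrier F" "z \<in> carrier F" for x y z
    using that by (simp add: J_def br_closed F.a_ac)
  have mult: "J (x \<otimes>\<^bsub>F\<^esub> x') y z = (J x y z \<otimes>\<^bsub>F\<^esub> x') \<oplus>\<^bsub>F\<^esub> (x \<otimes>\<^bsub>F\<^esub> J x' y z)"
    if c: "x \<in> carrier F" "x' \<in> carrier F" "y \<in> carrier F" "z \<in> carrier F" for x x' y z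
  proof -
    note s = br_leibniz br_leibniz_left br_add_left br_add_right br_closed c F.m_closed
    have 1: "br (x \<otimes>\<^bsub>F\<^esub> x') (br y z) = br x (br y z) \<otimes>\<^bsub>F\<^esub> x' \<oplus>\<^bsub>F\<^esub> x \<otimes>\<^bsub>F\<^esub> br x' (br y z)"
      by (simp add: s)
    have 2: "br y (br z (x \<otimes>\<^bsub>F\<^esub> x')) = (br y (br z x) \<otimes>\<^bsub>F\<^esub> x' \<oplus>\<^bsub>F\<^esub> br z x \<otimes>\<^bsub>F\<^esub> br y x') \<oplus>\<^bsub>F\<^esub>
       (br y x \<otimes>\<^bsub>F\<^esub> br z x' \<oplus>\<^bsub>F\<^esub> x \<otimes>\<^bsub>F\<^esub> br y (br z x'))"
      by (simp add: s)
    have 3: "br z (br (x \<otimes>\<^bsub>F\<^esub> x') y) = (br z (br x y) \<otimes>\<^bsub>F\<^esub> x' \<oplus>\<^bsub>F\<^esub> \<ominus>\<^bsub>F\<^esub> br y x \<otimes>\<^bsub>F\<^esub> br z x') \<oplus>\<^bsub>F\<^esub>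
       (br z x \<otimes>\<^bsub>F\<^esub> \<ominus>\<^bsub>F\<^esub> br y x' \<oplus>\<^bsub>F\<^esub> x \<otimes>\<^bsub>F\<^esub> br z (br x' y))"
      by (simp add: s flip: br_anti[of x y] br_anti[of x' y])
    \<comment> \<open>The mixed terms \<open>{y, x} {z, x'}\<close> and
      \<open>{z, x} {y, x'}\<close> occur once with each sign.\<close>
    have cancel: "A \<oplus>\<^bsub>F\<^esub> A' \<oplus>\<^bsub>F\<^esub> (B \<oplus>\<^bsub>F\<^esub> v \<oplus>\<^bsub>F\<^esub> (u \<oplus>\<^bsub>F\<^esub> B')) \<oplus>\<^bsub>F\<^esub> (C \<oplus>\<^bsub>F\<^esub> u' \<oplus>\<^bsub>F\<^esub> (v' \<oplus>\<^bsub>F\<^esub> C'))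
      = A \<oplus>\<^bsub>F\<^esub> B \<oplus>\<^bsub>F\<^esub> C \<oplus>\<^bsub>F\<^esub> (A' \<oplus>\<^bsub>F\<^esub> B' \<oplus>\<^bsub>F\<^esub> C')"
      if "u \<oplus>\<^bsub>F\<^esub> u' = \<zero>\<^bsub>F\<^esub>" "v \<oplus>\<^bsub>F\<^esub> v' = \<zero>\<^bsub>F\<^esub>"
        "A \<in> carrier F" "A' \<in> carrier F" "B \<in> carrier F" "B' \<in> carrier F" "C \<in> carrier F" "C' \<in> carrier F"
        "u \<in> carrier F" "u' \<in> carrier F" "v \<in> carrier F" "v' \<in> carrier F" for A A' B B' C C' u u' v v'
    proof -
      have "A \<oplus>\<^bsub>F\<^esub> A' \<oplus>\<^bsub>F\<^esub> (B \<oplus>\<^bsub>F\<^esub> v \<oplus>\<^bsub>F\<^esub> (u \<oplus>\<^bsub>F\<^esub> B')) \<oplus>\<^bsub>F\<^esub> (C \<oplus>\<^bsub>F\<^esub> u' \<oplus>\<^bsub>F\<^esub> (v' \<oplus>\<^bsub>F\<^esub> C'))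
        = A \<oplus>\<^bsub>F\<^esub> B \<oplus>\<^bsub>F\<^esub> C \<oplus>\<^bsub>F\<^esub> (A' \<oplus>\<^bsub>F\<^esub> B' \<oplus>\<^bsub>F\<^esub> C') \<oplus>\<^bsub>F\<^esub> ((u \<oplus>\<^bsub>F\<^esub> u') \<oplus>\<^bsub>F\<^esub> (v \<oplus>\<^bsub>F\<^esub> v'))"
        using that(3-) by (simp add: F.a_ac)
      then show ?thesis using that by simp
    qed
    show ?thesis
      unfolding J_def 1 2 3 using br_closed c
      by (subst cancel) (simp_all add: F.l_distr F.r_distr F.l_minus F.r_minus F.r_neg)
  qed
  \<comment> \<open>For \<open>x = a / b\<close> the derivation rule applied to
    \<open>b x = a\<close> leaves \<open>b J x y z = 0\<close>.\<close>
  have ext: "J x y z = \<zero>\<^bsub>F\<^esub>" if p: "\<And>s. J (q s 1) y z = \<zero>\<^bsub>F\<^esub>"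
    and c: "x \<in> carrier F" "y \<in> carrier F" "z \<in> carrier F" for x y z
  proof -
    obtain a b where r: "b \<notin> P" "x = q a b" using c(1) by (rule q_cases)
    have "q b 1 \<otimes>\<^bsub>F\<^esub> x = q a 1" using r by (simp add: q_mult one_notin q_eq_iff P_zero)
    then have "q b 1 \<otimes>\<^bsub>F\<^esub> J x y z = \<zero>\<^bsub>F\<^esub>"
      using mult[of "q b 1" x y z] p[of a] p[of b] c by (simp add: q_closed one_notin cl)
    then show ?thesis
      using r c cl F.integral_iff[of "q b 1" "J x y z"] by (simp add: q_closed one_notin q_eq_zero_iff)
  qed
  note qc = q_closed[OF one_notin]
  have pol: "J (q r 1) (q s 1) (q t 1) = \<zero>\<^bsub>F\<^esub>" for r s t
    by (simp add: J_def br_q_one q_add one_notin witt_bracket_jacobi flip: q_zero)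
  \<comment> \<open>The arguments are freed from being polynomials one after the other; cyclic
    symmetry brings the next one to the front.\<close>
  have 1: "J x (q s 1) (q t 1) = \<zero>\<^bsub>F\<^esub>" if "x \<in> carrier F" for x s t
    using ext pol that qc by blast
  have 2: "J x y (q t 1) = \<zero>\<^bsub>F\<^esub>" if c: "x \<in> carrier F" "y \<in> carrier F" for x y t
  proof -
    have "J y (q t 1) x = \<zero>\<^bsub>F\<^esub>"
    proof (rule ext)
      fix s
      show "J (q s 1) (q t 1) x = \<zero>\<^bsub>F\<^esub>"
        using 1[OF c(1), of s t] rot[OF c(1) qc qc, of s t] by simp
    qed (use c qc in auto)
    then show ?thesis using rot[OF c qc] by simp
  qed
  have "J z x y = \<zero>\<^bsub>F\<^esub>"
  proof (rule ext)
    fix s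
    show "J (q s 1) x y = \<zero>\<^bsub>F\<^esub>"
      using 2[OF assms(1,2), of s] rot[OF qc assms(1,2), of s] rot[OF assms(1,2) qc, of s] by simp
  qed (use assms in auto)
  then show ?thesis using rot[OF assms(3,1,2)] by (simp add: J_def)
qed

theorem frac_poisson: "poisson_algebra ring_of_type_algebra F br"
  by (rule poisson_algebra.intro[OF FA.algebra_axioms])
    (unfold_locales; simp add: br_closed br_add_left br_add_right br_smult_left br_smult_right
      br_alternating br_jacobi br_leibniz)

lemma frac_reduced: "reduced F"
proof -
  have "x = \<zero>\<^bsub>F\<^esub>" if "x \<in> carrier F" "x [^]\<^bsub>F\<^esub> n = \<zero>\<^bsub>F\<^esub>" for x and n :: nat
    using that by (induction n) (auto dest: F.integral)
  then show ?thesis by (simp add: reduced_def)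
qed

end


section \<open>Recovering the generators\<close>

text \<open>The last nonzero iterate has vanishing top derivative, hence is constant. An earlier
  constant iterate would make the chain vanish too soon.\<close>

lemma top_pd_chain:
  fixes f :: "'k::field_char_0 spoly"
  assumes "f \<noteq> 0"
  obtains m c where "c \<noteq> 0" "(top_pd ^^ m) f = const c" "\<And>k. k < m \<Longrightarrow> vars ((top_pd ^^ k) f) \<noteq> {}"
proof -
  define n where "n = (LEAST n. (top_pd ^^ n) f = 0)"
  have n: "(top_pd ^^ n) f = 0" and min: "\<And>k. k < n \<Longrightarrow> (top_pd ^^ k) f \<noteq> 0"
    using LeastI_ex[OF top_pd_nilpotent[of f]] not_less_Least[of _ "\<lambda>n. (top_pd ^^ n) f = 0"]
    by (auto simp: n_def)
  obtain m where m: "n = Suc m" using n assms by (cases n) auto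
  have "vars ((top_pd ^^ m) f) = {}" using n by (intro top_pd_eq_0D) (simp add: m)
  note c = vars_empty_const[OF this]
  show ?thesis
  proof (rule that[OF _ c])
    show "Poly_Mapping.lookup ((top_pd ^^ m) f) 0 \<noteq> 0" using c min[of m] by (auto simp: m)
    fix k assume "k < m"
    show "vars ((top_pd ^^ k) f) \<noteq> {}"
    proof
      assume "vars ((top_pd ^^ k) f) = {}"
      from vars_empty_const[OF this] have "top_pd ((top_pd ^^ k) f) = 0"
        by (metis pd_const top_pd_def)
      then show False using min[of "Suc k"] \<open>k < m\<close> by (simp add: m)
    qed
  qed
qed

text \<open>For \<open>N\<close> the index of the top variable of \<open>f\<close>, the bracket of \<open>x\<^bsub>i+1\<^esub>\<close> and \<open>f\<close> is
  \<open>(N - i) x\<^bsub>i+N+2\<^esub> \<partial>f/\<partial>x\<^bsub>N+1\<^esub>\<close> plus terms in lower variables.\<close>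

lemma xgen_mult_top_pd:
  fixes f :: "'k::field_char_0 spoly"
  assumes c: "\<And>c. const c \<in> T" and a: "\<And>f g. f \<in> T \<Longrightarrow> g \<in> T \<Longrightarrow> f + g \<in> T"
    and m: "\<And>f g. f \<in> T \<Longrightarrow> g \<in> T \<Longrightarrow> f * g \<in> T"
    and TM: "T \<subseteq> M" and Ma: "\<And>f g. f \<in> M \<Longrightarrow> g \<in> M \<Longrightarrow> f + g \<in> M"
    and Mm: "\<And>f g. f \<in> T \<Longrightarrow> g \<in> M \<Longrightarrow> f * g \<in> M"
    and f: "vars f \<noteq> {}" and i: "i > Max (vars f)"
    and x: "\<And>k. 1 \<le> k \<Longrightarrow> k < i + Max (vars f) + 2 \<Longrightarrow> xgen k \<in> T"
    and br: "witt_bracket (xgen (Suc i)) f \<in> M"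
  shows "xgen (i + Max (vars f) + 2) * top_pd f \<in> M"
proof -
  \<comment> \<open>In the uses, \<open>T\<close> holds the polynomials whose image is already known
    to lie in the algebra being built, and \<open>M\<close> those whose image lies there after
    multiplication by an inverse of the top derivative, possibly only an inverse on one
    stratum.\<close>
  let ?N = "Max (vars f)"
  let ?t = "\<lambda>j. of_int (int j - int i) * xgen (i + j + 2) * pd j f"
  have N: "?N \<in> vars f" using f by simp
  \<comment> \<open>The derivatives involve no variable beyond number \<open>?N + 1\<close>, which
    is below the one to be reached.\<close>
  have pd: "pd j f \<in> T" for j
  proof (rule subring_contains_poly[OF c a m])
    fix l assume "l \<in> vars (pd j f)"
    then have "l \<le> ?N" using vars_pd by (intro Max_ge) auto
    then show "xgen (Suc l) \<in> T" using i by (intro x) auto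
  qed auto
  have ofint: "of_int z \<in> T" for z
  proof -
    have "(of_int z :: 'k spoly) = const (of_int z)" by (simp add: const_def)
    then show ?thesis using c by simp
  qed
  have "(\<Sum>j\<in>V. ?t j) \<in> T" if "finite V" "V \<subseteq> vars f - {?N}" for V
    using that
  proof induction
    case empty
    then show ?case using c[of 0] by simp
  next
    case (insert j V)
    then have "j < ?N" by (simp add: le_neq_implies_less)
    then have "?t j \<in> T" by (intro m ofint pd x) auto
    then show ?case using insert a by auto
  qed
  then have rest: "(\<Sum>j\<in>vars f - {?N}. ?t j) \<in> T" by simp
  have "?t ?N = witt_bracket (xgen (Suc i)) f + const (-1) * (\<Sum>j\<in>vars f - {?N}. ?t j)"
    using sum.remove[OF finite_vars N, of ?t] const_add[of "-1::'k" 1]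
    by (simp add: witt_bracket_xgen_left add_eq_0_iff2)
  also have "\<dots> \<in> M" using br rest TM c m by (intro Ma) auto
  \<comment> \<open>The coefficient of the top term is nonzero because \<open>i > ?N\<close> and the
    characteristic is zero.\<close>
  finally have "const (inverse (of_int (int ?N - int i))) * ?t ?N \<in> M" by (rule Mm[OF c])
  moreover have "const (inverse (of_int (int ?N - int i))) * of_int (int ?N - int i) = (1 :: 'k spoly)"
  proof -
    have "(of_int (int ?N - int i) :: 'k) \<noteq> 0" using i by (simp only: of_int_eq_0_iff)
    moreover have "(of_int (int ?N - int i) :: 'k spoly) = const (of_int (int ?N - int i))"
      by (simp only: const_def single_of_int)
    ultimately show ?thesis by (simp only: const_mult[symmetric] left_inverse const_1 simp_thms)
  qed
  ultimately show ?thesis by (simp only: mult.assoc[symmetric] mult_1_left top_pd_def)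
qed

text \<open>For \<open>f\<close> in \<open>P\<close>, this is the order of the last derivative
  before the chain first leaves \<open>P\<close>; the derivative to be inverted has order one
  more.\<close>

definition level :: "'k::field_char_0 spoly \<Rightarrow> 'k spoly set \<Rightarrow> nat" where
  "level f P = (LEAST k. (top_pd ^^ Suc k) f \<notin> P)"

section \<open>The prime case: a single localisation\<close>

context poisson_prime
begin

text \<open>The chain ends in a nonzero constant, a unit, so it must leave the proper ideal
  \<open>P\<close>. Minimality puts the preceding derivative in \<open>P\<close>; at level zero this
  is \<open>f\<close> itself.\<close>

lemma level_props:
  assumes "f \<in> P" "c \<noteq> 0" "(top_pd ^^ m) f = const c"
  shows "level f P < m" "(top_pd ^^ level f P) f \<in> P" "(top_pd ^^ Suc (level f P)) f \<notin> P"
proof -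
  have "const c \<notin> P" using assms(2) by (rule const_notin)
  then have "m \<noteq> 0" using assms by (intro notI) simp
  then obtain m' where m: "m = Suc m'" using not0_implies_Suc by blast
  then have ex: "(top_pd ^^ Suc m') f \<notin> P" using assms(3) \<open>const c \<notin> P\<close> by simp
  then show "(top_pd ^^ Suc (level f P)) f \<notin> P" unfolding level_def by (rule LeastI)
  show "level f P < m"
    using Least_le[of "\<lambda>k. (top_pd ^^ Suc k) f \<notin> P", OF ex] by (simp only: level_def m less_Suc_eq_le)
  show "(top_pd ^^ level f P) f \<in> P"
  proof (cases "level f P")
    case (Suc k)
    then show ?thesis
      using not_less_Least[of k "\<lambda>k. (top_pd ^^ Suc k) f \<notin> P"] unfolding level_def[symmetric] by simp
  qed (use assms(1) in simp)
qed

lemma q_hom: "(\<lambda>s. q s 1) \<in> poisson_hom ring_of_type_algebra witt_sym witt_bracket F br"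
  by (intro poisson_homI)
    (auto simp: alg_hom_def ring_hom_def q_closed q_add q_mult q_smult q_one one_notin br_q_one)

lemma frac_emb_poisson:
  "frac_emb R \<in> poisson_hom ring_of_type_algebra R (quot_bracket witt_sym witt_bracket P) F br"
proof (rule poisson_homI[OF D.frac_emb_hom])
  fix x y assume "x \<in> carrier R" "y \<in> carrier R"
  then obtain a b where "x = coset a" "y = coset b" by (auto simp: R_simps(1))
  then show "frac_emb R (quot_bracket witt_sym witt_bracket P x y) = br (frac_emb R x) (frac_emb R y)"
    using quot_bracket_coset[OF witt_poisson_algebra poisson, of a b]
    by (simp add: frac_emb_coset br_q_one)
qed

theorem finite_localisation:
  assumes "f \<in> P" "f \<noteq> 0"
  obtains B p where "fg_subalgebra ring_of_type_algebra R B" "p \<in> B - {\<zero>\<^bsub>R\<^esub>}"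
    and "frac_emb R ` carrier R \<subseteq> carrier (adjoin_inverse ring_of_type_algebra R B p)"
    and "poisson_algebra ring_of_type_algebra (adjoin_inverse ring_of_type_algebra R B p) br"
    and "frac_emb R \<in> poisson_hom ring_of_type_algebra R (quot_bracket witt_sym witt_bracket P)
      (adjoin_inverse ring_of_type_algebra R B p) br"
proof -
  let ?K = "ring_of_type_algebra :: 'k ring"
  obtain m c where mc: "c \<noteq> 0" "(top_pd ^^ m) f = const c"
    "\<And>k. k < m \<Longrightarrow> vars ((top_pd ^^ k) f) \<noteq> {}"
    using top_pd_chain[OF assms(2)] by blast
  note lev = level_props[OF assms(1) mc(1,2)]
  define h where "h = (top_pd ^^ level f P) f"
  define g where "g = top_pd h"
  have hP: "h \<in> P" and gP: "g \<notin> P" and vars: "vars h \<noteq> {}"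
    using lev mc(3) by (simp_all add: h_def g_def)
  define N where "N = Max (vars h)"
  \<comment> \<open>A variable beyond this range has number \<open>i + N + 2\<close> with
    \<open>i > N\<close>, as the recursion requires.\<close>
  define G where "G = (\<lambda>n. coset (xgen n)) ` {1..2 * N + 2}"
  define B where "B = subalg_gen ?K R G"
  define C where "C = subalg_gen ?K F (frac_emb R ` B \<union> {inv\<^bsub>F\<^esub> (frac_emb R (coset g))})"
  have G: "finite G" "G \<subseteq> carrier R" by (auto simp: G_def coset_closed)
  have Bsub: "is_subalgebra ?K R B" unfolding B_def by (rule D.subalg_gen_subalgebra[OF G(2)])
  note Bs = D.is_subalgebraD[OF Bsub]
  note emb = alg_homD[OF D.frac_emb_hom]
  have q1: "frac_emb R (coset s) = q s 1" for s by (rule frac_emb_coset)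
  have inv: "inv\<^bsub>F\<^esub> (frac_emb R (coset g)) = q 1 g" using gP by (simp add: q1 q_inv)
  have gens: "frac_emb R ` B \<union> {inv\<^bsub>F\<^esub> (frac_emb R (coset g))} \<subseteq> carrier F"
    using Bs(1) emb(1) gP by (auto simp: inv q_closed)
  have Csub: "is_subalgebra ?K F C" unfolding C_def by (rule FA.subalg_gen_subalgebra[OF gens])
  note Cs = FA.is_subalgebraD[OF Csub]
  have genC: "frac_emb R ` B \<subseteq> C" "q 1 g \<in> C"
    using FA.subalg_gen_incl[of "frac_emb R ` B \<union> {inv\<^bsub>F\<^esub> (frac_emb R (coset g))}"]
    by (auto simp: C_def inv)
  have xB: "coset (xgen n) \<in> B" if "1 \<le> n" "n \<le> 2 * N + 2" for n
    using that D.subalg_gen_incl[of G] by (auto simp: B_def G_def)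
  define T where "T = {s. q s 1 \<in> C}"
  define M where "M = {s. q s 1 \<otimes>\<^bsub>F\<^esub> q 1 g \<in> C}"
  have q_hom': "(\<lambda>s. q s 1) \<in> alg_hom ?K witt_sym F" using q_hom by (simp add: poisson_hom_def)
  note qh = alg_homD[OF q_hom', simplified]
  have Tc: "const c \<in> T" for c
    using Cs(2,7) qh(5)[of c 1] by (simp add: T_def q_one)
  have Ta: "s + t \<in> T" and Tm: "s * t \<in> T" if "s \<in> T" "t \<in> T" for s t
    using that Cs by (auto simp: T_def qh(2,3))
  have TM: "T \<subseteq> M" using Cs genC by (auto simp: T_def M_def)
  have Ma: "s + t \<in> M" if "s \<in> M" "t \<in> M" for s t
    using that Cs gP by (auto simp: M_def qh(2) F.l_distr q_closed one_notin)
  have Mm: "s * t \<in> M" if "s \<in> T" "t \<in> M" for s t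
    using that Cs gP by (auto simp: T_def M_def qh(3) F.m_assoc q_closed one_notin)
  have xT: "xgen n \<in> T" if "n \<ge> 1" for n
    using that
  proof (induction n rule: less_induct)
    case (less n)
    show ?case
    proof (cases "n \<le> 2 * N + 2")
      case True
      then have "frac_emb R (coset (xgen n)) \<in> C" using genC(1) xB less.prems by blast
      then show ?thesis by (simp add: T_def q1)
    next
      case False
      define i where "i = n - N - 2"
      have n: "n = i + N + 2" and i: "i > N" using False by (auto simp: i_def)
      \<comment> \<open>This bracket is zero in the field of fractions, so it lies in
        \<open>M\<close>. Solving it for its top term expresses \<open>xgen n\<close> through
        smaller variables and the inverse of \<open>g\<close>.\<close>
      have "witt_bracket (xgen (Suc i)) h \<in> P" using hP by (rule P_bracket')
      then have "q (witt_bracket (xgen (Suc i)) h) 1 = \<zero>\<^bsub>F\<^esub>" by (simp add: q_eq_zero_iff one_notin)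
      then have "witt_bracket (xgen (Suc i)) h \<in> M"
        using Cs(3) gP by (simp add: M_def q_closed)
      then have "xgen (i + N + 2) * top_pd h \<in> M"
        unfolding N_def
        by (intro xgen_mult_top_pd[OF Tc Ta Tm TM Ma Mm vars])
          (use i less.IH n in \<open>auto simp: N_def\<close>)
      then have "q (xgen n * g) 1 \<otimes>\<^bsub>F\<^esub> q 1 g \<in> C" by (simp only: M_def n g_def mem_Collect_eq)
      also have "q (xgen n * g) 1 \<otimes>\<^bsub>F\<^esub> q 1 g = q (xgen n) 1"
        using gP by (simp add: q_mult one_notin q_eq_iff P_zero)
      finally show ?thesis by (simp add: T_def)
    qed
  qed
  have T_UNIV: "s \<in> T" for s
    by (induction s rule: spoly_induct) (simp_all add: Tc xT Ta Tm)
  \<comment> \<open>A derivative of \<open>h\<close> has only variables of \<open>h\<close>, and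
    these are among the generators of \<open>B\<close>.\<close>
  have pB: "coset g \<in> B"
  proof -
    have "g \<in> {s. coset s \<in> B}"
    proof (rule subring_contains_poly)
      fix i assume "i \<in> vars g"
      then have "i \<le> N" unfolding N_def g_def top_pd_def using vars_pd by (intro Max_ge) auto
      then show "xgen (Suc i) \<in> {s. coset s \<in> B}" using xB by simp
    next
      fix c show "const c \<in> {s. coset s \<in> B}"
        using Bs(7)[of c "\<one>\<^bsub>R\<^esub>"] Bs(2) by (simp add: R_simps)
    next
      fix s t assume "s \<in> {s. coset s \<in> B}" "t \<in> {s. coset s \<in> B}"
      then show "s + t \<in> {s. coset s \<in> B}" "s * t \<in> {s. coset s \<in> B}"
        using Bs(4,5)[of "coset s" "coset t"] by (simp_all add: R_simps)
    qed
    then show ?thesis by simp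
  qed
  interpret FP: poisson_algebra ?K F br by (rule frac_poisson)
  have embC: "frac_emb R ` carrier R \<subseteq> C"
    using T_UNIV by (auto simp: R_simps(1) q1 T_def)
  \<comment> \<open>Since all variables have been recovered, this larger set generates the same
    algebra, and brackets of its members are given by the quotient rule.\<close>
  let ?H = "range (\<lambda>s. q s 1) \<union> {q 1 g}"
  have H: "?H \<subseteq> carrier F" using gP by (auto simp: q_closed one_notin)
  have CH: "C = subalg_gen ?K F ?H"
    unfolding C_def
  proof (rule FA.subalg_gen_eqI[OF _ _ H])
    show "frac_emb R ` B \<union> {inv\<^bsub>F\<^esub> (frac_emb R (coset g))} \<subseteq> ?H"
      using Bs(1) q_inv[OF gP] by (auto simp: R_simps(1) q1)
    show "?H \<subseteq> subalg_gen ?K F (frac_emb R ` B \<union> {inv\<^bsub>F\<^esub> (frac_emb R (coset g))})"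
      using T_UNIV genC(2) by (auto simp: T_def C_def)
  qed
  have qC: "q s 1 \<in> C" for s using T_UNIV by (simp add: T_def)
  have brC: "br x y \<in> C" if "x \<in> C" "y \<in> C" for x y
  proof -
    have "br u v \<in> C" if "u \<in> ?H" "v \<in> ?H" for u v
    proof -
      have c: "br (q s 1) (q 1 g) \<in> C" for s
        using gP qC genC(2) by (simp add: br_q_inverse Cs)
      have "br (q 1 g) (q s 1) \<in> C" for s
        using c[of s] br_anti[of "q 1 g" "q s 1"] gP by (simp add: q_closed one_notin Cs)
      moreover have "br (q 1 g) (q 1 g) \<in> C" using gP Cs(3) by (simp add: br_alternating q_closed)
      ultimately show ?thesis using that c qC by (auto simp: br_q_one)
    qed
    then show ?thesis using FP.subalg_gen_br_closed[OF H] that unfolding CH by blast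
  qed
  have adj: "adjoin_inverse ?K R B (coset g) = F\<lparr>carrier := C\<rparr>"
    by (simp add: adjoin_inverse_def C_def)
  show ?thesis
  proof (rule that[of B "coset g"])
    show "fg_subalgebra ?K R B" using G by (auto simp: fg_subalgebra_def B_def)
    show "coset g \<in> B - {\<zero>\<^bsub>R\<^esub>}" using pB coset_nz[OF gP] by simp
    show "frac_emb R ` carrier R \<subseteq> carrier (adjoin_inverse ?K R B (coset g))"
      using embC by (simp add: adj)
    show "poisson_algebra ?K (adjoin_inverse ?K R B (coset g)) br"
      unfolding adj by (rule FP.poisson_restrict[OF Csub brC])
    show "frac_emb R \<in> poisson_hom ?K R (quot_bracket witt_sym witt_bracket P)
      (adjoin_inverse ?K R B (coset g)) br"
      using frac_emb_poisson embC unfolding adj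
      by (auto simp: poisson_hom_def alg_hom_def ring_hom_def)
  qed
qed

end

section \<open>The radical case: gluing over the strata\<close>

lemma infinite_imp_inj_triple:
  assumes "infinite (UNIV :: 'a set)"
  obtains j :: "nat \<times> 'a \<times> 'a \<Rightarrow> 'a" where "inj j"
proof -
  obtain e :: "nat \<Rightarrow> 'a" where e: "inj e"
    using infinite_countable_subset[OF assms] by blast
  have "\<exists>p. bij_betw p ((UNIV :: 'a set) \<times> (UNIV :: 'a set)) (UNIV :: 'a set)"
    using card_of_Times_same_infinite[OF assms] by (simp only: card_of_ordIso)
  then obtain p :: "'a \<times> 'a \<Rightarrow> 'a" where p: "inj p" by (auto dest: bij_betw_imp_inj_on)
  \<comment> \<open>The pairing is used twice, after the number has been replaced by an element of
    the infinite type.\<close>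
  have "inj (\<lambda>(n, x). p (e n, p x))"
    by (auto simp: inj_def dest!: injD[OF p] injD[OF e])
  then show ?thesis by (rule that)
qed

text \<open>\<open>level f P\<close> stratifies the Poisson primes \<open>P\<close> above the ideal; on each of the
  finitely many strata one derivative of \<open>f\<close> is inverted. The algebra \<open>A\<close> is generated,
  inside the product of all the fields of fractions, by finitely many variables and these
  inverses, extended by zero to the other strata.\<close>

theorem radical_poisson_embed:
  fixes I :: "'k::field_char_0 spoly set"
  assumes rad: "radical_ideal I witt_sym" and poi: "poisson_ideal I witt_sym witt_bracket"
    and ne: "I \<noteq> {0}"
  obtains A :: "('k, 'k spoly set) module" and br \<phi>
  where "fg_algebra ring_of_type_algebra A" "reduced A" "poisson_algebra ring_of_type_algebra A br"
    and "\<phi> \<in> poisson_hom ring_of_type_algebra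
      (quot_alg witt_sym I) (quot_bracket witt_sym witt_bracket I) A br"
    and "inj_on \<phi> (carrier (quot_alg witt_sym I))"
proof -
  let ?K = "ring_of_type_algebra :: 'k ring"
  have "0 \<in> I" using poi unfolding poisson_ideal_def ideal_witt_sym_iff by blast
  then obtain f where f: "f \<in> I" "f \<noteq> 0" using ne by blast
  obtain m c where mc: "c \<noteq> 0" "(top_pd ^^ m) f = const c"
    "\<And>k. k < m \<Longrightarrow> vars ((top_pd ^^ k) f) \<noteq> {}"
    using top_pd_chain[OF f(2)] by blast
  define Y where "Y = {P. poisson_prime P \<and> I \<subseteq> P}"
  define h where "h k = (top_pd ^^ k) f" for k
  have Y: "poisson_prime P" if "P \<in> Y" for P using that by (simp add: Y_def)
  have lev: "level f P < m" "h (level f P) \<in> P" "h (Suc (level f P)) \<notin> P" if "P \<in> Y" for P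
    using poisson_prime.level_props[OF Y[OF that] _ mc(1,2)] f(1) that by (auto simp: Y_def h_def)
  define Q where "Q = prod_alg Y (\<lambda>P. frac_alg (quot_alg witt_sym P) :: ('k, _) module)"
  define br where "br u v = (\<lambda>P\<in>Y. frac_bracket P (u P) (v P))" for u v
  define \<psi> where "\<psi> s = (\<lambda>P\<in>Y. qfrac P s 1)" for s
  define t where "t k = (\<lambda>P\<in>Y. if level f P = k then qfrac P 1 (h (Suc k))
    else \<zero>\<^bsub>(frac_alg (quot_alg witt_sym P) :: ('k, _) module)\<^esub>)" for k
  have K: "cring ?K" by (rule cring_from_type_algebra)
  interpret Q: poisson_algebra ?K Q br
    unfolding Q_def br_def
    by (rule prod_alg_poisson[OF K]) (use poisson_prime.frac_poisson[OF Y] in auto)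
  note Q_simps = prod_alg_simps[of Y "\<lambda>P. frac_alg (quot_alg witt_sym P) :: ('k, _) module", folded Q_def]
  have \<psi>: "\<psi> \<in> poisson_hom ?K witt_sym witt_bracket Q br"
    unfolding Q_def br_def \<psi>_def by (rule prod_alg_hom) (use poisson_prime.q_hom[OF Y] in auto)
  note \<psi>h = alg_homD[OF poisson_homD(1)[OF \<psi>], simplified] poisson_homD(2)[OF \<psi>, simplified]
  have t_closed: "t k \<in> carrier Q" for k
  proof -
    have "t k P \<in> carrier (frac_alg (quot_alg witt_sym P))" if P: "P \<in> Y" for P
    proof -
      interpret poisson_prime P by (rule Y[OF P])
      show ?thesis using lev[OF P] P by (auto simp: t_def q_closed)
    qed
    then show ?thesis by (auto simp: Q_simps t_def)
  qed
  \<comment> \<open>One bound serves all levels, since derivatives have no new variables. If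
    \<open>f\<close> is constant, then \<open>m = 0\<close>, \<open>I\<close> is the whole ring and
    \<open>Y\<close> is empty, so the unspecified value of \<open>N\<close> is harmless.\<close>
  define N where "N = Max (vars f)"
  define G where "G = (\<lambda>n. \<psi> (xgen n)) ` {1..2 * N + 2} \<union> t ` {..<m}"
  define C where "C = subalg_gen ?K Q G"
  have G: "finite G" "G \<subseteq> carrier Q" by (auto simp: G_def \<psi>h t_closed)
  have Csub: "is_subalgebra ?K Q C" unfolding C_def by (rule Q.subalg_gen_subalgebra[OF G(2)])
  note Cs = Q.is_subalgebraD[OF Csub]
  have GC: "G \<subseteq> C" unfolding C_def by (rule Q.subalg_gen_incl)
  have tC: "t k \<in> C" if "k < m" for k using GC that by (auto simp: G_def)

  define T where "T = {s. \<psi> s \<in> C}"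
  define M where "M k = {s. \<psi> s \<otimes>\<^bsub>Q\<^esub> t k \<in> C}" for k
  have Tc: "const c \<in> T" for c
    using Cs(2,7) \<psi>h(5)[of c 1] by (simp add: T_def \<psi>h)
  have Ta: "s + t \<in> T" and Tm: "s * t \<in> T" if "s \<in> T" "t \<in> T" for s t
    using that Cs by (auto simp: T_def \<psi>h)
  have TM: "T \<subseteq> M k" if "k < m" for k using Cs tC[OF that] by (auto simp: T_def M_def)
  have Ma: "s + t \<in> M k" if "s \<in> M k" "t \<in> M k" for s t k
    using that Cs by (auto simp: M_def \<psi>h Q.l_distr t_closed)
  have Mm: "s * t \<in> M k" if "s \<in> T" "t \<in> M k" for s t k
    using that Cs by (auto simp: T_def M_def \<psi>h Q.m_assoc t_closed)
  \<comment> \<open>On stratum \<open>k\<close> the polynomial \<open>h k\<close> lies in the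
    Poisson prime, so its bracket is zero there; on the other strata \<open>t k\<close> is
    zero.\<close>
  have br_M: "witt_bracket x (h k) \<in> M k" for x k
  proof -
    have "\<psi> (witt_bracket x (h k)) \<otimes>\<^bsub>Q\<^esub> t k = \<zero>\<^bsub>Q\<^esub>"
      unfolding Q_simps
    proof (rule restrict_ext)
      fix P assume P: "P \<in> Y"
      interpret poisson_prime P by (rule Y[OF P])
      show "\<psi> (witt_bracket x (h k)) P \<otimes>\<^bsub>F\<^esub> t k P = \<zero>\<^bsub>F\<^esub>"
      proof (cases "level f P = k")
        case True
        then have "q (witt_bracket x (h k)) 1 = \<zero>\<^bsub>F\<^esub>"
          using lev(2)[OF P] by (simp add: q_eq_zero_iff one_notin P_bracket')
        then show ?thesis using True lev(3)[OF P] P by (simp add: \<psi>_def t_def q_closed)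
      qed (use P in \<open>simp add: \<psi>_def t_def q_closed one_notin\<close>)
    qed
    then show ?thesis using Cs(3) by (simp add: M_def)
  qed
  \<comment> \<open>The product of \<open>t k\<close> and the image of \<open>h (Suc k)\<close> is
    the indicator of stratum \<open>k\<close>, so the image of \<open>s\<close> is a sum of
    \<open>m\<close> pieces, each in \<open>C\<close>. The partial sum \<open>e n\<close> agrees
    with it on levels below \<open>n\<close> and is zero elsewhere.\<close>
  have glue: "s \<in> T" if s: "\<And>k. k < m \<Longrightarrow> s * h (Suc k) \<in> M k" for s
  proof -
    define e where "e n = (\<lambda>P\<in>Y. if level f P < n then qfrac P s 1
      else \<zero>\<^bsub>(frac_alg (quot_alg witt_sym P) :: ('k, _) module)\<^esub>)" for n
    have "e n \<in> C" if "n \<le> m" for n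
      using that
    proof (induction n)
      case 0
      have "e 0 = \<zero>\<^bsub>Q\<^esub>" by (simp add: e_def Q_simps)
      then show ?case using Cs(3) by simp
    next
      case (Suc n)
      have "e (Suc n) = e n \<oplus>\<^bsub>Q\<^esub> \<psi> (s * h (Suc n)) \<otimes>\<^bsub>Q\<^esub> t n"
        unfolding e_def Q_simps
      proof (rule restrict_ext)
        fix P assume P: "P \<in> Y"
        interpret poisson_prime P by (rule Y[OF P])
        show "(if level f P < Suc n then q s 1 else \<zero>\<^bsub>F\<^esub>) =
          (\<lambda>P\<in>Y. if level f P < n then qfrac P s 1 else \<zero>\<^bsub>frac_alg (quot_alg witt_sym P)\<^esub>) P \<oplus>\<^bsub>F\<^esub>
          (\<lambda>P\<in>Y. \<psi> (s * h (Suc n)) P \<otimes>\<^bsub>frac_alg (quot_alg witt_sym P)\<^esub> t n P) P"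
        proof (cases "level f P = n")
          case True
          then have "h (Suc n) \<notin> P" using lev(3)[OF P] by simp
          moreover from this have "q (s * h (Suc n)) (h (Suc n)) = q s 1"
            by (simp add: q_eq_iff one_notin P_zero)
          ultimately show ?thesis
            using True P by (simp add: \<psi>_def t_def q_mult q_closed one_notin)
        next
          case False
          then show ?thesis
            using P by (auto simp: \<psi>_def t_def q_closed one_notin)
        qed
      qed
      then show ?case using Suc s[of n] Cs(4) by (simp add: M_def)
    qed
    from this[of m] have "e m \<in> C" by simp
    moreover have "e m = \<psi> s"
      unfolding e_def \<psi>_def by (rule restrict_ext) (simp add: lev)
    ultimately show ?thesis by (simp add: T_def)
  qed
  have xT: "xgen n \<in> T" if "n \<ge> 1" for n
    using that
  proof (induction n rule: less_induct)
    case (less n)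
    show ?case
    proof (cases "n \<le> 2 * N + 2")
      case True
      then show ?thesis using GC less.prems by (auto simp: G_def T_def)
    next
      case False
      show ?thesis
      proof (rule glue)
        fix k assume k: "k < m"
        define i where "i = n - Max (vars (h k)) - 2"
        have "Max (vars (h k)) \<le> N"
          unfolding N_def h_def using mc(3)[OF k] vars_top_pd_pow by (intro Max_mono) auto
        then have n: "n = i + Max (vars (h k)) + 2" and i: "i > Max (vars (h k))"
          using False by (auto simp: i_def)
        have "xgen (i + Max (vars (h k)) + 2) * top_pd (h k) \<in> M k"
        proof (rule xgen_mult_top_pd[OF Tc Ta Tm TM[OF k] Ma Mm])
          show "vars (h k) \<noteq> {}" using mc(3)[OF k] by (simp add: h_def)
          show "xgen l \<in> T" if "1 \<le> l" "l < i + Max (vars (h k)) + 2" for l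
            using that less.IH n by simp
        qed (use i br_M in auto)
        then show "xgen n * h (Suc k) \<in> M k" by (simp only: n h_def funpow.simps comp_def)
      qed
    qed
  qed
  have T_UNIV: "s \<in> T" for s
    by (induction s rule: spoly_induct) (simp_all add: Tc xT Ta Tm)
  then have \<psi>C: "\<psi> s \<in> C" for s by (simp add: T_def)

  let ?H = "range \<psi> \<union> t ` {..<m}"
  have H: "?H \<subseteq> carrier Q" using \<psi>h(1) t_closed by auto
  have CH: "C = subalg_gen ?K Q ?H"
    unfolding C_def
    by (rule Q.subalg_gen_eqI[OF _ _ H]) (use \<psi>C tC in \<open>auto simp: G_def C_def\<close>)
  have brC: "br x y \<in> C" if "x \<in> C" "y \<in> C" for x y
  proof -
    have st: "br (\<psi> s) (t k) = \<psi> (witt_bracket (h (Suc k)) s) \<otimes>\<^bsub>Q\<^esub> (t k \<otimes>\<^bsub>Q\<^esub> t k)" for s k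
      unfolding br_def Q_simps
    proof (rule restrict_ext)
      fix P assume P: "P \<in> Y"
      interpret poisson_prime P by (rule Y[OF P])
      interpret FP: poisson_algebra ?K F "frac_bracket P" by (rule frac_poisson)
      show "frac_bracket P (\<psi> s P) (t k P) =
        \<psi> (witt_bracket (h (Suc k)) s) P \<otimes>\<^bsub>F\<^esub> (\<lambda>P\<in>Y. t k P \<otimes>\<^bsub>frac_alg (quot_alg witt_sym P)\<^esub> t k P) P"
        using P lev(3)[OF P] FP.br_smult_right
        by (auto simp: \<psi>_def t_def br_q_inverse FP.br_zero q_closed one_notin)
    qed
    \<comment> \<open>For \<open>k \<noteq> l\<close> both sides vanish, as the strata are disjoint;
      for \<open>k = l\<close> the quotient rule applies on the stratum.\<close>
    have tt: "br (t k) (t l) = \<psi> (witt_bracket (h (Suc k)) (h (Suc l))) \<otimes>\<^bsub>Q\<^esub>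
      (t k \<otimes>\<^bsub>Q\<^esub> t k) \<otimes>\<^bsub>Q\<^esub> (t l \<otimes>\<^bsub>Q\<^esub> t l)" for k l
      unfolding br_def Q_simps
    proof (rule restrict_ext)
      fix P assume P: "P \<in> Y"
      interpret poisson_prime P by (rule Y[OF P])
      interpret FP: poisson_algebra ?K F "frac_bracket P" by (rule frac_poisson)
      have z: "frac_bracket P \<zero>\<^bsub>F\<^esub> x = \<zero>\<^bsub>F\<^esub>" if "x \<in> carrier F" for x
        using that FP.br_zero[of x] br_anti[of "\<zero>\<^bsub>F\<^esub>" x] by simp
      show "frac_bracket P (t k P) (t l P) =
        (\<lambda>P\<in>Y. \<psi> (witt_bracket (h (Suc k)) (h (Suc l))) P \<otimes>\<^bsub>frac_alg (quot_alg witt_sym P)\<^esub>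
          (\<lambda>P\<in>Y. t k P \<otimes>\<^bsub>frac_alg (quot_alg witt_sym P)\<^esub> t k P) P) P \<otimes>\<^bsub>F\<^esub>
        (\<lambda>P\<in>Y. t l P \<otimes>\<^bsub>frac_alg (quot_alg witt_sym P)\<^esub> t l P) P"
        using P lev(3)[OF P]
        by (auto simp: \<psi>_def t_def br_q_inverse FP.br_zero z q_closed one_notin)
    qed
    have "br u v \<in> C" if "u \<in> ?H" "v \<in> ?H" for u v
    proof -
      have c: "br (\<psi> s) (t k) \<in> C" if "k < m" for s k
        using that by (simp add: st \<psi>C tC Cs)
      have "br (t k) (\<psi> s) \<in> C" if "k < m" for s k
        using c[OF that, of s] Q.br_anti[of "t k" "\<psi> s"] by (simp add: t_closed \<psi>h Cs)
      moreover have "br (t k) (t l) \<in> C" if "k < m" "l < m" for k l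
        using that by (simp add: tt \<psi>C tC Cs)
      ultimately show ?thesis using that c \<psi>C by (auto simp flip: \<psi>h(6))
    qed
    then show ?thesis using Q.subalg_gen_br_closed[OF H] that unfolding CH by blast
  qed
  let ?A = "Q\<lparr>carrier := C\<rparr>"
  have fgA: "fg_algebra ?K ?A" unfolding C_def by (rule Q.fg_algebra_subalg_gen[OF G])
  have poA: "poisson_algebra ?K ?A br" by (rule Q.poisson_restrict[OF Csub brC])
  interpret A: poisson_algebra ?K ?A br by (rule poA)

  text \<open>To fit \<open>A\<close> into the type \<open>'k spoly set\<close>, an element is encoded by the set of all
    polynomial fractions representing it on the strata.\<close>

  define E where "E a = {(k, s, u). \<forall>P\<in>Y. level f P = k \<longrightarrow> u \<notin> P \<and> a P = qfrac P s u}" for a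
  \<comment> \<open>Every element of \<open>C\<close> has, on each stratum, one numerator and one
    denominator valid for all its primes. This holds for the generators and survives the algebra
    operations; on an empty stratum any pair will do.\<close>
  have "is_subalgebra ?K Q {a \<in> C. \<forall>k. \<exists>s u. (k, s, u) \<in> E a}"
  proof (rule Q.is_subalgebraI)
    show "{a \<in> C. \<forall>k. \<exists>s u. (k, s, u) \<in> E a} \<subseteq> carrier Q" using Cs(1) by blast
    have "(k, 1, 1) \<in> E \<one>\<^bsub>Q\<^esub>" for k
      using poisson_prime.q_one[OF Y] poisson_prime.one_notin[OF Y] by (simp add: E_def Q_simps)
    then show "\<one>\<^bsub>Q\<^esub> \<in> {a \<in> C. \<forall>k. \<exists>s u. (k, s, u) \<in> E a}" using Cs(2) by blast
  next
    fix a b assume ab: "a \<in> {a \<in> C. \<forall>k. \<exists>s u. (k, s, u) \<in> E a}" "b \<in> {a \<in> C. \<forall>k. \<exists>s u. (k, s, u) \<in> E a}"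
    have 1: "(k, s * v + r * u, u * v) \<in> E (a \<oplus>\<^bsub>Q\<^esub> b)" "(k, s * r, u * v) \<in> E (a \<otimes>\<^bsub>Q\<^esub> b)"
      if "(k, s, u) \<in> E a" "(k, r, v) \<in> E b" for k s u r v
      using that poisson_prime.q_add[OF Y] poisson_prime.q_mult[OF Y] poisson_prime.P_prime[OF Y]
      by (auto simp: E_def Q_simps)
    then show "a \<oplus>\<^bsub>Q\<^esub> b \<in> {a \<in> C. \<forall>k. \<exists>s u. (k, s, u) \<in> E a}"
      "a \<otimes>\<^bsub>Q\<^esub> b \<in> {a \<in> C. \<forall>k. \<exists>s u. (k, s, u) \<in> E a}"
      using ab Cs(4,5) by blast+
  next
    fix c a assume a: "c \<in> carrier ?K" "a \<in> {a \<in> C. \<forall>k. \<exists>s u. (k, s, u) \<in> E a}"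
    have "(k, const c * s, u) \<in> E (c \<odot>\<^bsub>Q\<^esub> a)" if "(k, s, u) \<in> E a" for k s u
      using that poisson_prime.q_smult[OF Y] by (auto simp: E_def Q_simps)
    then show "c \<odot>\<^bsub>Q\<^esub> a \<in> {a \<in> C. \<forall>k. \<exists>s u. (k, s, u) \<in> E a}" using a Cs(7) by blast
  qed
  moreover have "?H \<subseteq> {a \<in> C. \<forall>k. \<exists>s u. (k, s, u) \<in> E a}"
  proof -
    have "(k, s, 1) \<in> E (\<psi> s)" for k s
      using poisson_prime.one_notin[OF Y] by (simp add: E_def \<psi>_def)
    moreover have "(k, 1, h (Suc k)) \<in> E (t k)" for k
      using lev(3) by (auto simp: E_def t_def)
    moreover have "(k, 0, 1) \<in> E (t l)" if "k \<noteq> l" for k l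
      using that poisson_prime.q_zero[OF Y] poisson_prime.one_notin[OF Y] by (auto simp: E_def t_def)
    ultimately have "\<exists>s u. (k, s, u) \<in> E (\<psi> r)" "\<exists>s u. (k, s, u) \<in> E (t l)" for k r l
      by metis+
    then show ?thesis using \<psi>C tC by auto
  qed
  ultimately have "subalg_gen ?K Q ?H \<subseteq> {a \<in> C. \<forall>k. \<exists>s u. (k, s, u) \<in> E a}"
    by (rule Q.subalg_gen_min)
  then have enc: "\<exists>s u. (k, s, u) \<in> E a" if "a \<in> C" for a k
    using that CH by auto
  \<comment> \<open>At each prime, one common triple of its level already fixes the value
    there.\<close>
  have E_inj: "inj_on E C"
  proof (rule inj_onI)
    fix a b assume ab: "a \<in> C" "b \<in> C" "E a = E b"
    have "a P = b P" if P: "P \<in> Y" for P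
    proof -
      obtain s u where "(level f P, s, u) \<in> E a" using enc[OF ab(1)] by blast
      moreover from this ab(3) have "(level f P, s, u) \<in> E b" by simp
      ultimately show ?thesis using P by (simp add: E_def)
    qed
    then show "a = b"
      using PiE_ext[OF subsetD[OF Cs(1) ab(1), unfolded Q_simps]
          subsetD[OF Cs(1) ab(2), unfolded Q_simps]] by blast
  qed
  \<comment> \<open>Coding triples as single polynomials turns each set of triples into an element
    of the required type.\<close>
  obtain j :: "nat \<times> 'k spoly \<times> 'k spoly \<Rightarrow> 'k spoly" where j: "inj j"
    using infinite_imp_inj_triple[OF infinite_UNIV_char_0] .
  have \<iota>: "inj_on (\<lambda>a. j ` E a) (carrier ?A)"
    using inj_onD[OF E_inj] by (intro inj_onI) (simp add: inj_image_eq_iff[OF j])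
  let ?\<iota> = "\<lambda>a. j ` E a"
  note tr = transport_poisson[OF poA \<iota>]
  interpret tr: poisson_algebra ?K "transport_alg ?\<iota> ?A" "\<lambda>x y. ?\<iota> (br (inv_into C ?\<iota> x) (inv_into C ?\<iota> y))"
    using tr(1) by simp
  have \<psi>A: "\<psi> \<in> poisson_hom ?K witt_sym witt_bracket ?A br"
    using \<psi> \<psi>C by (auto simp: poisson_hom_def alg_hom_def ring_hom_def)
  have ker: "\<psi> s = \<zero>\<^bsub>Q\<^esub> \<longleftrightarrow> s \<in> I" for s
  proof -
    have "\<psi> s = \<zero>\<^bsub>Q\<^esub> \<longleftrightarrow> (\<forall>P\<in>Y. s \<in> P)"
      using poisson_prime.q_eq_zero_iff[OF Y poisson_prime.one_notin[OF Y]]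
      by (auto simp: \<psi>_def Q_simps restrict_def fun_eq_iff)
    \<comment> \<open>Here radicality makes the map injective modulo \<open>I\<close>: some Poisson
      prime above \<open>I\<close> avoids \<open>s\<close>.\<close>
    moreover have "\<exists>P\<in>Y. s \<notin> P" if "s \<notin> I"
      using radical_poisson_separation[OF rad poi that] by (metis (mono_tags) Y_def mem_Collect_eq poisson_prime.intro)
    ultimately show ?thesis by (auto simp: Y_def)
  qed
  have kerA: "?\<iota> (\<psi> s) = \<zero>\<^bsub>transport_alg ?\<iota> ?A\<^esub> \<longleftrightarrow> s \<in> I" for s
  proof -
    have "?\<iota> (\<psi> s) = ?\<iota> \<zero>\<^bsub>?A\<^esub> \<longleftrightarrow> \<psi> s = \<zero>\<^bsub>?A\<^esub>"
      using \<psi>C A.M.zero_closed by (intro inj_on_eq_iff[OF \<iota>]) auto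
    then show ?thesis
      using alg_hom_zero[OF poisson_homD(1)[OF tr(2)] A.algebra_axioms tr.algebra_axioms] by (simp add: ker)
  qed
  obtain \<phi> where \<phi>: "\<phi> \<in> poisson_hom ?K (quot_alg witt_sym I) (quot_bracket witt_sym witt_bracket I)
      (transport_alg ?\<iota> ?A) (\<lambda>x y. ?\<iota> (br (inv_into (carrier ?A) ?\<iota> x) (inv_into (carrier ?A) ?\<iota> y)))"
    "inj_on \<phi> (carrier (quot_alg witt_sym I))"
    using quot_alg_embed[OF witt_poisson_algebra poi tr.algebra_axioms
        poisson_hom_compose[OF \<psi>A tr(2)] kerA] by blast
  have "reduced Q"
    unfolding Q_def by (rule prod_alg_reduced) (use poisson_prime.frac_reduced[OF Y] in auto)
  moreover have "id \<in> alg_hom ?K ?A Q"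
    using Cs by (auto simp: alg_hom_def ring_hom_def)
  ultimately have redA: "reduced ?A"
    using reduced_alg_hom[OF _ inj_on_id A.algebra_axioms Q.algebra_axioms] by blast
  have "reduced (transport_alg ?\<iota> ?A)"
    by (rule transport_reduced[OF poA \<iota> redA])
  moreover have "fg_algebra ?K (transport_alg ?\<iota> ?A)"
    by (rule fg_algebra_image[OF poisson_homD(1)[OF tr(2)] tr(3) fgA tr.algebra_axioms])
  ultimately show ?thesis using that tr(1) \<phi> by blast
qed

text \<open>The purely algebraic assertions arise from the Poisson ones by forgetting the bracket,
  so the same \<open>A\<close>, \<open>B\<close> and \<open>p\<close> serve for both.\<close>

theorem lemma2p9:
  fixes I :: "'k::field_char_0 spoly set"
  assumes "poisson_ideal I witt_sym witt_bracket"
    and "radical_ideal I witt_sym"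
    and "I \<noteq> {\<zero>\<^bsub>(witt_sym :: ('k, 'k spoly) module)\<^esub>}"
  shows
    "(\<exists>(A :: ('k, 'k spoly set) module) \<phi>.
        fg_algebra ring_of_type_algebra A \<and> reduced A
      \<and> \<phi> \<in> alg_hom ring_of_type_algebra (quot_alg witt_sym I) A
      \<and> inj_on \<phi> (carrier (quot_alg witt_sym I)))
   \<and> (primeideal I witt_sym \<longrightarrow>
       (\<exists>B p. fg_subalgebra ring_of_type_algebra (quot_alg witt_sym I) B
          \<and> p \<in> B - {\<zero>\<^bsub>quot_alg witt_sym I\<^esub>}
          \<and> frac_emb (quot_alg witt_sym I) ` carrier (quot_alg witt_sym I)
              \<subseteq> carrier (adjoin_inverse ring_of_type_algebra (quot_alg witt_sym I) B p)))
   \<and> (\<exists>(A :: ('k, 'k spoly set) module) br \<phi>.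
        fg_algebra ring_of_type_algebra A \<and> reduced A
      \<and> poisson_algebra ring_of_type_algebra A br
      \<and> \<phi> \<in> poisson_hom ring_of_type_algebra
              (quot_alg witt_sym I) (quot_bracket witt_sym witt_bracket I) A br
      \<and> inj_on \<phi> (carrier (quot_alg witt_sym I)))
   \<and> (primeideal I witt_sym \<longrightarrow>
       (\<exists>B p br. fg_subalgebra ring_of_type_algebra (quot_alg witt_sym I) B
          \<and> p \<in> B - {\<zero>\<^bsub>quot_alg witt_sym I\<^esub>}
          \<and> frac_emb (quot_alg witt_sym I) ` carrier (quot_alg witt_sym I)
              \<subseteq> carrier (adjoin_inverse ring_of_type_algebra (quot_alg witt_sym I) B p)
          \<and> poisson_algebra ring_of_type_algebra
               (adjoin_inverse ring_of_type_algebra (quot_alg witt_sym I) B p) br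
          \<and> frac_emb (quot_alg witt_sym I)
              \<in> poisson_hom ring_of_type_algebra
                  (quot_alg witt_sym I) (quot_bracket witt_sym witt_bracket I)
                  (adjoin_inverse ring_of_type_algebra (quot_alg witt_sym I) B p) br))"
proof -
  have ne: "I \<noteq> {0}" using assms(3) by simp
  have "0 \<in> I" using assms(1) unfolding poisson_ideal_def ideal_witt_sym_iff by blast
  then obtain f where f: "f \<in> I" "f \<noteq> 0" using ne by blast
  obtain A :: "('k, 'k spoly set) module" and br \<phi>
    where A: "fg_algebra ring_of_type_algebra A" "reduced A" "poisson_algebra ring_of_type_algebra A br"
    and \<phi>: "\<phi> \<in> poisson_hom ring_of_type_algebra
      (quot_alg witt_sym I) (quot_bracket witt_sym witt_bracket I) A br"
      "inj_on \<phi> (carrier (quot_alg witt_sym I))"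
    using radical_poisson_embed[OF assms(2,1) ne] .
  have b: "\<exists>B p br. fg_subalgebra ring_of_type_algebra (quot_alg witt_sym I) B
          \<and> p \<in> B - {\<zero>\<^bsub>quot_alg witt_sym I\<^esub>}
          \<and> frac_emb (quot_alg witt_sym I) ` carrier (quot_alg witt_sym I)
              \<subseteq> carrier (adjoin_inverse ring_of_type_algebra (quot_alg witt_sym I) B p)
          \<and> poisson_algebra ring_of_type_algebra
               (adjoin_inverse ring_of_type_algebra (quot_alg witt_sym I) B p) br
          \<and> frac_emb (quot_alg witt_sym I)
              \<in> poisson_hom ring_of_type_algebra
                  (quot_alg witt_sym I) (quot_bracket witt_sym witt_bracket I)
                  (adjoin_inverse ring_of_type_algebra (quot_alg witt_sym I) B p) br"
    if "primeideal I witt_sym"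
  proof -
    interpret poisson_prime I using that assms(1) by (rule poisson_prime.intro)
    show ?thesis using finite_localisation[OF f] by metis
  qed
  show ?thesis
    using A \<phi> poisson_homD(1)[OF \<phi>(1)] b by (intro conjI impI) (blast | metis)+
qed

end
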